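(* Let $\nu$ be an uncountable limit cardinal such that $\lambda:=\operatorname{cf}(\nu)$ is weakly compact, in the sense that every chain of cardinality $\lambda$ contains either a chain of order type $\lambda$ or a chain of order type $\lambda^*$. For a family $K=(\kappa_{\alpha}^+)_{\alpha<\lambda}$ of distinct infinite successor cardinals, all less than $\nu$, with $\bigvee\{\kappa_\alpha^+:\alpha<\lambda\}=\nu$, put $$Q_1(K):=\sum_{\alpha\in\lambda}[\kappa_\alpha^+]^2,\qquad Q_2(K):=\sum_{\alpha\in\lambda^*}[\kappa_\alpha^+]^2,\qquad Q_3(K):=Q_1(K)^*,\qquad Q_4(K):=Q_2(K)^*.$$ Then: (a) for any two such families $K,K'$ and each $i\in\{1,2,3,4\}$, the posets $Q_i(K)$ and $Q_i(K')$ are equimorphic; (b) for every such family $K$, the posets $Q_1(K),Q_2(K),Q_3(K),Q_4(K)$ are pairwise non-equimorphic; (c) for every such family $K$ and every poset $P$ with no infinite antichain, $\operatorname{Cov}(P)\geq\nu$ if and only if at least one of $Q_1(K),Q_2(K),Q_3(K),Q_4(K)$ is embeddable in $P$.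
   Context: The chain covering number $\operatorname{Cov}(P)$ of a poset $P$ is the least cardinal number of chains needed to cover the underlying set of $P$. A poset $P$ is embeddable in a poset $P'$ if $P$ is isomorphic to the poset induced by $P'$ on some subset; two posets are equimorphic if each is embeddable in the other. The dual $P^*$ of $P$ is the same set with the opposite order; $\lambda^*$ is the dual of the chain $\lambda$. For an infinite ordinal $\mu$, $[\mu]^2:=\{(\alpha,\beta):\alpha<\beta<\mu\}$ is ordered by $(\alpha,\beta)\leq(\alpha',\beta')$ iff $\alpha\leq\alpha'$ and $\beta\leq\beta'$. $\kappa^+$ is the successor cardinal of $\kappa$, $\operatorname{cf}(\nu)$ is the cofinality of $\nu$, $\bigvee$ is the supremum of a set of cardinals. For a chain $C$ and posets $Q_\alpha$ ($\alpha\in C$), $\sum_{\alpha\in C}Q_\alpha$ is the lexicographical sum: the disjoint union of the $Q_\alpha$, where $x\in Q_\alpha$ is below $y\in Q_\beta$ iff either $\alpha<\beta$ in $C$, or $\alpha=\beta$ and $x\leq y$ in $Q_\alpha$. *)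

theory Defs
  imports Main
begin

unbundle cardinal_syntax

text \<open>
  Posets, chains and well-orders are reflexive relations \<open>r\<close> whose underlying set is
  \<^term>\<open>Field r\<close>, as in the library's theory of cardinals; the dual of \<open>r\<close> is \<open>r\<inverse>\<close>.
  An infinite cardinal is a well-order satisfying \<^const>\<open>card_order_on\<close> (an initial ordinal),
  so it also serves as an index chain. Equality of cardinals is \<open>=o\<close>.
\<close>

text \<open>
  The library's \<^const>\<open>iso\<close> is defined through initial segments, but by \<open>iso_iff2\<close> it is the usual
  notion of isomorphism for arbitrary relations (unlike \<^const>\<open>embed\<close>, which must not be used here).
\<close>

definition embeddable :: "'a rel \<Rightarrow> 'b rel \<Rightarrow> bool" where
  "embeddable P P' \<longleftrightarrow> (\<exists>S \<subseteq> Field P'. \<exists>f. iso P (Restr P' S) f)"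

definition equimorphic :: "'a rel \<Rightarrow> 'b rel \<Rightarrow> bool" where
  "equimorphic P P' \<longleftrightarrow> embeddable P P' \<and> embeddable P' P"

definition antichain :: "'a rel \<Rightarrow> 'a set \<Rightarrow> bool" where
  "antichain P A \<longleftrightarrow>
     A \<subseteq> Field P \<and> (\<forall>x\<in>A. \<forall>y\<in>A. x \<noteq> y \<longrightarrow> (x, y) \<notin> P \<and> (y, x) \<notin> P)"

definition chain_cover :: "'a rel \<Rightarrow> 'a set set \<Rightarrow> bool" where
  "chain_cover P \<C> \<longleftrightarrow> \<C> \<subseteq> Chains P \<and> \<Union>\<C> = Field P"

definition Cov :: "'a rel \<Rightarrow> 'a set rel" where
  "Cov P = |SOME \<C>. chain_cover P \<C> \<and> (\<forall>\<D>. chain_cover P \<D> \<longrightarrow> |\<C>| \<le>o |\<D>| )|"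

definition cofinal_in :: "'a set \<Rightarrow> 'a rel \<Rightarrow> bool" where
  "cofinal_in A r \<longleftrightarrow> A \<subseteq> Field r \<and> (\<forall>a\<in>Field r. \<exists>b\<in>A. (a, b) \<in> r)"

definition cf :: "'a rel \<Rightarrow> 'a rel" where
  "cf r = |SOME A. cofinal_in A r \<and> (\<forall>B. cofinal_in B r \<longrightarrow> |A| \<le>o |B| )|"

lemma ex_min_card_of:
  fixes \<Phi> :: "'a set \<Rightarrow> bool"
  assumes "\<Phi> X"
  shows "\<exists>A. \<Phi> A \<and> (\<forall>B. \<Phi> B \<longrightarrow> |A| \<le>o |B| )"
proof -
  have "card_of ` Collect \<Phi> \<noteq> {}" using assms by blast
  moreover have "\<forall>r \<in> card_of ` Collect \<Phi>. Card_order r" by (auto simp: card_of_Card_order)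
  ultimately have "\<exists>r \<in> card_of ` Collect \<Phi>. \<forall>r' \<in> card_of ` Collect \<Phi>. r \<le>o r'"
    by (rule exists_minim_Card_order)
  then show ?thesis by auto
qed

lemma Cov_least:
  assumes "Partial_order P"
  shows "\<exists>\<C>. chain_cover P \<C> \<and> Cov P = |\<C>|"
    and "chain_cover P \<D> \<Longrightarrow> Cov P \<le>o |\<D>|"
proof -
  let ?min = "\<lambda>\<C>. chain_cover P \<C> \<and> (\<forall>\<D>. chain_cover P \<D> \<longrightarrow> |\<C>| \<le>o |\<D>| )"
  have "Refl P" using assms by (simp add: partial_order_on_def preorder_on_def)
  then have "chain_cover P ((\<lambda>x. {x}) ` Field P)"
    by (auto simp: chain_cover_def Chains_def refl_on_def)
  then have *: "?min (SOME \<C>. ?min \<C>)" by (intro someI_ex[of ?min] ex_min_card_of)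
  show "\<exists>\<C>. chain_cover P \<C> \<and> Cov P = |\<C>|" unfolding Cov_def using * by blast
  show "chain_cover P \<D> \<Longrightarrow> Cov P \<le>o |\<D>|" unfolding Cov_def using * by blast
qed

lemma cf_least:
  assumes "Refl r"
  shows "\<exists>A. cofinal_in A r \<and> cf r = |A|"
    and "cofinal_in B r \<Longrightarrow> cf r \<le>o |B|"
proof -
  let ?min = "\<lambda>A. cofinal_in A r \<and> (\<forall>B. cofinal_in B r \<longrightarrow> |A| \<le>o |B| )"
  have "cofinal_in (Field r) r" using assms by (auto simp: cofinal_in_def refl_on_def)
  then have *: "?min (SOME A. ?min A)" by (intro someI_ex[of ?min] ex_min_card_of)
  show "\<exists>A. cofinal_in A r \<and> cf r = |A|" unfolding cf_def using * by blast
  show "cofinal_in B r \<Longrightarrow> cf r \<le>o |B|" unfolding cf_def using * by blast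
qed

text \<open>
  Below, a bound variable ranging over cardinals smaller than \<open>\<nu> :: 'a rel\<close>, or over chains of the
  cardinality of \<open>\<lambda> :: 'a rel\<close>, has type \<open>'a rel\<close>; every such cardinal or chain (over any type) has
  an isomorphic copy on a subset of \<open>Field \<nu>\<close>, respectively \<open>Field \<lambda>\<close>.
\<close>

definition limit_cardinal :: "'a rel \<Rightarrow> bool" where
  "limit_cardinal \<nu> \<longleftrightarrow>
     Card_order \<nu> \<and> Field \<nu> \<noteq> {} \<and>
     (\<forall>\<mu> :: 'a rel. Card_order \<mu> \<and> \<mu> <o \<nu> \<longrightarrow> cardSuc \<mu> <o \<nu>)"

definition weakly_compact :: "'a rel \<Rightarrow> bool" where
  "weakly_compact lam \<longleftrightarrow>
     (\<forall>C :: 'a rel. Linear_order C \<and> |Field C| =o lam \<longrightarrow>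
        embeddable lam C \<or> embeddable (lam\<inverse>) C)"

definition is_card_Sup :: "'a rel \<Rightarrow> 'i set \<Rightarrow> ('i \<Rightarrow> 'k rel) \<Rightarrow> bool" where
  "is_card_Sup \<nu> I \<mu> \<longleftrightarrow>
     (\<forall>i\<in>I. \<mu> i \<le>o \<nu>) \<and>
     (\<forall>\<rho> :: 'a rel. Card_order \<rho> \<and> (\<forall>i\<in>I. \<mu> i \<le>o \<rho>) \<longrightarrow> \<nu> \<le>o \<rho>)"

text \<open>
  The family \<open>K = (\<kappa>\<^sub>\<alpha>\<^sup>+)\<close>, \<open>\<alpha> < \<lambda>\<close>, is given by the cardinals \<open>\<kappa> \<alpha>\<close>, \<open>\<alpha> \<in> Field \<lambda>\<close>.
\<close>

definition succ_family :: "'l rel \<Rightarrow> 'a rel \<Rightarrow> ('l \<Rightarrow> 'k rel) \<Rightarrow> bool" where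
  "succ_family lam \<nu> \<kappa> \<longleftrightarrow>
     (\<forall>\<alpha>\<in>Field lam. Card_order (\<kappa> \<alpha>) \<and> cinfinite (cardSuc (\<kappa> \<alpha>)) \<and> cardSuc (\<kappa> \<alpha>) <o \<nu>) \<and>
     (\<forall>\<alpha>\<in>Field lam. \<forall>\<beta>\<in>Field lam. \<alpha> \<noteq> \<beta> \<longrightarrow> \<not> cardSuc (\<kappa> \<alpha>) =o cardSuc (\<kappa> \<beta>)) \<and>
     is_card_Sup \<nu> (Field lam) (\<lambda>\<alpha>. cardSuc (\<kappa> \<alpha>))"

definition incr_pairs :: "'a rel \<Rightarrow> ('a \<times> 'a) rel" where
  "incr_pairs \<mu> =
     {((\<alpha>, \<beta>), (\<alpha>', \<beta>')). (\<alpha>, \<beta>) \<in> \<mu> - Id \<and> (\<alpha>', \<beta>') \<in> \<mu> - Id \<and>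
        (\<alpha>, \<alpha>') \<in> \<mu> \<and> (\<beta>, \<beta>') \<in> \<mu>}"

definition lex_sum :: "'i rel \<Rightarrow> ('i \<Rightarrow> 'q rel) \<Rightarrow> ('i \<times> 'q) rel" where
  "lex_sum C Q =
     {((\<alpha>, x), (\<beta>, y)). \<alpha> \<in> Field C \<and> x \<in> Field (Q \<alpha>) \<and> \<beta> \<in> Field C \<and> y \<in> Field (Q \<beta>) \<and>
        ((\<alpha>, \<beta>) \<in> C - Id \<or> \<alpha> = \<beta> \<and> (x, y) \<in> Q \<alpha>)}"

lemma Field_incr_pairs:
  assumes "Refl \<mu>"
  shows "Field (incr_pairs \<mu>) = \<mu> - Id"
proof -
  have "(p, p) \<in> incr_pairs \<mu>" if "p \<in> \<mu> - Id" for p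
    using that assms by (cases p) (auto simp: incr_pairs_def refl_on_def Field_def)
  moreover have "Field (incr_pairs \<mu>) \<subseteq> \<mu> - Id" by (auto simp: incr_pairs_def Field_def)
  ultimately show ?thesis by (auto intro: FieldI1)
qed

lemma Field_lex_sum:
  assumes "\<And>\<alpha>. \<alpha> \<in> Field C \<Longrightarrow> Refl (Q \<alpha>)"
  shows "Field (lex_sum C Q) = (SIGMA \<alpha>:Field C. Field (Q \<alpha>))"
proof -
  have "(p, p) \<in> lex_sum C Q" if "p \<in> (SIGMA \<alpha>:Field C. Field (Q \<alpha>))" for p
    using that assms by (auto simp: lex_sum_def refl_on_def)
  moreover have "Field (lex_sum C Q) \<subseteq> (SIGMA \<alpha>:Field C. Field (Q \<alpha>))"
    by (auto simp: lex_sum_def Field_def)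
  ultimately show ?thesis by (auto intro: FieldI1)
qed

definition Q1 :: "'l rel \<Rightarrow> ('l \<Rightarrow> 'k rel) \<Rightarrow> ('l \<times> 'k set \<times> 'k set) rel" where
  "Q1 lam \<kappa> = lex_sum lam (\<lambda>\<alpha>. incr_pairs (cardSuc (\<kappa> \<alpha>)))"

definition Q2 :: "'l rel \<Rightarrow> ('l \<Rightarrow> 'k rel) \<Rightarrow> ('l \<times> 'k set \<times> 'k set) rel" where
  "Q2 lam \<kappa> = lex_sum (lam\<inverse>) (\<lambda>\<alpha>. incr_pairs (cardSuc (\<kappa> \<alpha>)))"

definition Q3 :: "'l rel \<Rightarrow> ('l \<Rightarrow> 'k rel) \<Rightarrow> ('l \<times> 'k set \<times> 'k set) rel" where
  "Q3 lam \<kappa> = (Q1 lam \<kappa>)\<inverse>"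

definition Q4 :: "'l rel \<Rightarrow> ('l \<Rightarrow> 'k rel) \<Rightarrow> ('l \<times> 'k set \<times> 'k set) rel" where
  "Q4 lam \<kappa> = (Q2 lam \<kappa>)\<inverse>"

end

theory Submission
  imports Defs
begin

text \<open>
  Call a set small if it is covered by few chains. In a poset without infinite antichains, if every
  large subset contained a point incomparable to a large part of it, iterating would give an
  infinite antichain. So on some large set all sets of points incomparable to a given one are
  small, and then ``\<open>x\<close> and \<open>y\<close> are incomparable or the interval between them is small'' is an
  equivalence relation whose classes are lexicographically ordered. Hence there is either a large
  set in which the complement of every principal filter (or of every principal ideal) is small, or
  a large lexicographical sum of small sets along a chain.

  For the ideal of sets covered by \<open>\<kappa>\<close> chains the sum is itself small, and the first alternative
  yields \<open>[\<kappa>\<^sup>+]\<^sup>2\<close> or its dual: above every point there is an unbounded chain capped by some further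
  point, and \<open>\<kappa>\<^sup>+\<close> such chains, chosen so that later ones dominate earlier ones, form the rows.
  For the ideal of sets covered by fewer than \<open>\<nu>\<close> chains, the first alternative provides \<open>\<lambda>\<close>
  consecutive intervals with covering numbers unbounded in \<open>\<nu>\<close>, and the sum provides \<open>\<lambda>\<close> blocks,
  which weak compactness arranges in type \<open>\<lambda>\<close> or \<open>\<lambda>\<^sup>*\<close>; each interval or block contains a copy of
  \<open>[\<kappa>\<^sup>+]\<^sup>2\<close> or of its dual.
\<close>

section \<open>Embeddings\<close>

lemma embeddable_iff:
  "embeddable R P \<longleftrightarrow>
     (\<exists>f. f ` Field R \<subseteq> Field P \<and> inj_on f (Field R) \<and>
        (\<forall>x\<in>Field R. \<forall>y\<in>Field R. (x, y) \<in> R \<longleftrightarrow> (f x, f y) \<in> P))"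
proof
  assume "embeddable R P"
  then obtain S f where S: "S \<subseteq> Field P" and f: "iso R (Restr P S) f"
    unfolding embeddable_def by blast
  from f have bij: "bij_betw f (Field R) (Field (Restr P S))"
    and rel: "\<And>x y. x \<in> Field R \<Longrightarrow> y \<in> Field R \<Longrightarrow> (x, y) \<in> R \<longleftrightarrow> (f x, f y) \<in> Restr P S"
    unfolding iso_iff2 by blast+
  have sub: "f ` Field R \<subseteq> S" using bij Field_Restr_subset[of P S] unfolding bij_betw_def by blast
  then have "(f x, f y) \<in> Restr P S \<longleftrightarrow> (f x, f y) \<in> P" if "x \<in> Field R" "y \<in> Field R" for x y
    using that by auto
  then show "\<exists>f. f ` Field R \<subseteq> Field P \<and> inj_on f (Field R) \<and>
        (\<forall>x\<in>Field R. \<forall>y\<in>Field R. (x, y) \<in> R \<longleftrightarrow> (f x, f y) \<in> P)"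
    using sub S bij rel unfolding bij_betw_def by (intro exI[of _ f]) auto
next
  assume "\<exists>f. f ` Field R \<subseteq> Field P \<and> inj_on f (Field R) \<and>
        (\<forall>x\<in>Field R. \<forall>y\<in>Field R. (x, y) \<in> R \<longleftrightarrow> (f x, f y) \<in> P)"
  then obtain f where f: "f ` Field R \<subseteq> Field P" "inj_on f (Field R)"
    and rel: "\<And>x y. x \<in> Field R \<Longrightarrow> y \<in> Field R \<Longrightarrow> (x, y) \<in> R \<longleftrightarrow> (f x, f y) \<in> P" by blast
  have "Field (Restr P (f ` Field R)) = f ` Field R"
  proof
    show "f ` Field R \<subseteq> Field (Restr P (f ` Field R))"
    proof
      fix y assume "y \<in> f ` Field R"
      then obtain x where x: "x \<in> Field R" "y = f x" by blast
      then obtain x' where x': "x' \<in> Field R" "(x, x') \<in> R \<or> (x', x) \<in> R"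
        unfolding Field_def by blast
      then have "(f x, f x') \<in> Restr P (f ` Field R) \<or> (f x', f x) \<in> Restr P (f ` Field R)"
        using x rel by auto
      then show "y \<in> Field (Restr P (f ` Field R))" using x unfolding Field_def by blast
    qed
  qed (rule Field_Restr_subset)
  then have "iso R (Restr P (f ` Field R)) f"
    unfolding iso_iff2 bij_betw_def using f rel by auto
  then show "embeddable R P" unfolding embeddable_def using f(1) by blast
qed

lemma embeddable_converse: "embeddable (R\<inverse>) (P\<inverse>) \<longleftrightarrow> embeddable R P"
proof -
  have "(\<forall>x\<in>A. \<forall>y\<in>A. (y, x) \<in> R \<longleftrightarrow> (f y, f x) \<in> P) \<longleftrightarrow>
        (\<forall>x\<in>A. \<forall>y\<in>A. (x, y) \<in> R \<longleftrightarrow> (f x, f y) \<in> P)" for f and A by blast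
  then show ?thesis unfolding embeddable_iff by simp
qed

definition embeds_into :: "'a rel \<Rightarrow> 'b rel \<Rightarrow> 'b set \<Rightarrow> bool" where
  "embeds_into R P A \<longleftrightarrow>
     (\<exists>f. f ` Field R \<subseteq> A \<and> (\<forall>x\<in>Field R. \<forall>y\<in>Field R. (x, y) \<in> R \<longleftrightarrow> (f x, f y) \<in> P))"

lemma embeds_intoI:
  assumes "\<And>x. x \<in> Field R \<Longrightarrow> f x \<in> A"
    and "\<And>x y. x \<in> Field R \<Longrightarrow> y \<in> Field R \<Longrightarrow> (x, y) \<in> R \<longleftrightarrow> (f x, f y) \<in> P"
  shows "embeds_into R P A"
  unfolding embeds_into_def by (intro exI[of _ f]) (auto simp: assms)

lemma embeddable_iff_embeds_into:
  assumes "antisym R" "Refl P"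
  shows "embeddable R P \<longleftrightarrow> embeds_into R P (Field P)"
proof
  assume "embeds_into R P (Field P)"
  then obtain f where f: "f ` Field R \<subseteq> Field P"
    and rel: "\<forall>x\<in>Field R. \<forall>y\<in>Field R. (x, y) \<in> R \<longleftrightarrow> (f x, f y) \<in> P"
    unfolding embeds_into_def by blast
  have "inj_on f (Field R)"
  proof (rule inj_onI)
    fix x y assume xy: "x \<in> Field R" "y \<in> Field R" "f x = f y"
    then have "(f x, f x) \<in> P" using f assms(2) by (auto simp: refl_on_def)
    then have "(x, y) \<in> R" "(y, x) \<in> R" using rel xy by auto
    then show "x = y" using assms(1) by (simp add: antisym_def)
  qed
  then show "embeddable R P" unfolding embeddable_iff using f rel by blast
qed (auto simp only: embeddable_iff embeds_into_def)

lemma embeds_into_mono: "embeds_into R P A \<Longrightarrow> A \<subseteq> B \<Longrightarrow> embeds_into R P B"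
  unfolding embeds_into_def by (meson order_trans)

lemma embeds_into_trans:
  assumes "embeds_into R S (Field S)" "embeds_into S P A"
  shows "embeds_into R P A"
proof -
  from assms(1) obtain f where f: "f ` Field R \<subseteq> Field S"
    "\<forall>x\<in>Field R. \<forall>y\<in>Field R. (x, y) \<in> R \<longleftrightarrow> (f x, f y) \<in> S"
    unfolding embeds_into_def by blast
  from assms(2) obtain g where g: "g ` Field S \<subseteq> A"
    "\<forall>x\<in>Field S. \<forall>y\<in>Field S. (x, y) \<in> S \<longleftrightarrow> (g x, g y) \<in> P"
    unfolding embeds_into_def by blast
  show ?thesis by (rule embeds_intoI[of _ "g \<circ> f"]) (use f g in \<open>auto simp: image_subset_iff\<close>)
qed

lemma embeds_into_converse: "embeds_into (R\<inverse>) (P\<inverse>) A \<longleftrightarrow> embeds_into R P A"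
proof -
  have "(\<forall>x\<in>A. \<forall>y\<in>A. (y, x) \<in> R \<longleftrightarrow> (f y, f x) \<in> P) \<longleftrightarrow>
        (\<forall>x\<in>A. \<forall>y\<in>A. (x, y) \<in> R \<longleftrightarrow> (f x, f y) \<in> P)" for f and A by blast
  then show ?thesis unfolding embeds_into_def by simp
qed

lemma embeds_into_lex_sum:
  assumes Q: "\<And>\<alpha>. \<alpha> \<in> Field C \<Longrightarrow> Refl (Q \<alpha>)"
    and C: "Linear_order C"
    and P: "antisym P"
    and emb: "\<And>\<alpha>. \<alpha> \<in> Field C \<Longrightarrow> embeds_into (Q \<alpha>) P (D \<alpha>)"
    and less: "\<And>\<alpha> \<beta> x y. (\<alpha>, \<beta>) \<in> C - Id \<Longrightarrow> x \<in> D \<alpha> \<Longrightarrow> y \<in> D \<beta> \<Longrightarrow> (x, y) \<in> P - Id"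
  shows "embeds_into (lex_sum C Q) P (\<Union>\<alpha>\<in>Field C. D \<alpha>)"
proof -
  have "\<forall>\<alpha>. \<exists>f. \<alpha> \<in> Field C \<longrightarrow> f ` Field (Q \<alpha>) \<subseteq> D \<alpha> \<and>
      (\<forall>x\<in>Field (Q \<alpha>). \<forall>y\<in>Field (Q \<alpha>). (x, y) \<in> Q \<alpha> \<longleftrightarrow> (f x, f y) \<in> P)"
    using emb unfolding embeds_into_def by simp
  then obtain f where f: "\<And>\<alpha> x. \<alpha> \<in> Field C \<Longrightarrow> x \<in> Field (Q \<alpha>) \<Longrightarrow> f \<alpha> x \<in> D \<alpha>"
    and rel: "\<And>\<alpha> x y. \<alpha> \<in> Field C \<Longrightarrow> x \<in> Field (Q \<alpha>) \<Longrightarrow> y \<in> Field (Q \<alpha>) \<Longrightarrow>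
        (x, y) \<in> Q \<alpha> \<longleftrightarrow> (f \<alpha> x, f \<alpha> y) \<in> P"
    unfolding image_subset_iff by metis
  have F: "Field (lex_sum C Q) = (SIGMA \<alpha>:Field C. Field (Q \<alpha>))" using Q by (rule Field_lex_sum)
  have tot: "\<alpha> = \<beta> \<or> (\<alpha>, \<beta>) \<in> C - Id \<or> (\<beta>, \<alpha>) \<in> C - Id" if "\<alpha> \<in> Field C" "\<beta> \<in> Field C" for \<alpha> \<beta>
    using C that unfolding linear_order_on_def total_on_def by auto
  have asym: "(\<beta>, \<alpha>) \<notin> C - Id" if "(\<alpha>, \<beta>) \<in> C - Id" for \<alpha> \<beta>
    using C that unfolding linear_order_on_def partial_order_on_def antisym_def by blast
  show ?thesis
  proof (rule embeds_intoI[where f = "\<lambda>(\<alpha>, x). f \<alpha> x"])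
    fix p q assume "p \<in> Field (lex_sum C Q)" "q \<in> Field (lex_sum C Q)"
    then obtain \<alpha> x \<beta> y where p: "p = (\<alpha>, x)" "\<alpha> \<in> Field C" "x \<in> Field (Q \<alpha>)"
      and q: "q = (\<beta>, y)" "\<beta> \<in> Field C" "y \<in> Field (Q \<beta>)" unfolding F by blast
    have D: "f \<alpha> x \<in> D \<alpha>" "f \<beta> y \<in> D \<beta>" using f p q by blast+
    have "(p, q) \<in> lex_sum C Q \<longleftrightarrow> (\<alpha>, \<beta>) \<in> C - Id \<or> \<alpha> = \<beta> \<and> (x, y) \<in> Q \<alpha>"
      unfolding lex_sum_def using p q by auto
    also have "\<dots> \<longleftrightarrow> (f \<alpha> x, f \<beta> y) \<in> P"
    proof (cases "\<alpha> = \<beta>")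
      case True
      then show ?thesis using rel p q by auto
    next
      case False
      with tot p q consider "(\<alpha>, \<beta>) \<in> C - Id" | "(\<beta>, \<alpha>) \<in> C - Id" by blast
      then show ?thesis
      proof cases
        case 1
        then show ?thesis using less[OF 1 D] by blast
      next
        case 2
        then have "(f \<beta> y, f \<alpha> x) \<in> P - Id" using less D by blast
        then have "(f \<alpha> x, f \<beta> y) \<notin> P" using P unfolding antisym_def by blast
        then show ?thesis using asym[OF 2] False by blast
      qed
    qed
    finally show "(p, q) \<in> lex_sum C Q \<longleftrightarrow> (case p of (\<alpha>, x) \<Rightarrow> f \<alpha> x, case q of (\<alpha>, x) \<Rightarrow> f \<alpha> x) \<in> P"
      using p q by simp
  qed (use F f in auto)
qed

lemma converse_lex_sum: "(lex_sum C Q)\<inverse> = lex_sum (C\<inverse>) (\<lambda>\<alpha>. (Q \<alpha>)\<inverse>)"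
  unfolding lex_sum_def by auto

lemma Partial_order_incr_pairs:
  assumes "Partial_order \<mu>"
  shows "Partial_order (incr_pairs \<mu>)"
proof -
  have r: "refl_on (Field \<mu>) \<mu>" and t: "trans \<mu>" and a: "antisym \<mu>"
    using assms unfolding partial_order_on_def preorder_on_def by blast+
  have "Refl (incr_pairs \<mu>)"
    unfolding Field_incr_pairs[OF r] refl_on_def
    using r by (auto simp: incr_pairs_def refl_on_def Field_def)
  moreover have "trans (incr_pairs \<mu>)"
  proof (rule transI)
    fix p q s assume pq: "(p, q) \<in> incr_pairs \<mu>" and qs: "(q, s) \<in> incr_pairs \<mu>"
    obtain a x b y c z where p: "p = (a, x)" and q: "q = (b, y)" and s: "s = (c, z)"
      by (metis surj_pair)
    have "(a, c) \<in> \<mu>" if "(a, b) \<in> \<mu>" "(b, c) \<in> \<mu>" using t that by (rule transD)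
    moreover have "(x, z) \<in> \<mu>" if "(x, y) \<in> \<mu>" "(y, z) \<in> \<mu>" using t that by (rule transD)
    ultimately show "(p, s) \<in> incr_pairs \<mu>"
      using pq qs unfolding incr_pairs_def p q s by blast
  qed
  moreover have "antisym (incr_pairs \<mu>)"
    using antisymD[OF a] by (intro antisymI) (auto simp: incr_pairs_def)
  ultimately show ?thesis unfolding partial_order_on_def preorder_on_def
by (auto intro: FieldI1 FieldI2)
qed

lemma Partial_order_lex_sum:
  assumes C: "Partial_order C" and Q: "\<And>\<alpha>. \<alpha> \<in> Field C \<Longrightarrow> Partial_order (Q \<alpha>)"
  shows "Partial_order (lex_sum C Q)"
proof -
  have r: "\<And>\<alpha>. \<alpha> \<in> Field C \<Longrightarrow> Refl (Q \<alpha>)" and tQ: "\<And>\<alpha>. \<alpha> \<in> Field C \<Longrightarrow> trans (Q \<alpha>)"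
    and aQ: "\<And>\<alpha>. \<alpha> \<in> Field C \<Longrightarrow> antisym (Q \<alpha>)"
    using Q unfolding partial_order_on_def preorder_on_def by blast+
  have tC: "trans C" and aC: "antisym C"
    using C unfolding partial_order_on_def preorder_on_def by blast+
  have F: "Field (lex_sum C Q) = (SIGMA \<alpha>:Field C. Field (Q \<alpha>))" using r by (rule Field_lex_sum)
  have "Refl (lex_sum C Q)"
    unfolding refl_on_def F using r by (auto simp: lex_sum_def refl_on_def)
  moreover have "trans (lex_sum C Q)"
  proof (rule transI)
    fix p q s assume pq: "(p, q) \<in> lex_sum C Q" and qs: "(q, s) \<in> lex_sum C Q"
    obtain a x b y c z where p: "p = (a, x)" and q: "q = (b, y)" and s: "s = (c, z)"
      by (metis surj_pair)
    have "(a, c) \<in> C" if "(a, b) \<in> C" "(b, c) \<in> C" using tC that by (rule transD)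
    moreover have "a = b" if "(a, b) \<in> C" "(b, a) \<in> C" using aC that by (rule antisymD)
    moreover have "(x, z) \<in> Q a" if "(x, y) \<in> Q a" "(y, z) \<in> Q a" "a \<in> Field C"
      using tQ[OF that(3)] that(1,2) by (rule transD)
    ultimately show "(p, s) \<in> lex_sum C Q"
      using pq qs unfolding lex_sum_def p q s by (simp only: mem_Collect_eq prod.case) blast
  qed
  moreover have "antisym (lex_sum C Q)"
  proof (rule antisymI)
    fix p q assume pq: "(p, q) \<in> lex_sum C Q" and qp: "(q, p) \<in> lex_sum C Q"
    obtain a x b y where p: "p = (a, x)" and q: "q = (b, y)" by (metis surj_pair)
    have "a = b" if "(a, b) \<in> C" "(b, a) \<in> C" using aC that by (rule antisymD)
    moreover have "x = y" if "(x, y) \<in> Q a" "(y, x) \<in> Q a" "a \<in> Field C"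
      using aQ[OF that(3)] that(1,2) by (rule antisymD)
    ultimately show "p = q"
      using pq qp unfolding lex_sum_def p q by (simp only: mem_Collect_eq prod.case) blast
  qed
  ultimately show ?thesis unfolding partial_order_on_def preorder_on_def by (auto intro: FieldI1 FieldI2)
qed

section \<open>Covering by few chains\<close>

definition chain_colourable :: "'k rel \<Rightarrow> 'p rel \<Rightarrow> 'p set \<Rightarrow> bool" where
  "chain_colourable \<kappa> P A \<longleftrightarrow>
     (\<exists>c. c ` A \<subseteq> Field \<kappa> \<and> (\<forall>x\<in>A. \<forall>y\<in>A. c x = c y \<longrightarrow> (x, y) \<in> P \<or> (y, x) \<in> P))"

lemma chain_colourable_subset:
  "chain_colourable \<kappa> P B \<Longrightarrow> A \<subseteq> B \<Longrightarrow> chain_colourable \<kappa> P A"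
  unfolding chain_colourable_def by (elim exE, rule exI) (auto simp: image_subset_iff)

lemma chain_colourable_converse: "chain_colourable \<kappa> (P\<inverse>) A \<longleftrightarrow> chain_colourable \<kappa> P A"
  unfolding chain_colourable_def by (simp add: disj_commute)

lemma chain_colourable_ordLeq:
  assumes "chain_colourable \<kappa> P A" "\<kappa> \<le>o \<kappa>'"
  shows "chain_colourable \<kappa>' P A"
proof -
  obtain c where c: "c ` A \<subseteq> Field \<kappa>" "\<forall>x\<in>A. \<forall>y\<in>A. c x = c y \<longrightarrow> (x, y) \<in> P \<or> (y, x) \<in> P"
    using assms(1) unfolding chain_colourable_def by blast
  obtain g where g: "inj_on g (Field \<kappa>)" "g ` Field \<kappa> \<subseteq> Field \<kappa>'"
    using card_of_mono2[OF assms(2)] unfolding card_of_ordLeq[symmetric] by blast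
  have "g (c x) = g (c y) \<longleftrightarrow> c x = c y" if "x \<in> A" "y \<in> A" for x y
    using inj_on_eq_iff[OF g(1)] that c(1) by (simp add: image_subset_iff)
  then show ?thesis unfolding chain_colourable_def
    using c g by (intro exI[of _ "g \<circ> c"]) (auto simp: image_subset_iff)
qed

lemma chain_colourable_singleton:
  assumes "Field \<kappa> \<noteq> {}" "(x, x) \<in> P"
  shows "chain_colourable \<kappa> P {x}"
proof -
  obtain k where "k \<in> Field \<kappa>" using assms(1) by blast
  then show ?thesis unfolding chain_colourable_def using assms(2) by (intro exI[of _ "\<lambda>_. k"]) auto
qed

lemma chain_colourable_UN:
  assumes \<kappa>: "Card_order \<kappa>" "cinfinite \<kappa>" and I: "|I| \<le>o \<kappa>"
    and A: "\<And>i. i \<in> I \<Longrightarrow> chain_colourable \<kappa> P (A i)"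
  shows "chain_colourable \<kappa> P (\<Union>i\<in>I. A i)"
proof -
  have "\<forall>i. \<exists>c. i \<in> I \<longrightarrow> c ` A i \<subseteq> Field \<kappa> \<and>
      (\<forall>x\<in>A i. \<forall>y\<in>A i. c x = c y \<longrightarrow> (x, y) \<in> P \<or> (y, x) \<in> P)"
    using A unfolding chain_colourable_def by simp
  then obtain c where c: "\<And>i. i \<in> I \<Longrightarrow> c i ` A i \<subseteq> Field \<kappa>"
    and chain: "\<And>i x y. i \<in> I \<Longrightarrow> x \<in> A i \<Longrightarrow> y \<in> A i \<Longrightarrow> c i x = c i y \<Longrightarrow> (x, y) \<in> P \<or> (y, x) \<in> P"
    by metis
  have "|I \<times> Field \<kappa>| \<le>o \<kappa>"
    using card_of_Times_ordLeq_infinite_Field[OF _ I _ \<kappa>(1)] \<kappa>(2) ordIso_imp_ordLeq[OF card_of_Field_ordIso[OF \<kappa>(1)]]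
    unfolding cinfinite_def by blast
  then have "|I \<times> Field \<kappa>| \<le>o |Field \<kappa>|"
    using ordLeq_ordIso_trans[OF _ ordIso_symmetric[OF card_of_Field_ordIso[OF \<kappa>(1)]]] by blast
  then obtain g where g: "inj_on g (I \<times> Field \<kappa>)" "g ` (I \<times> Field \<kappa>) \<subseteq> Field \<kappa>"
    unfolding card_of_ordLeq[symmetric] by blast
  define ix where "ix x = (SOME i. i \<in> I \<and> x \<in> A i)" for x
  have ix: "ix x \<in> I \<and> x \<in> A (ix x)" if "x \<in> (\<Union>i\<in>I. A i)" for x
    unfolding ix_def by (rule someI_ex) (use that in blast)
  define d where "d x = g (ix x, c (ix x) x)" for x
  have mem: "(ix x, c (ix x) x) \<in> I \<times> Field \<kappa>" if "x \<in> (\<Union>i\<in>I. A i)" for x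
    using ix[OF that] c by (auto simp: image_subset_iff)
  have "(x, y) \<in> P \<or> (y, x) \<in> P" if x: "x \<in> (\<Union>i\<in>I. A i)" and y: "y \<in> (\<Union>i\<in>I. A i)" and d: "d x = d y" for x y
  proof -
    have "ix x = ix y" "c (ix x) x = c (ix y) y"
      using inj_onD[OF g(1) d[unfolded d_def] mem[OF x] mem[OF y]] by auto
    then show ?thesis using chain[of "ix x" x y] ix[OF x] ix[OF y] by simp
  qed
  moreover have "d ` (\<Union>i\<in>I. A i) \<subseteq> Field \<kappa>" using mem g(2) unfolding d_def by blast
  ultimately show ?thesis unfolding chain_colourable_def by (intro exI[of _ d]) blast
qed

lemma card_of_ordLeq_if_finite:
  assumes "Card_order \<kappa>" "cinfinite \<kappa>" "finite I"
  shows "|I| \<le>o \<kappa>"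
proof -
  have "|I| <o \<kappa>"
    by (rule finite_ordLess_infinite)
      (use assms in \<open>simp_all add: cinfinite_def Field_card_of card_of_well_order_on card_order_on_well_order_on\<close>)
  then show ?thesis by (rule ordLess_imp_ordLeq)
qed

lemma chain_colourable_Un:
  assumes "Card_order \<kappa>" "cinfinite \<kappa>" "chain_colourable \<kappa> P A" "chain_colourable \<kappa> P B"
  shows "chain_colourable \<kappa> P (A \<union> B)"
proof -
  have "chain_colourable \<kappa> P (\<Union>X\<in>{A, B}. X)"
    using assms by (intro chain_colourable_UN) (auto intro: card_of_ordLeq_if_finite)
  then show ?thesis by simp
qed

lemma chain_colourable_lexicographic:
  assumes K: "\<And>K. K \<in> \<K> \<Longrightarrow> chain_colourable \<kappa> P K"
    and cmp: "\<And>K L x y. K \<in> \<K> \<Longrightarrow> L \<in> \<K> \<Longrightarrow> K \<noteq> L \<Longrightarrow> x \<in> K \<Longrightarrow> y \<in> L \<Longrightarrow> (x, y) \<in> P \<or> (y, x) \<in> P"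
  shows "chain_colourable \<kappa> P (\<Union>\<K>)"
proof -
  have "\<forall>K. \<exists>c. K \<in> \<K> \<longrightarrow> c ` K \<subseteq> Field \<kappa> \<and>
      (\<forall>x\<in>K. \<forall>y\<in>K. c x = c y \<longrightarrow> (x, y) \<in> P \<or> (y, x) \<in> P)"
    using K unfolding chain_colourable_def by simp
  then obtain c where c: "\<And>K. K \<in> \<K> \<Longrightarrow> c K ` K \<subseteq> Field \<kappa>"
    and chain: "\<And>K x y. K \<in> \<K> \<Longrightarrow> x \<in> K \<Longrightarrow> y \<in> K \<Longrightarrow> c K x = c K y \<Longrightarrow> (x, y) \<in> P \<or> (y, x) \<in> P"
    by metis
  define cl where "cl x = (SOME K. K \<in> \<K> \<and> x \<in> K)" for x
  have cl: "cl x \<in> \<K> \<and> x \<in> cl x" if "x \<in> \<Union>\<K>" for x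
    unfolding cl_def by (rule someI_ex) (use that in blast)
  have "(x, y) \<in> P \<or> (y, x) \<in> P" if "x \<in> \<Union>\<K>" "y \<in> \<Union>\<K>" "c (cl x) x = c (cl y) y" for x y
    using cmp[of "cl x" "cl y" x y] chain[of "cl x" x y] cl[OF that(1)] cl[OF that(2)] that(3)
    by (cases "cl x = cl y") simp_all
  moreover have "(\<lambda>x. c (cl x) x) ` \<Union>\<K> \<subseteq> Field \<kappa>" using cl c by (auto simp: image_subset_iff)
  ultimately show ?thesis unfolding chain_colourable_def by (intro exI[of _ "\<lambda>x. c (cl x) x"]) blast
qed

lemma chain_colourable_if_embeds_into:
  assumes "embeds_into R P A" "chain_colourable \<kappa> P A"
  shows "chain_colourable \<kappa> R (Field R)"
proof -
  obtain f where f: "f ` Field R \<subseteq> A" "\<forall>x\<in>Field R. \<forall>y\<in>Field R. (x, y) \<in> R \<longleftrightarrow> (f x, f y) \<in> P"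
    using assms(1) unfolding embeds_into_def by blast
  obtain c where c: "c ` A \<subseteq> Field \<kappa>" "\<forall>x\<in>A. \<forall>y\<in>A. c x = c y \<longrightarrow> (x, y) \<in> P \<or> (y, x) \<in> P"
    using assms(2) unfolding chain_colourable_def by blast
  show ?thesis unfolding chain_colourable_def
    using f c by (intro exI[of _ "c \<circ> f"]) (auto simp: image_subset_iff)
qed

lemma Cov_ordLeq_iff:
  assumes P: "Partial_order P" and \<kappa>: "Card_order \<kappa>"
  shows "Cov P \<le>o \<kappa> \<longleftrightarrow> chain_colourable \<kappa> P (Field P)"
proof
  assume le: "Cov P \<le>o \<kappa>"
  obtain \<C> where \<C>: "chain_cover P \<C>" "Cov P = |\<C>|" using Cov_least(1)[OF P] by blast
  have "|\<C>| \<le>o |Field \<kappa>|"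
    using le \<C>(2) ordLeq_ordIso_trans[OF _ ordIso_symmetric[OF card_of_Field_ordIso[OF \<kappa>]]] by simp
  then obtain g where g: "inj_on g \<C>" "g ` \<C> \<subseteq> Field \<kappa>" unfolding card_of_ordLeq[symmetric] by blast
  define cl where "cl x = (SOME K. K \<in> \<C> \<and> x \<in> K)" for x
  have cl: "cl x \<in> \<C> \<and> x \<in> cl x" if "x \<in> Field P" for x
    unfolding cl_def by (rule someI_ex) (use that \<C>(1) in \<open>auto simp: chain_cover_def\<close>)
  have "(x, y) \<in> P \<or> (y, x) \<in> P" if x: "x \<in> Field P" and y: "y \<in> Field P" and eq: "g (cl x) = g (cl y)" for x y
  proof -
    have "cl x = cl y" using inj_onD[OF g(1) eq] cl[OF x] cl[OF y] by blast
    then have "y \<in> cl x" using cl[OF y] by simp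
    then show ?thesis using cl[OF x] \<C>(1) unfolding chain_cover_def Chains_def by blast
  qed
  then show "chain_colourable \<kappa> P (Field P)" unfolding chain_colourable_def
    using g(2) cl by (intro exI[of _ "\<lambda>x. g (cl x)"]) (auto simp: image_subset_iff)
next
  assume "chain_colourable \<kappa> P (Field P)"
  then obtain c where c: "c ` Field P \<subseteq> Field \<kappa>"
    "\<forall>x\<in>Field P. \<forall>y\<in>Field P. c x = c y \<longrightarrow> (x, y) \<in> P \<or> (y, x) \<in> P"
    unfolding chain_colourable_def by blast
  define \<C> where "\<C> = (\<lambda>k. {x \<in> Field P. c x = k}) ` (c ` Field P)"
  have "chain_cover P \<C>" unfolding chain_cover_def \<C>_def Chains_def using c(2) by (auto; metis)
  then have "Cov P \<le>o |\<C>|" by (rule Cov_least(2)[OF P])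
  also have "|\<C>| \<le>o |c ` Field P|" unfolding \<C>_def by (rule card_of_image)
  also have "|c ` Field P| \<le>o |Field \<kappa>|" using c(1) by (rule card_of_mono1)
  also have "|Field \<kappa>| =o \<kappa>" using \<kappa> by (rule card_of_Field_ordIso)
  finally show "Cov P \<le>o \<kappa>" .
qed

section \<open>Trichotomy for an ideal of small sets\<close>

definition up_type :: "('p set \<Rightarrow> bool) \<Rightarrow> 'p rel \<Rightarrow> 'p set \<Rightarrow> bool" where
  "up_type \<I> P B \<longleftrightarrow> \<not> \<I> B \<and> (\<forall>x\<in>B. \<I> {y\<in>B. (x, y) \<notin> P})"

definition linear_blocks :: "'p rel \<Rightarrow> 'p set set \<Rightarrow> bool" where
  "linear_blocks P \<K> \<longleftrightarrow>
     (\<forall>K\<in>\<K>. K \<noteq> {}) \<and>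
     (\<forall>K\<in>\<K>. \<forall>L\<in>\<K>. K \<noteq> L \<longrightarrow> K \<inter> L = {} \<and> (K \<times> L \<subseteq> P \<or> L \<times> K \<subseteq> P))"

lemma linear_blocksD:
  assumes "linear_blocks P \<K>" "K \<in> \<K>" "L \<in> \<K>" "K \<noteq> L"
  shows "K \<inter> L = {}" "K \<times> L \<subseteq> P \<or> L \<times> K \<subseteq> P"
  using assms unfolding linear_blocks_def by simp_all

lemma up_type_or_linear_blocks:
  fixes P :: "'p rel"
  assumes P: "Partial_order P" and A: "A \<subseteq> Field P"
    and fac: "\<And>X. antichain P X \<Longrightarrow> X \<subseteq> A \<Longrightarrow> finite X"
    and sub: "\<And>X Y. \<I> Y \<Longrightarrow> X \<subseteq> Y \<Longrightarrow> \<I> X"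
    and Un: "\<And>X Y. \<I> X \<Longrightarrow> \<I> Y \<Longrightarrow> \<I> (X \<union> Y)"
    and sing: "\<And>x. x \<in> Field P \<Longrightarrow> \<I> {x}"
    and pos: "\<not> \<I> A"
  obtains B where "B \<subseteq> A" "up_type \<I> P B"
  | B where "B \<subseteq> A" "up_type \<I> (P\<inverse>) B"
  | \<K> where "\<Union>\<K> \<subseteq> A" "linear_blocks P \<K>" "\<And>K. K \<in> \<K> \<Longrightarrow> \<I> K" "\<not> \<I> (\<Union>\<K>)"
proof -
  have refl: "\<And>x. x \<in> Field P \<Longrightarrow> (x, x) \<in> P" and tr: "trans P" and as: "antisym P"
    using P unfolding partial_order_on_def preorder_on_def refl_on_def by blast+
  define inc where "inc B x = {y\<in>B. (x, y) \<notin> P \<and> (y, x) \<notin> P}" for B x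
  obtain B where BA: "B \<subseteq> A" and posB: "\<not> \<I> B" and inc: "\<And>x. x \<in> B \<Longrightarrow> \<I> (inc B x)"
  proof (rule ccontr)
    assume "\<not> thesis"
    with that have step: "\<exists>x\<in>B. \<not> \<I> (inc B x)" if "B \<subseteq> A" "\<not> \<I> B" for B
      using that by blast
    have "\<exists>s. \<forall>n. (fst (s n) \<subseteq> A \<and> \<not> \<I> (fst (s n)) \<and> snd (s n) \<in> fst (s n) \<and> \<not> \<I> (inc (fst (s n)) (snd (s n))))
        \<and> fst (s (Suc n)) = inc (fst (s n)) (snd (s n))"
    proof (rule dependent_nat_choice)
      show "\<exists>s. fst s \<subseteq> A \<and> \<not> \<I> (fst s) \<and> snd s \<in> fst s \<and> \<not> \<I> (inc (fst s) (snd s))"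
        using step[of A] pos by auto
    next
      fix s n assume s: "fst s \<subseteq> A \<and> \<not> \<I> (fst s) \<and> snd s \<in> fst s \<and> \<not> \<I> (inc (fst s) (snd s))"
      then have "inc (fst s) (snd s) \<subseteq> A" unfolding inc_def by blast
      with s obtain x where "x \<in> inc (fst s) (snd s)" "\<not> \<I> (inc (inc (fst s) (snd s)) x)"
        using step by blast
      then show "\<exists>t. (fst t \<subseteq> A \<and> \<not> \<I> (fst t) \<and> snd t \<in> fst t \<and> \<not> \<I> (inc (fst t) (snd t)))
          \<and> fst t = inc (fst s) (snd s)"
        using s \<open>inc (fst s) (snd s) \<subseteq> A\<close> by (intro exI[of _ "(inc (fst s) (snd s), x)"]) simp
    qed
    then obtain s where s: "\<And>n. fst (s n) \<subseteq> A" "\<And>n. snd (s n) \<in> fst (s n)"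
      and Suc: "\<And>n. fst (s (Suc n)) = inc (fst (s n)) (snd (s n))" by blast
    have dec: "fst (s m) \<subseteq> fst (s n)" if "n \<le> m" for n m
      using that by (induction rule: dec_induct) (auto simp: Suc inc_def)
    have incomp: "(snd (s n), snd (s m)) \<notin> P \<and> (snd (s m), snd (s n)) \<notin> P" if "n < m" for n m
    proof -
      have "snd (s m) \<in> fst (s (Suc n))" using dec[of "Suc n" m] that s(2)[of m] by auto
      then show ?thesis unfolding Suc inc_def by blast
    qed
    have snA: "snd (s n) \<in> A" for n using s by blast
    have inj: "inj (\<lambda>n. snd (s n))"
      by (rule linorder_injI) (metis incomp refl snA A subsetD)
    have "antichain P (range (\<lambda>n. snd (s n)))"
      unfolding antichain_def using snA A incomp by (auto simp: image_subset_iff) (metis linorder_neqE_nat)+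
    then have "finite (range (\<lambda>n. snd (s n)))" using fac snA by blast
    then show False using inj finite_imageD infinite_UNIV_nat by blast
  qed
  define iv where "iv x y = {z\<in>B. (x, z) \<in> P \<and> (z, y) \<in> P}" for x y
  define near where "near x y \<longleftrightarrow> (x, y) \<notin> P \<and> (y, x) \<notin> P \<or> (x, y) \<in> P \<and> \<I> (iv x y) \<or> (y, x) \<in> P \<and> \<I> (iv y x)" for x y
  have BP: "x \<in> Field P" if "x \<in> B" for x using that BA A by blast
  have rB: "(x, x) \<in> P" if "x \<in> B" for x using that BP refl by blast
  have T: "(x, z) \<in> P" if "(x, y) \<in> P" "(y, z) \<in> P" for x y z using tr that by (rule transD)
  have iv_near: "\<I> (iv x z)" if "y \<in> B" "near x y" "near y z" "(x, z) \<in> P" for x y z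
  proof -
    have 1: "\<I> (iv x z)" if "X \<subseteq> inc B y \<union> Y" "\<I> Y" "iv x z = X" for X Y
      using sub[OF Un[OF inc[OF \<open>y \<in> B\<close>] that(2)] that(1)] that(3) by simp
    have 2: "iv x z \<subseteq> inc B y \<union> (iv x y \<union> iv y z)" unfolding iv_def inc_def by blast
    have 3: "(x, y) \<in> P \<and> (y, x) \<in> P \<Longrightarrow> x = y" "(z, y) \<in> P \<and> (y, z) \<in> P \<Longrightarrow> z = y"
      using antisymD[OF as] by blast+
    have 4: "(z, y) \<in> P \<Longrightarrow> (x, y) \<in> P" "(y, x) \<in> P \<Longrightarrow> (y, z) \<in> P" using T that(4) by blast+
    have 5: "(x, y) \<in> P \<Longrightarrow> \<I> (iv x y)" "(y, z) \<in> P \<Longrightarrow> \<I> (iv y z)"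
      using that(2,3) 3 unfolding near_def by auto
    consider (a) "(x, y) \<in> P" "\<I> (iv x y)" "(y, z) \<in> P" "\<I> (iv y z)"
      | (b) "(x, y) \<notin> P" "(z, y) \<notin> P" "\<I> (iv y z) \<or> (y, z) \<notin> P"
      | (c) "(y, z) \<notin> P" "(y, x) \<notin> P" "\<I> (iv x y) \<or> (x, y) \<notin> P"
      | (d) "(y, x) \<in> P" "(y, z) \<in> P" "\<I> (iv y z)"
      | (e) "(x, y) \<in> P" "(z, y) \<in> P" "\<I> (iv x y)"
      using 3 4 5 by argo
    then show ?thesis
    proof cases
      case a
      then show ?thesis using 1[OF 2 Un] by blast
    next
      case b
      have "iv x z \<subseteq> inc B y \<union> (if (y, z) \<in> P then iv y z else {})"
        unfolding iv_def inc_def using b T by auto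
      moreover have "\<I> (if (y, z) \<in> P then iv y z else {})" using b sub[OF inc[OF \<open>y \<in> B\<close>]] by auto
      ultimately show ?thesis using 1 by blast
    next
      case c
      have "iv x z \<subseteq> inc B y \<union> (if (x, y) \<in> P then iv x y else {})"
        unfolding iv_def inc_def using c T by auto
      moreover have "\<I> (if (x, y) \<in> P then iv x y else {})" using c sub[OF inc[OF \<open>y \<in> B\<close>]] by auto
      ultimately show ?thesis using 1 by blast
    next
      case d
      have "iv x z \<subseteq> iv y z" unfolding iv_def using d T by auto
      then show ?thesis using d sub by blast
    next
      case e
      have "iv x z \<subseteq> iv x y" unfolding iv_def using e T by auto
      then show ?thesis using e sub by blast
    qed
  qed
  have near_sym: "near x y \<longleftrightarrow> near y x" for x y unfolding near_def by blast
  have near_refl: "near x x" if "x \<in> B" for x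
  proof -
    have "iv x x \<subseteq> {x}" unfolding iv_def using as by (auto dest: antisymD)
    then have "\<I> (iv x x)" using sub[OF sing[OF BP[OF that]]] by blast
    then show ?thesis unfolding near_def using rB[OF that] by blast
  qed
  have near_trans: "near x z" if "y \<in> B" "near x y" "near y z" for x y z
    using iv_near[OF that] iv_near[of y z x] that near_sym unfolding near_def[of x z] by blast
  define cl where "cl x = {y\<in>B. near x y}" for x
  have cl_small: "\<I> (cl x)"
    if up: "\<And>C. C \<subseteq> A \<Longrightarrow> \<not> up_type \<I> P C" and down: "\<And>C. C \<subseteq> A \<Longrightarrow> \<not> up_type \<I> (P\<inverse>) C" and x: "x \<in> B" for x
  proof -
    define U where "U = {y \<in> cl x. (x, y) \<in> P}"
    define D where "D = {y \<in> cl x. (y, x) \<in> P}"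
    have iv: "\<I> (iv y z)" if yz: "y \<in> cl x" "z \<in> cl x" "(y, z) \<in> P" for y z
      using iv_near[of x y z] x yz near_sym unfolding cl_def by blast
    have "x \<in> cl x" unfolding cl_def using x near_refl by blast
    have "\<I> {z\<in>U. (y, z) \<notin> P}" if "y \<in> U" for y
    proof -
      have "{z\<in>U. (y, z) \<notin> P} \<subseteq> inc B y \<union> iv x y" unfolding U_def inc_def iv_def cl_def by blast
      moreover have "\<I> (inc B y)" "\<I> (iv x y)" using that inc iv[OF \<open>x \<in> cl x\<close>] unfolding U_def cl_def by blast+
      ultimately show ?thesis using sub Un by blast
    qed
    then have U: "\<I> U" using up[of U] BA unfolding up_type_def U_def cl_def by blast
    have "\<I> {z\<in>D. (y, z) \<notin> P\<inverse>}" if "y \<in> D" for y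
    proof -
      have "{z\<in>D. (y, z) \<notin> P\<inverse>} \<subseteq> inc B y \<union> iv y x" unfolding D_def inc_def iv_def cl_def by blast
      moreover have "\<I> (inc B y)" "\<I> (iv y x)" using that inc iv[OF _ \<open>x \<in> cl x\<close>] unfolding D_def cl_def by blast+
      ultimately show ?thesis using sub Un by blast
    qed
    then have D: "\<I> D" using down[of D] BA unfolding up_type_def D_def cl_def by blast
    have "cl x \<subseteq> inc B x \<union> (U \<union> D)" unfolding U_def D_def inc_def cl_def by blast
    then show ?thesis using sub Un[OF inc[OF x] Un[OF U D]] by blast
  qed
  have lin: "linear_blocks P (cl ` B)"
  proof -
    have cl_eq: "cl x = cl y" if "x \<in> B" "y \<in> B" "z \<in> cl x" "w \<in> cl y" "near z w" for x y z w
    proof -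
      have "near x y"
        using near_trans[of z x w] near_trans[of w x y] that near_sym unfolding cl_def by blast
      then show ?thesis
        using near_trans[of x y] near_trans[of y x] near_sym that(1,2) unfolding cl_def by blast
    qed
    have "cl x \<times> cl y \<subseteq> P \<or> cl y \<times> cl x \<subseteq> P" if xy: "x \<in> B" "y \<in> B" "cl x \<noteq> cl y" for x y
    proof -
      have far: "\<not> near z w" if "z \<in> cl x" "w \<in> cl y" for z w using cl_eq xy that by blast
      have swap: "cl x' \<times> cl y' \<subseteq> P" if xy': "x' \<in> B" "y' \<in> B" "cl x' \<noteq> cl y'" "(x', y') \<in> P" for x' y'
      proof -
        have far: "\<not> near z w" if "z \<in> cl x'" "w \<in> cl y'" for z w using cl_eq xy' that by blast
        have mem: "x' \<in> cl x'" "y' \<in> cl y'" using xy' near_refl unfolding cl_def by blast+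
        have 1: "(z, y') \<in> P" if z: "z \<in> cl x'" for z
        proof (rule ccontr)
          assume "(z, y') \<notin> P"
          then have yz: "(y', z) \<in> P" using far[OF z mem(2)] unfolding near_def by blast
          then have xz: "(x', z) \<in> P" using xy'(4) T by blast
          have "\<I> (iv x' z)" using iv_near[of x' x' z] near_refl z xy'(1) xz unfolding cl_def by blast
          moreover have "iv x' y' \<subseteq> iv x' z" unfolding iv_def using yz T by blast
          ultimately have "near x' y'" unfolding near_def using xy'(4) sub by blast
          then show False using far mem by blast
        qed
        have "(z, w) \<in> P" if z: "z \<in> cl x'" and w: "w \<in> cl y'" for z w
        proof (rule ccontr)
          assume "(z, w) \<notin> P"
          then have wz: "(w, z) \<in> P" using far[OF z w] unfolding near_def by blast
          have zy: "(z, y') \<in> P" using 1[OF z] .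
          then have wy: "(w, y') \<in> P" using wz T by blast
          have "\<I> (iv w y')" using iv_near[of y' w y'] near_refl near_sym w xy'(2) wy unfolding cl_def by blast
          moreover have "iv z y' \<subseteq> iv w y'" unfolding iv_def using wz T by blast
          ultimately have "near z y'" unfolding near_def using zy sub by blast
          then show False using far mem z by blast
        qed
        then show ?thesis by blast
      qed
      have "x \<in> cl x" "y \<in> cl y" using xy near_refl unfolding cl_def by blast+
      then have "(x, y) \<in> P \<or> (y, x) \<in> P" using far unfolding near_def by blast
      then show ?thesis using swap[of x y] swap[of y x] xy by metis
    qed
    moreover have "cl x \<inter> cl y = {}" if "x \<in> B" "y \<in> B" "cl x \<noteq> cl y" for x y
    proof (rule ccontr)
      assume "cl x \<inter> cl y \<noteq> {}"
      then obtain z where z: "z \<in> cl x" "z \<in> cl y" by blast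
      then have "near z z" using near_refl unfolding cl_def by blast
      then show False using cl_eq[OF that(1,2) z] that(3) by blast
    qed
    moreover have "cl x \<noteq> {}" if "x \<in> B" for x using that near_refl unfolding cl_def by blast
    ultimately show ?thesis unfolding linear_blocks_def by auto
  qed
  have Un_cl: "\<Union>(cl ` B) = B" unfolding cl_def using near_refl by blast
  show ?thesis
  proof (cases "(\<exists>C\<subseteq>A. up_type \<I> P C) \<or> (\<exists>C\<subseteq>A. up_type \<I> (P\<inverse>) C)")
    case True
    then show ?thesis by (elim disjE exE conjE) (fact that(1), fact that(2))
  next
    case False
    have "\<I> K" if "K \<in> cl ` B" for K
      using that by (elim imageE, simp only:, intro cl_small) (use False in simp_all)
    then show ?thesis using that(3)[OF _ lin] Un_cl BA posB by simp
  qed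
qed

section \<open>Uncountable covering number at a successor cardinal\<close>

lemma card_of_underS_cardSuc:
  assumes "Card_order \<kappa>" "i \<in> Field (cardSuc \<kappa>)"
  shows "|underS (cardSuc \<kappa>) i| \<le>o \<kappa>"
  using card_of_underS[OF cardSuc_Card_order[OF assms(1)] assms(2)]
    cardSuc_ordLeq_ordLess[OF assms(1) card_of_Card_order] by blast

lemma card_of_image_ordLeq: "|X| \<le>o r \<Longrightarrow> |f ` X| \<le>o r"
  using card_of_image ordLeq_transitive by blast

lemma card_of_UNIV_nat_ordLeq: "Card_order \<kappa> \<Longrightarrow> cinfinite \<kappa> \<Longrightarrow> |UNIV :: nat set| \<le>o \<kappa>"
  using card_of_nat natLeq_ordLeq_cinfinite ordIso_ordLeq_trans by blast

definition unbounded_chain :: "'p rel \<Rightarrow> 'p set \<Rightarrow> 'p set \<Rightarrow> bool" where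
  "unbounded_chain P A X \<longleftrightarrow> X \<subseteq> A \<and> (\<forall>x\<in>X. \<forall>y\<in>X. (x, y) \<in> P \<or> (y, x) \<in> P) \<and>
     (\<forall>b\<in>A. \<exists>x\<in>X. (x, b) \<notin> P)"

definition directed_upto :: "'k rel \<Rightarrow> 'p rel \<Rightarrow> 'p set \<Rightarrow> bool" where
  "directed_upto \<kappa> P A \<longleftrightarrow> (\<forall>X. X \<subseteq> A \<and> |X| \<le>o \<kappa> \<longrightarrow> (\<exists>b\<in>A. \<forall>x\<in>X. (x, b) \<in> P))"

lemma directed_uptoD:
  "directed_upto \<kappa> P A \<Longrightarrow> X \<subseteq> A \<Longrightarrow> |X| \<le>o \<kappa> \<Longrightarrow> \<exists>b\<in>A. \<forall>x\<in>X. (x, b) \<in> P"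
  unfolding directed_upto_def by simp

lemma up_type_imp_directed_upto:
  assumes \<kappa>: "Card_order \<kappa>" "cinfinite \<kappa>" and A: "up_type (chain_colourable \<kappa> P) P A"
  shows "directed_upto \<kappa> P A"
  unfolding directed_upto_def
proof (intro allI impI, elim conjE)
  fix X assume X: "X \<subseteq> A" "|X| \<le>o \<kappa>"
  have "chain_colourable \<kappa> P (\<Union>x\<in>X. {y\<in>A. (x, y) \<notin> P})"
    using A X(1) unfolding up_type_def by (intro chain_colourable_UN[OF \<kappa> X(2)]) blast
  then have "\<not> A \<subseteq> (\<Union>x\<in>X. {y\<in>A. (x, y) \<notin> P})"
    using A chain_colourable_subset unfolding up_type_def by blast
  then show "\<exists>b\<in>A. \<forall>x\<in>X. (x, b) \<in> P" by auto
qed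

lemma unbounded_chain_above:
  assumes "trans P" "Card_order \<kappa>" "cinfinite \<kappa>" and dir: "directed_upto \<kappa> P A"
    and X: "unbounded_chain P A X" and Z: "Z \<subseteq> X" "|Z| \<le>o \<kappa>" and Y: "Y \<subseteq> A" "|Y| \<le>o \<kappa>"
  shows "\<exists>v\<in>X. (\<forall>z\<in>Z. (z, v) \<in> P) \<and> (\<forall>y\<in>Y. (v, y) \<notin> P)"
proof -
  have "|Z \<union> Y| \<le>o \<kappa>" using Un_Cinfinite_bound[OF Z(2) Y(2)] assms(2,3) by blast
  moreover have "Z \<union> Y \<subseteq> A" using Z Y X unfolding unbounded_chain_def by blast
  ultimately obtain b where b: "b \<in> A" "\<forall>x\<in>Z \<union> Y. (x, b) \<in> P" using directed_uptoD[OF dir] by blast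
  obtain x where x: "x \<in> X" "(x, b) \<notin> P" using X b(1) unfolding unbounded_chain_def by blast
  have "(x, w) \<notin> P" if "w \<in> Z \<union> Y" for w using transD[OF assms(1), of x w b] b x that by blast
  then show ?thesis using X x(1) Z(1) unfolding unbounded_chain_def by blast
qed

text \<open>
  If every complement of a principal filter of \<open>B\<close> is bounded in \<open>B\<close>, then iterating the bounds
  shows that a point reaches only few points by steps \<open>x \<mapsto> w\<close> with \<open>x \<not>\<le> w\<close>; the classes
  of mutual reachability are lexicographically ordered.
\<close>

lemma chain_colourable_if_complements_bounded:
  assumes \<kappa>: "Card_order \<kappa>" "cinfinite \<kappa>" and P: "trans P" and refl: "\<And>x. x \<in> B \<Longrightarrow> (x, x) \<in> P"
    and small: "\<And>x. x \<in> B \<Longrightarrow> chain_colourable \<kappa> P {w\<in>B. (x, w) \<notin> P}"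
    and bound: "\<And>x. x \<in> B \<Longrightarrow> \<exists>b\<in>B. \<forall>w\<in>B. (x, w) \<notin> P \<longrightarrow> (w, b) \<in> P"
  shows "chain_colourable \<kappa> P B"
proof -
  define T where "T = {(x, w). x \<in> B \<and> w \<in> B \<and> (x, w) \<notin> P}"
  obtain g where g: "\<And>x. x \<in> B \<Longrightarrow> g x \<in> B"
    and gb: "\<And>x w. x \<in> B \<Longrightarrow> w \<in> B \<Longrightarrow> (x, w) \<notin> P \<Longrightarrow> (w, g x) \<in> P"
    using bound by metis
  have gn: "(g ^^ n) x \<in> B" if "x \<in> B" for x n using that g by (induction n) auto
  have step: "w \<in> B \<and> ((g ^^ n) x, w) \<notin> P" if "(x, w) \<in> T ^^ Suc n" "x \<in> B" for x w n
    using that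
  proof (induction n arbitrary: w)
    case 0
    then show ?case by (simp add: T_def)
  next
    case (Suc n)
    then obtain v where v: "(x, v) \<in> T ^^ Suc n" "(v, w) \<in> T" by auto
    with Suc have "v \<in> B" "((g ^^ n) x, v) \<notin> P" by blast+
    then have "(v, (g ^^ Suc n) x) \<in> P" using gb gn[OF Suc.prems(2)] by simp
    then show ?case using v(2) transD[OF P, of v "(g ^^ Suc n) x" w] unfolding T_def by blast
  qed
  define E where "E x = {w\<in>B. (x, w) \<in> T\<^sup>* \<and> (w, x) \<in> T\<^sup>*}" for x
  have "chain_colourable \<kappa> P (E x)" if x: "x \<in> B" for x
  proof -
    have "E x \<subseteq> {x} \<union> (\<Union>n::nat. {w\<in>B. ((g ^^ n) x, w) \<notin> P})"
    proof
      fix w assume "w \<in> E x"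
      then have "(x, w) \<in> T\<^sup>*" unfolding E_def by blast
      then obtain n where n: "(x, w) \<in> T ^^ n" using rtrancl_imp_relpow by blast
      show "w \<in> {x} \<union> (\<Union>n::nat. {w\<in>B. ((g ^^ n) x, w) \<notin> P})"
      proof (cases n)
        case (Suc m)
        then show ?thesis using step[OF _ x] n by blast
      qed (use n in simp)
    qed
    moreover have "chain_colourable \<kappa> P (\<Union>n::nat. {w\<in>B. ((g ^^ n) x, w) \<notin> P})"
      by (rule chain_colourable_UN[OF \<kappa> card_of_UNIV_nat_ordLeq[OF \<kappa>]]) (rule small[OF gn[OF x]])
    moreover have "chain_colourable \<kappa> P {x}"
      using \<kappa>(2) refl[OF x] unfolding cinfinite_def by (intro chain_colourable_singleton) auto
    ultimately show ?thesis using chain_colourable_subset chain_colourable_Un[OF \<kappa>] by blast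
  qed
  moreover have "(u, v) \<in> P \<or> (v, u) \<in> P"
    if "x \<in> B" "y \<in> B" "E x \<noteq> E y" "u \<in> E x" "v \<in> E y" for x y u v
  proof (rule ccontr)
    assume "\<not> ?thesis"
    then have "(u, v) \<in> T\<^sup>*" "(v, u) \<in> T\<^sup>*" using that unfolding T_def E_def by blast+
    then have "(x, y) \<in> T\<^sup>*" "(y, x) \<in> T\<^sup>*"
      using that(4,5) unfolding E_def by (auto intro: rtrancl_trans)
    then have "E x = E y" unfolding E_def by (auto intro: rtrancl_trans)
    then show False using that by blast
  qed
  ultimately have "chain_colourable \<kappa> P (\<Union>(E ` B))"
    by (intro chain_colourable_lexicographic; elim imageE) (simp_all only: simp_thms)
  moreover have "\<Union>(E ` B) = B" unfolding E_def by blast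
  ultimately show ?thesis by simp
qed

lemma up_type_unbounded_chain:
  assumes P: "Partial_order P" and AP: "A \<subseteq> Field P" and \<kappa>: "Card_order \<kappa>" "cinfinite \<kappa>"
    and A: "up_type (chain_colourable \<kappa> P) P A" and y: "y \<in> A"
  shows "\<exists>X. unbounded_chain P A X \<and> (\<forall>x\<in>X. (y, x) \<in> P) \<and> (\<exists>z\<in>A. \<forall>x\<in>X. (z, x) \<notin> P)"
proof (rule ccontr)
  assume none: "\<not> ?thesis"
  have tr: "trans P" and refl: "\<And>x. x \<in> A \<Longrightarrow> (x, x) \<in> P"
    using P AP unfolding partial_order_on_def preorder_on_def refl_on_def by blast+
  have dir: "directed_upto \<kappa> P A" using \<kappa> A by (rule up_type_imp_directed_upto)
  define B where "B = {x\<in>A. (y, x) \<in> P}"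
  have bound: "\<exists>b\<in>B. \<forall>w\<in>B. (z, w) \<notin> P \<longrightarrow> (w, b) \<in> P" if z: "z \<in> B" for z
  proof -
    have "chain_colourable \<kappa> P {w\<in>A. (z, w) \<notin> P}" using A z unfolding up_type_def B_def by blast
    then obtain c where c: "c ` {w\<in>A. (z, w) \<notin> P} \<subseteq> Field \<kappa>"
      and chain: "\<forall>v\<in>{w\<in>A. (z, w) \<notin> P}. \<forall>w\<in>{w\<in>A. (z, w) \<notin> P}. c v = c w \<longrightarrow> (v, w) \<in> P \<or> (w, v) \<in> P"
      unfolding chain_colourable_def by blast
    have "\<exists>b\<in>A. \<forall>w\<in>B. (z, w) \<notin> P \<longrightarrow> c w = k \<longrightarrow> (w, b) \<in> P" for k
    proof (rule ccontr)
      assume no: "\<not> ?thesis"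
      define X where "X = {w\<in>B. (z, w) \<notin> P \<and> c w = k}"
      have "unbounded_chain P A X"
        unfolding unbounded_chain_def using chain no unfolding X_def B_def by blast
      moreover have "\<forall>x\<in>X. (y, x) \<in> P" "\<exists>z\<in>A. \<forall>x\<in>X. (z, x) \<notin> P"
        using z unfolding X_def B_def by blast+
      ultimately show False using none by blast
    qed
    then obtain b where b: "\<And>k. b k \<in> A" "\<And>k w. w \<in> B \<Longrightarrow> (z, w) \<notin> P \<Longrightarrow> c w = k \<Longrightarrow> (w, b k) \<in> P" by metis
    have "|insert y (b ` Field \<kappa>)| \<le>o \<kappa>"
      using Un_Cinfinite_bound[of "{y}" \<kappa> "b ` Field \<kappa>"] \<kappa> card_of_ordLeq_if_finite[OF \<kappa>, of "{y}"]
        card_of_image_ordLeq[OF ordIso_imp_ordLeq[OF card_of_Field_ordIso[OF \<kappa>(1)]], of b] by simp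
    then obtain a where a: "a \<in> A" "\<forall>x\<in>insert y (b ` Field \<kappa>). (x, a) \<in> P"
      using directed_uptoD[OF dir, of "insert y (b ` Field \<kappa>)"] b(1) y by blast
    have "(w, a) \<in> P" if w: "w \<in> B" "(z, w) \<notin> P" for w
    proof -
      have "c w \<in> Field \<kappa>" using w c unfolding B_def by blast
      then show ?thesis using a(2) b(2)[OF w HOL.refl] transD[OF tr, of w "b (c w)" a] by blast
    qed
    then show ?thesis using a unfolding B_def by blast
  qed
  have small: "chain_colourable \<kappa> P {w\<in>B. (x, w) \<notin> P}" if "x \<in> B" for x
  proof -
    have "chain_colourable \<kappa> P {w\<in>A. (x, w) \<notin> P}" using that A unfolding B_def up_type_def by blast
    then show ?thesis by (rule chain_colourable_subset) (auto simp: B_def)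
  qed
  have "(x, x) \<in> P" if "x \<in> B" for x using that refl unfolding B_def by blast
  then have "chain_colourable \<kappa> P B"
    using small bound by (rule chain_colourable_if_complements_bounded[OF \<kappa> tr])
  then have "chain_colourable \<kappa> P (B \<union> {w\<in>A. (y, w) \<notin> P})"
    using A y unfolding up_type_def by (intro chain_colourable_Un[OF \<kappa>]) blast+
  moreover have "A \<subseteq> B \<union> {w\<in>A. (y, w) \<notin> P}" unfolding B_def by blast
  ultimately show False using A chain_colourable_subset unfolding up_type_def by blast
qed

text \<open>
  A partition argument in the style of Dushnik and Miller: an infinite sequence of chains, each
  capped by an element lying below all later chains and none of them dominated by a later one,
  would yield an infinite antichain.
\<close>

lemma dominating_family:
  assumes P: "Partial_order P" and AP: "A \<subseteq> Field P"
    and fac: "\<And>X. antichain P X \<Longrightarrow> X \<subseteq> A \<Longrightarrow> finite X"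
    and \<kappa>: "Card_order \<kappa>" "cinfinite \<kappa>" and dir: "directed_upto \<kappa> P A"
    and ex: "\<And>y. y \<in> A \<Longrightarrow>
      \<exists>X. unbounded_chain P A X \<and> (\<forall>x\<in>X. (y, x) \<in> P) \<and> (\<exists>z\<in>A. \<forall>x\<in>X. (z, x) \<notin> P)"
  obtains \<S> h where
    "\<forall>X\<in>\<S>. unbounded_chain P A X"
    "\<forall>y\<in>A. \<exists>X\<in>\<S>. \<forall>x\<in>X. (y, x) \<in> P"
    "\<forall>X\<in>\<S>. h X \<in> A \<and> (\<forall>x\<in>X. (h X, x) \<notin> P)"
    "\<forall>X\<in>\<S>. \<forall>Y\<in>\<S>. (\<forall>y\<in>Y. (h X, y) \<in> P) \<longrightarrow> (\<forall>x\<in>X. \<exists>y\<in>Y. (x, y) \<in> P)"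
proof -
  have tr: "trans P" and refl: "\<And>x. x \<in> A \<Longrightarrow> (x, x) \<in> P"
    using P AP unfolding partial_order_on_def preorder_on_def refl_on_def by blast+
  have ub: "\<exists>b\<in>A. (x, b) \<in> P \<and> (y, b) \<in> P" if "x \<in> A" "y \<in> A" for x y
    using directed_uptoD[OF dir, of "{x, y}"] card_of_ordLeq_if_finite[OF \<kappa>, of "{x, y}"] that by simp
  define above where "above y X \<longleftrightarrow> (\<forall>x\<in>X. (y, x) \<in> P)" for y X
  define cap where "cap z X \<longleftrightarrow> z \<in> A \<and> (\<forall>x\<in>X. (z, x) \<notin> P)" for z X
  define large where "large \<S> \<longleftrightarrow> (\<forall>y\<in>A. \<exists>X\<in>\<S>. above y X)" for \<S>
  define dom where "dom X Y \<longleftrightarrow> (\<forall>x\<in>X. \<exists>y\<in>Y. (x, y) \<in> P)" for X Y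
  define \<R> where "\<R> = {X. unbounded_chain P A X \<and> (\<exists>z. cap z X)}"
  have above_mono: "above y X" if "above b X" "(y, b) \<in> P" for y b X
    using that transD[OF tr] unfolding above_def by blast
  have "\<exists>\<S>\<subseteq>\<R>. large \<S> \<and> (\<forall>X\<in>\<S>. \<not> large {Y\<in>\<S>. \<not> dom X Y})"
  proof (rule ccontr)
    assume no: "\<not> ?thesis"
    define OK where "OK s \<longleftrightarrow> fst s \<subseteq> \<R> \<and> large (fst s) \<and> snd s \<in> fst s \<and> large {Y\<in>fst s. \<not> dom (snd s) Y}" for s
    define Next :: "'a set set \<times> 'a set \<Rightarrow> 'a set set \<times> 'a set \<Rightarrow> bool" where "Next s t \<longleftrightarrow> (\<exists>z. cap z (snd s) \<and> (\<forall>Y\<in>fst t. Y \<in> fst s \<and> \<not> dom (snd s) Y \<and> above z Y))" for s t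
    have ext: "\<exists>X. OK (\<S>, X)" if "\<S> \<subseteq> \<R>" "large \<S>" for \<S>
    proof -
      have "\<not> (\<forall>X\<in>\<S>. \<not> large {Y\<in>\<S>. \<not> dom X Y})" using no that by simp
      then show ?thesis unfolding OK_def fst_conv snd_conv using that by blast
    qed
    have "\<exists>s. \<forall>n. OK (s n) \<and> Next (s n) (s (Suc n))"
    proof (rule dependent_nat_choice)
      have "large \<R>"
        unfolding large_def
      proof
        fix y assume "y \<in> A"
        from ex[OF this] obtain X z where "unbounded_chain P A X" "above y X" "cap z X"
          unfolding above_def cap_def by blast
        then show "\<exists>X\<in>\<R>. above y X" unfolding \<R>_def by blast
      qed
      with ext[of \<R>] obtain X where "OK (\<R>, X)" by blast
      then show "\<exists>s. OK s" ..
    next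
      fix s n assume s: "OK s"
      then have sR: "snd s \<in> \<R>" unfolding OK_def by blast
      then obtain z where z: "cap z (snd s)" unfolding \<R>_def by blast
      define \<S> where "\<S> = {Y\<in>fst s. \<not> dom (snd s) Y \<and> above z Y}"
      have "large \<S>"
        unfolding large_def
      proof
        fix y assume "y \<in> A"
        then obtain b where b: "b \<in> A" "(y, b) \<in> P" "(z, b) \<in> P" using ub z unfolding cap_def by blast
        then obtain Y where "Y \<in> {Y\<in>fst s. \<not> dom (snd s) Y}" "above b Y"
          using s unfolding OK_def large_def by blast
        then have "Y \<in> \<S>" "above y Y" using b above_mono unfolding \<S>_def by blast+
        then show "\<exists>Y\<in>\<S>. above y Y" by blast
      qed
      moreover have "\<S> \<subseteq> \<R>" using s unfolding \<S>_def OK_def by blast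
      ultimately obtain X where "OK (\<S>, X)" using ext by blast
      moreover have "Next s (\<S>, X)" unfolding Next_def \<S>_def using z by auto
      ultimately have "OK (\<S>, X) \<and> Next s (\<S>, X)" ..
      then show "\<exists>t. OK t \<and> Next s t" ..
    qed
    then obtain s where OK: "\<And>n. OK (s n)" and Next: "\<And>n. Next (s n) (s (Suc n))" by blast
    define X where "X n = snd (s n)" for n
    have "\<forall>n. \<exists>z. cap z (X n) \<and> (\<forall>Y\<in>fst (s (Suc n)). Y \<in> fst (s n) \<and> \<not> dom (X n) Y \<and> above z Y)"
      using Next unfolding Next_def X_def by blast
    then obtain z where z: "\<And>n. cap (z n) (X n)"
      "\<And>n Y. Y \<in> fst (s (Suc n)) \<Longrightarrow> Y \<in> fst (s n) \<and> \<not> dom (X n) Y \<and> above (z n) Y" by metis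
    have Xs: "X n \<in> fst (s n)" "X n \<in> \<R>" for n using OK[of n] unfolding OK_def X_def by blast+
    have dec: "fst (s m) \<subseteq> fst (s n)" if "n \<le> m" for n m
      using that by (induction rule: dec_induct) (use z(2) in blast)+
    have later: "\<not> dom (X n) (X m) \<and> above (z n) (X m)" if "n < m" for n m
      using z(2)[of "X m" n] dec[of "Suc n" m] Xs(1)[of m] that by auto
    have "\<forall>n m. \<exists>x. n < m \<longrightarrow> x \<in> X n \<and> (\<forall>y\<in>X m. (x, y) \<notin> P)"
      using later unfolding dom_def by blast
    then obtain w where w: "\<And>n m. n < m \<Longrightarrow> w n m \<in> X n"
      "\<And>n m y. n < m \<Longrightarrow> y \<in> X m \<Longrightarrow> (w n m, y) \<notin> P" by metis
    have "\<exists>v\<in>X n. \<forall>m>n. (w n m, v) \<in> P" for n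
    proof -
      have "|w n ` {m. n < m}| \<le>o \<kappa>"
        by (intro card_of_image_ordLeq ordLeq_transitive[OF card_of_mono1 card_of_UNIV_nat_ordLeq[OF \<kappa>]]) simp
      moreover have "|{} :: 'a set| \<le>o \<kappa>" by (rule card_of_ordLeq_if_finite[OF \<kappa>]) simp
      moreover have "unbounded_chain P A (X n)" using Xs(2) unfolding \<R>_def by blast
      moreover have "w n ` {m. n < m} \<subseteq> X n" using w(1) by blast
      ultimately show ?thesis
        using unbounded_chain_above[OF tr \<kappa> dir, of "X n" "w n ` {m. n < m}" "{}"] by auto
    qed
    then obtain v where v: "\<And>n. v n \<in> X n" "\<And>n m. n < m \<Longrightarrow> (w n m, v n) \<in> P" by metis
    have vA: "v n \<in> A" for n using v(1) Xs(2) unfolding \<R>_def unbounded_chain_def by blast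
    have incomp: "(v n, v m) \<notin> P \<and> (v m, v n) \<notin> P" if "n < m" for n m
    proof
      show "(v n, v m) \<notin> P"
        using transD[OF tr v(2)[OF that], of "v m"] w(2)[OF that v(1)] by blast
      have "(z n, v m) \<in> P" using later[OF that] v(1) unfolding above_def by blast
      then show "(v m, v n) \<notin> P"
        using transD[OF tr, of "z n" "v m" "v n"] z(1)[of n] v(1)[of n] unfolding cap_def by blast
    qed
    have inj: "inj v" by (rule linorder_injI) (metis incomp refl vA)
    have "antichain P (range v)"
      unfolding antichain_def using vA AP incomp
      by (auto simp: image_subset_iff) (metis linorder_neqE_nat)+
    then have "finite (range v)" using fac vA by blast
    then show False using inj finite_imageD infinite_UNIV_nat by blast
  qed
  then obtain \<S> where \<S>: "\<S> \<subseteq> \<R>" "large \<S>" "\<And>X. X \<in> \<S> \<Longrightarrow> \<not> large {Y\<in>\<S>. \<not> dom X Y}" by blast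
  have "\<exists>h. cap h X \<and> (\<forall>Y\<in>\<S>. above h Y \<longrightarrow> dom X Y)" if X: "X \<in> \<S>" for X
  proof -
    obtain z where z: "cap z X" using X \<S>(1) unfolding \<R>_def by blast
    obtain y where y: "y \<in> A" "\<And>Y. Y \<in> \<S> \<Longrightarrow> above y Y \<Longrightarrow> dom X Y"
      using \<S>(3)[OF X] unfolding large_def by blast
    obtain h where h: "h \<in> A" "(z, h) \<in> P" "(y, h) \<in> P" using ub y(1) z unfolding cap_def by blast
    have "cap h X" using z h transD[OF tr h(2)] unfolding cap_def by blast
    then show ?thesis using y(2) above_mono h(3) by blast
  qed
  then obtain h where h: "\<And>X. X \<in> \<S> \<Longrightarrow> cap (h X) X"
    "\<And>X Y. X \<in> \<S> \<Longrightarrow> Y \<in> \<S> \<Longrightarrow> above (h X) Y \<Longrightarrow> dom X Y" by metis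
  show thesis
  proof (rule that[of \<S> h])
    show "\<forall>X\<in>\<S>. unbounded_chain P A X" using \<S>(1) unfolding \<R>_def by blast
    show "\<forall>y\<in>A. \<exists>X\<in>\<S>. \<forall>x\<in>X. (y, x) \<in> P" using \<S>(2) unfolding large_def above_def .
    show "\<forall>X\<in>\<S>. h X \<in> A \<and> (\<forall>x\<in>X. (h X, x) \<notin> P)" using h(1) unfolding cap_def by blast
    show "\<forall>X\<in>\<S>. \<forall>Y\<in>\<S>. (\<forall>y\<in>Y. (h X, y) \<in> P) \<longrightarrow> (\<forall>x\<in>X. \<exists>y\<in>Y. (x, y) \<in> P)"
      using h(2) unfolding above_def dom_def by blast
  qed
qed

lemma embeds_into_incr_pairs_if_up_type:
  fixes P :: "'a rel" and \<kappa> :: "'b rel"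
  assumes P: "Partial_order P" and AP: "A \<subseteq> Field P"
    and fac: "\<And>X. antichain P X \<Longrightarrow> X \<subseteq> A \<Longrightarrow> finite X"
    and \<kappa>: "Card_order \<kappa>" "cinfinite \<kappa>"
    and A: "up_type (chain_colourable \<kappa> P) P A"
  shows "embeds_into (incr_pairs (cardSuc \<kappa>)) P A"
proof -
  have tr: "trans P" and refl: "\<And>x. x \<in> A \<Longrightarrow> (x, x) \<in> P"
    using P AP unfolding partial_order_on_def preorder_on_def refl_on_def by blast+
  have dir: "directed_upto \<kappa> P A" using \<kappa> A by (rule up_type_imp_directed_upto)
  obtain \<S> h where fam: "\<forall>X\<in>\<S>. unbounded_chain P A X"
    "\<forall>y\<in>A. \<exists>X\<in>\<S>. \<forall>x\<in>X. (y, x) \<in> P"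
    "\<forall>X\<in>\<S>. h X \<in> A \<and> (\<forall>x\<in>X. (h X, x) \<notin> P)"
    "\<forall>X\<in>\<S>. \<forall>Y\<in>\<S>. (\<forall>y\<in>Y. (h X, y) \<in> P) \<longrightarrow> (\<forall>x\<in>X. \<exists>y\<in>Y. (x, y) \<in> P)"
    by (rule dominating_family[OF P AP fac \<kappa> dir up_type_unbounded_chain[OF P AP \<kappa> A]])
  have \<S>: "unbounded_chain P A X" and hA: "h X \<in> A" if "X \<in> \<S>" for X using fam(1,3) that by blast+
  have large: "\<exists>X\<in>\<S>. \<forall>x\<in>X. (y, x) \<in> P" if "y \<in> A" for y using fam(2) that by blast
  have cap: "(h X, x) \<notin> P" if "X \<in> \<S>" "x \<in> X" for X x using fam(3) that by blast
  have dom: "\<exists>y\<in>Y. (x, y) \<in> P"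
    if "X \<in> \<S>" "Y \<in> \<S>" "\<forall>y\<in>Y. (h X, y) \<in> P" "x \<in> X" for X Y x using fam(4) that by blast
  define r where "r = cardSuc \<kappa>"
  have r: "Card_order r" unfolding r_def using \<kappa>(1) by (rule cardSuc_Card_order)
  then have wo: "Well_order r" by (rule card_order_on_well_order_on)
  then have wf: "wf (r - Id)" and rtr: "trans r" and ras: "antisym r" and rrefl: "Refl r" and rtot: "Total r"
    unfolding order_on_defs by blast+
  have tot: "(a, b) \<in> r \<or> (b, a) \<in> r - Id" if "a \<in> Field r" "b \<in> Field r" for a b
    using rrefl rtot that unfolding refl_on_def total_on_def by (cases "a = b") auto
  have under: "|underS r i| \<le>o \<kappa>" if "i \<in> Field r" for i
    using card_of_underS_cardSuc[OF \<kappa>(1)] that unfolding r_def by blast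
  have "\<exists>X. \<forall>i. i \<in> Field r \<longrightarrow> X i \<in> \<S> \<and> (\<forall>j\<in>underS r i. \<forall>x\<in>X i. (h (X j), x) \<in> P)"
  proof (rule dependent_wf_choice[OF wf])
    fix i X assume IH: "\<And>j. (j, i) \<in> r - Id \<Longrightarrow>
      j \<in> Field r \<longrightarrow> X j \<in> \<S> \<and> (\<forall>k\<in>underS r j. \<forall>x\<in>X j. (h (X k), x) \<in> P)"
    show "\<exists>Y. i \<in> Field r \<longrightarrow> Y \<in> \<S> \<and> (\<forall>j\<in>underS r i. \<forall>x\<in>Y. (h (X j), x) \<in> P)"
    proof (cases "i \<in> Field r")
      case True
      have "(h \<circ> X) ` underS r i \<subseteq> A"
        using IH hA unfolding underS_def by (auto simp: image_subset_iff intro: FieldI1)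
      then obtain b where b: "b \<in> A" "\<forall>x\<in>(h \<circ> X) ` underS r i. (x, b) \<in> P"
        using directed_uptoD[OF dir _ card_of_image_ordLeq[OF under[OF True]]] by blast
      obtain Y where Y: "Y \<in> \<S>" "\<forall>x\<in>Y. (b, x) \<in> P" using large[OF b(1)] by blast
      then have "(h (X j), x) \<in> P" if "j \<in> underS r i" "x \<in> Y" for j x
        using transD[OF tr, of "h (X j)" b x] b(2) that by simp
      then show ?thesis using Y(1) by blast
    qed simp
  qed (auto simp: underS_def)
  then obtain X where X: "\<And>i. i \<in> Field r \<Longrightarrow> X i \<in> \<S>"
    and hX: "\<And>i j x. i \<in> Field r \<Longrightarrow> j \<in> underS r i \<Longrightarrow> x \<in> X i \<Longrightarrow> (h (X j), x) \<in> P" by blast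
  have XA: "X i \<subseteq> A" if "i \<in> Field r" for i using \<S>[OF X[OF that]] unfolding unbounded_chain_def by blast
  define R where "R = inv_image ((r - Id) <*lex*> (r - Id)) prod.swap"
  have wfR: "wf R" unfolding R_def using wf by (intro wf_inv_image wf_lex_prod)
  have R: "((i', j'), (i, j)) \<in> R \<longleftrightarrow> (j', j) \<in> r - Id \<or> j' = j \<and> (i', i) \<in> r - Id" for i j i' j'
    unfolding R_def by auto
  define \<Phi> :: "('b set \<times> 'b set \<Rightarrow> 'a) \<Rightarrow> 'b set \<times> 'b set \<Rightarrow> 'a \<Rightarrow> bool"
    where "\<Phi> f p v \<longleftrightarrow> (p \<in> r - Id \<longrightarrow> v \<in> X (fst p) \<and> (\<forall>q. (q, p) \<in> R \<and> q \<in> r - Id \<longrightarrow>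
      ((fst q, fst p) \<in> r \<longrightarrow> (f q, v) \<in> P) \<and> ((snd q, snd p) \<in> r - Id \<longrightarrow> (v, f q) \<notin> P)))" for f p v
  have "\<exists>f. \<forall>p. \<Phi> f p (f p)"
  proof (rule dependent_wf_choice[OF wfR])
    fix f g :: "'b set \<times> 'b set \<Rightarrow> 'a" and p v assume "\<And>q. (q, p) \<in> R \<Longrightarrow> f q = g q"
    then show "\<Phi> f p v = \<Phi> g p v" unfolding \<Phi>_def by auto
  next
    fix p and f :: "'b set \<times> 'b set \<Rightarrow> 'a" assume IH: "\<And>q. (q, p) \<in> R \<Longrightarrow> \<Phi> f q (f q)"
    show "\<exists>v. \<Phi> f p v"
    proof (cases "p \<in> r - Id")
      case True
      obtain i j where p: "p = (i, j)" by (cases p)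
      have ij: "i \<in> Field r" "j \<in> Field r" using True unfolding p by (auto intro: FieldI1 FieldI2)
      define Pred where "Pred = {q. (q, p) \<in> R \<and> q \<in> r - Id}"
      have fX: "f q \<in> X (fst q)" if "q \<in> Pred" for q using IH[of q] that unfolding Pred_def \<Phi>_def by blast
      have qF: "fst q \<in> Field r" if "q \<in> Pred" for q
        using that unfolding Pred_def by (cases q) (auto intro: FieldI1)
      have "|insert j (underS r j)| \<le>o \<kappa>"
        using Un_Cinfinite_bound[of "{j}" \<kappa> "underS r j"] \<kappa> under[OF ij(2)] card_of_ordLeq_if_finite[OF \<kappa>, of "{j}"] by simp
      then have "|insert j (underS r j) \<times> insert j (underS r j)| \<le>o \<kappa>"
        using card_of_Times_ordLeq_infinite_Field[of \<kappa>] \<kappa> unfolding cinfinite_def by blast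
      moreover have "Pred \<subseteq> insert j (underS r j) \<times> insert j (underS r j)"
      proof
        fix q assume q: "q \<in> Pred"
        obtain a b where ab: "q = (a, b)" by (cases q)
        have 1: "(b, j) \<in> r - Id \<or> b = j" "(a, b) \<in> r" using q by (auto simp: Pred_def ab p R)
        then have "(a, j) \<in> r" using transD[OF rtr, of a b j] by blast
        then show "q \<in> insert j (underS r j) \<times> insert j (underS r j)"
          unfolding ab underS_def using 1 by auto
      qed
      ultimately have Pred: "|Pred| \<le>o \<kappa>" by (rule ordLeq_transitive[OF card_of_mono1, rotated])
      have "\<exists>d\<in>X i. (f q, d) \<in> P" if q: "q \<in> Pred" "(fst q, i) \<in> r" for q
      proof (cases "fst q = i")
        case True
        then show ?thesis using fX[OF q(1)] XA[OF ij(1)] refl by blast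
      next
        case False
        then have "fst q \<in> underS r i" using q(2) unfolding underS_def by blast
        then have "\<forall>y\<in>X i. (h (X (fst q)), y) \<in> P" using hX[OF ij(1)] by simp
        from dom[OF X[OF qF[OF q(1)]] X[OF ij(1)] this fX[OF q(1)]] show ?thesis .
      qed
      then obtain d where d: "\<And>q. q \<in> Pred \<Longrightarrow> (fst q, i) \<in> r \<Longrightarrow> d q \<in> X i \<and> (f q, d q) \<in> P" by metis
      have "\<exists>v\<in>X i. (\<forall>z\<in>d ` {q\<in>Pred. (fst q, i) \<in> r}. (z, v) \<in> P) \<and> (\<forall>y\<in>f ` Pred. (v, y) \<notin> P)"
      proof (rule unbounded_chain_above[OF tr \<kappa> dir \<S>[OF X[OF ij(1)]]])
        show "d ` {q\<in>Pred. (fst q, i) \<in> r} \<subseteq> X i" using d by blast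
        show "f ` Pred \<subseteq> A" using fX XA qF by blast
        show "|f ` Pred| \<le>o \<kappa>" using Pred by (rule card_of_image_ordLeq)
        have "|{q\<in>Pred. (fst q, i) \<in> r}| \<le>o |Pred|" by (rule card_of_mono1) blast
        then show "|d ` {q\<in>Pred. (fst q, i) \<in> r}| \<le>o \<kappa>"
          using Pred by (intro card_of_image_ordLeq) (rule ordLeq_transitive)
      qed
      then obtain v where v: "v \<in> X i" "\<forall>z\<in>d ` {q\<in>Pred. (fst q, i) \<in> r}. (z, v) \<in> P"
        "\<forall>y\<in>f ` Pred. (v, y) \<notin> P" by blast
      have "(f q, v) \<in> P" if "q \<in> Pred" "(fst q, i) \<in> r" for q
        using transD[OF tr, of "f q" "d q" v] d[OF that] v(2) that by simp
      moreover have "(v, f q) \<notin> P" if "q \<in> Pred" for q using v(3) that by simp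
      ultimately have "\<Phi> f p v" unfolding \<Phi>_def using v(1) unfolding Pred_def p by simp
      then show ?thesis by blast
    qed (unfold \<Phi>_def, blast)
  qed
  then obtain f where f: "\<And>p. \<Phi> f p (f p)" by blast
  have fX: "f (i, j) \<in> X i" if "(i, j) \<in> r - Id" for i j using f[of "(i, j)"] that unfolding \<Phi>_def by simp
  have fle: "(f q, f p) \<in> P" if "(q, p) \<in> R" "q \<in> r - Id" "p \<in> r - Id" "(fst q, fst p) \<in> r" for p q
    using f[of p] that unfolding \<Phi>_def by blast
  have fnle: "(f p, f q) \<notin> P" if "(q, p) \<in> R" "q \<in> r - Id" "p \<in> r - Id" "(snd q, snd p) \<in> r - Id" for p q
    using f[of p] that unfolding \<Phi>_def by blast
  have F: "Field (incr_pairs r) = r - Id" using rrefl by (rule Field_incr_pairs)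
  show ?thesis
    unfolding r_def[symmetric]
  proof (rule embeds_intoI[of _ f])
    fix p assume "p \<in> Field (incr_pairs r)"
    then show "f p \<in> A" using fX XA unfolding F by (cases p) (auto intro: FieldI1)
  next
    fix p q assume "p \<in> Field (incr_pairs r)" "q \<in> Field (incr_pairs r)"
    then have pq: "p \<in> r - Id" "q \<in> r - Id" unfolding F by blast+
    obtain i j i' j' where p: "p = (i, j)" and q: "q = (i', j')" by (cases p; cases q) blast
    have Fi: "i \<in> Field r" "j \<in> Field r" "i' \<in> Field r" "j' \<in> Field r"
      using pq unfolding p q by (auto intro: FieldI1 FieldI2)
    have "(f p, f q) \<in> P" if "(i, i') \<in> r" "(j, j') \<in> r"
    proof (cases "p = q")
      case True
      then show ?thesis using fX XA Fi pq refl unfolding p by blast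
    next
      case False
      then have "(p, q) \<in> R" using that unfolding p q R by blast
      then show ?thesis using fle pq that unfolding p q by simp
    qed
    moreover have "(i, i') \<in> r" if "(f p, f q) \<in> P"
    proof (rule ccontr)
      assume "(i, i') \<notin> r"
      then have "i' \<in> underS r i"
        using tot[OF Fi(1,3)] unfolding underS_def by blast
      have "f p \<in> X i" "f q \<in> X i'" using fX pq unfolding p q by auto
      then have "(h (X i'), f p) \<in> P" using hX[OF Fi(1) \<open>i' \<in> underS r i\<close>] by simp
      then have "(h (X i'), f q) \<in> P" using that by (rule transD[OF tr])
      then show False using cap[OF X[OF Fi(3)] \<open>f q \<in> X i'\<close>] by simp
    qed
    moreover have "(j, j') \<in> r" if "(f p, f q) \<in> P"
    proof (rule ccontr)
      assume "(j, j') \<notin> r"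
      then have "(j', j) \<in> r - Id"
        using tot[OF Fi(2,4)] by blast
      then have "(q, p) \<in> R" unfolding p q R by blast
      then show False using fnle[of q p] pq \<open>(j', j) \<in> r - Id\<close> that unfolding p q by simp
    qed
    ultimately show "(p, q) \<in> incr_pairs r \<longleftrightarrow> (f p, f q) \<in> P"
      using pq unfolding incr_pairs_def p q by blast
  qed
qed

lemma antichain_converse: "antichain (P\<inverse>) X \<longleftrightarrow> antichain P X"
  unfolding antichain_def by auto

theorem embeds_into_incr_pairs_if_not_chain_colourable:
  assumes P: "Partial_order P" and AP: "A \<subseteq> Field P"
    and fac: "\<And>X. antichain P X \<Longrightarrow> X \<subseteq> A \<Longrightarrow> finite X"
    and \<kappa>: "Card_order \<kappa>" "cinfinite \<kappa>"
    and A: "\<not> chain_colourable \<kappa> P A"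
  shows "embeds_into (incr_pairs (cardSuc \<kappa>)) P A \<or> embeds_into ((incr_pairs (cardSuc \<kappa>))\<inverse>) P A"
proof -
  have sing: "chain_colourable \<kappa> P {x}" if "x \<in> Field P" for x
    using P that \<kappa>(2) unfolding partial_order_on_def preorder_on_def refl_on_def cinfinite_def
    by (intro chain_colourable_singleton) auto
  have ideal: "chain_colourable \<kappa> (P\<inverse>) = chain_colourable \<kappa> P"
    by (rule ext) (rule chain_colourable_converse)
  show ?thesis
  proof (rule up_type_or_linear_blocks[OF P AP fac chain_colourable_subset chain_colourable_Un[OF \<kappa>] sing A])
    fix B assume B: "B \<subseteq> A" "up_type (chain_colourable \<kappa> P) P B"
    have "embeds_into (incr_pairs (cardSuc \<kappa>)) P B"
      by (rule embeds_into_incr_pairs_if_up_type[OF P _ _ \<kappa> B(2)]) (use B(1) AP fac in auto)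
    then show ?thesis using embeds_into_mono B(1) by blast
  next
    fix B assume B: "B \<subseteq> A" "up_type (chain_colourable \<kappa> P) (P\<inverse>) B"
    have "embeds_into (incr_pairs (cardSuc \<kappa>)) (P\<inverse>) B"
      by (rule embeds_into_incr_pairs_if_up_type[OF _ _ _ \<kappa>]) (use P B AP fac in \<open>auto simp: ideal antichain_converse\<close>)
    then have "embeds_into ((incr_pairs (cardSuc \<kappa>))\<inverse>) P B"
      using embeds_into_converse[of "incr_pairs (cardSuc \<kappa>)" "P\<inverse>" B] by simp
    then show ?thesis using embeds_into_mono B(1) by blast
  next
    fix \<K> assume \<K>: "linear_blocks P \<K>" "\<And>K. K \<in> \<K> \<Longrightarrow> chain_colourable \<kappa> P K" "\<not> chain_colourable \<kappa> P (\<Union>\<K>)"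
    have "chain_colourable \<kappa> P (\<Union>\<K>)"
      using \<K>(2)
    proof (rule chain_colourable_lexicographic)
      fix K L x y assume "K \<in> \<K>" "L \<in> \<K>" "K \<noteq> L" "x \<in> K" "y \<in> L"
      then show "(x, y) \<in> P \<or> (y, x) \<in> P" using linear_blocksD(2)[OF \<K>(1), of K L] by auto
    qed
    then show ?thesis using \<K>(3) by blast
  qed
qed

section \<open>Increasing pairs\<close>

lemma Card_orderD:
  assumes "Card_order r"
  shows "Well_order r" "Refl r" "trans r" "antisym r" "Total r" "wf (r - Id)"
  using card_order_on_well_order_on[OF assms] unfolding order_on_defs by blast+

lemma Card_order_cases:
  assumes "Card_order r" "a \<in> Field r" "b \<in> Field r"
  shows "(a, b) \<in> r \<or> (b, a) \<in> r - Id"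
  using Card_orderD(2,5)[OF assms(1)] assms(2,3) unfolding refl_on_def total_on_def by (cases "a = b") auto

lemma Card_order_asym: "Card_order r \<Longrightarrow> (a, b) \<in> r \<Longrightarrow> (b, a) \<in> r - Id \<Longrightarrow> False"
  using antisymD[OF Card_orderD(4), of r a b] by auto

lemma Card_order_less_trans:
  assumes "Card_order r"
  shows "(a, b) \<in> r \<Longrightarrow> (b, c) \<in> r - Id \<Longrightarrow> (a, c) \<in> r - Id"
    and "(a, b) \<in> r - Id \<Longrightarrow> (b, c) \<in> r \<Longrightarrow> (a, c) \<in> r - Id"
  using transD[OF Card_orderD(3)[OF assms], of a b c] Card_order_asym[OF assms, of a b]
    Card_order_asym[OF assms, of b c] by auto

lemma regularCard_strict_bound:
  assumes r: "Card_order r" "cinfinite r" "regularCard r" and S: "S \<subseteq> Field r" "|S| <o r"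
  shows "\<exists>b\<in>Field r. \<forall>s\<in>S. (s, b) \<in> r - Id"
proof -
  have "\<not> cofinal S r"
    using r(3) S not_ordLess_ordIso unfolding regularCard_def by blast
  then obtain a where a: "a \<in> Field r" "\<And>b. b \<in> S \<Longrightarrow> \<not> (a \<noteq> b \<and> (a, b) \<in> r)"
    unfolding cofinal_def by blast
  obtain b where b: "b \<in> Field r" "(a, b) \<in> r - Id"
    using infinite_Card_order_limit[OF r(1) _ a(1)] r(2) unfolding cinfinite_def by blast
  have "(s, b) \<in> r - Id" if "s \<in> S" for s
  proof -
    have "(s, a) \<in> r" using Card_order_cases[OF r(1), of s a] a that S(1) by blast
    then show ?thesis using b(2) by (rule Card_order_less_trans(1)[OF r(1)])
  qed
  then show ?thesis using b(1) by blast
qed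

lemma Cinfinite_cardSucI:
  assumes "Card_order \<kappa>" "cinfinite \<kappa>"
  shows "Card_order (cardSuc \<kappa>)" "cinfinite (cardSuc \<kappa>)" "regularCard (cardSuc \<kappa>)"
  using Cinfinite_cardSuc[of \<kappa>] regularCard_cardSuc[of \<kappa>] assms by auto

theorem not_chain_colourable_incr_pairs:
  assumes \<kappa>: "Card_order \<kappa>" "cinfinite \<kappa>"
  shows "\<not> chain_colourable \<kappa> (incr_pairs (cardSuc \<kappa>)) (Field (incr_pairs (cardSuc \<kappa>)))"
proof
  define r where "r = cardSuc \<kappa>"
  have r: "Card_order r" "cinfinite r" "regularCard r" unfolding r_def using Cinfinite_cardSucI[OF \<kappa>] .
  have F: "Field (incr_pairs r) = r - Id" using Card_orderD(2)[OF r(1)] by (rule Field_incr_pairs)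
  assume "chain_colourable \<kappa> (incr_pairs (cardSuc \<kappa>)) (Field (incr_pairs (cardSuc \<kappa>)))"
  then have "chain_colourable \<kappa> (incr_pairs r) (r - Id)" unfolding r_def[symmetric] F .
  then obtain c where c: "c ` (r - Id) \<subseteq> Field \<kappa>"
    and chain: "\<forall>p\<in>r - Id. \<forall>q\<in>r - Id. c p = c q \<longrightarrow> (p, q) \<in> incr_pairs r \<or> (q, p) \<in> incr_pairs r"
    unfolding chain_colourable_def by blast
  have \<kappa>r: "\<kappa> <o r" unfolding r_def using \<kappa>(1) by (rule cardSuc_greater)
  have "\<exists>k\<in>Field \<kappa>. \<forall>b\<in>Field r. \<exists>\<beta>. (b, \<beta>) \<in> r - Id \<and> (\<alpha>, \<beta>) \<in> r - Id \<and> c (\<alpha>, \<beta>) = k"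
    if \<alpha>: "\<alpha> \<in> Field r" for \<alpha>
  proof (rule ccontr)
    assume no: "\<not> ?thesis"
    have "\<forall>k\<in>Field \<kappa>. \<exists>b\<in>Field r. \<forall>\<beta>. (b, \<beta>) \<in> r - Id \<longrightarrow> (\<alpha>, \<beta>) \<in> r - Id \<longrightarrow> c (\<alpha>, \<beta>) \<noteq> k"
    proof (intro ballI, rule ccontr)
      fix k assume k: "k \<in> Field \<kappa>"
        and "\<not> (\<exists>b\<in>Field r. \<forall>\<beta>. (b, \<beta>) \<in> r - Id \<longrightarrow> (\<alpha>, \<beta>) \<in> r - Id \<longrightarrow> c (\<alpha>, \<beta>) \<noteq> k)"
      then have "\<forall>b\<in>Field r. \<exists>\<beta>. (b, \<beta>) \<in> r - Id \<and> (\<alpha>, \<beta>) \<in> r - Id \<and> c (\<alpha>, \<beta>) = k" by simp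
      then show False using no k by (elim notE) (rule bexI)
    qed
    then obtain b where b: "\<And>k. k \<in> Field \<kappa> \<Longrightarrow> b k \<in> Field r"
      "\<And>k \<beta>. k \<in> Field \<kappa> \<Longrightarrow> (b k, \<beta>) \<in> r - Id \<Longrightarrow> (\<alpha>, \<beta>) \<in> r - Id \<Longrightarrow> c (\<alpha>, \<beta>) \<noteq> k" by metis
    have "|insert \<alpha> (b ` Field \<kappa>)| \<le>o \<kappa>"
      using Un_Cinfinite_bound[of "{\<alpha>}" \<kappa> "b ` Field \<kappa>"] \<kappa> card_of_ordLeq_if_finite[OF \<kappa>, of "{\<alpha>}"]
        card_of_image_ordLeq[OF ordIso_imp_ordLeq[OF card_of_Field_ordIso[OF \<kappa>(1)]], of b] by simp
    then have "|insert \<alpha> (b ` Field \<kappa>)| <o r" using \<kappa>r by (rule ordLeq_ordLess_trans)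
    from regularCard_strict_bound[OF r _ this] obtain \<beta> where \<beta>: "\<beta> \<in> Field r" "\<forall>s\<in>insert \<alpha> (b ` Field \<kappa>). (s, \<beta>) \<in> r - Id"
      using \<alpha> b(1) by (auto simp: image_subset_iff)
    then have "c (\<alpha>, \<beta>) \<in> Field \<kappa>" using c by auto
    then show False using b(2)[of "c (\<alpha>, \<beta>)" \<beta>] \<beta>(2) by simp
  qed
  then obtain k where k: "\<And>\<alpha>. \<alpha> \<in> Field r \<Longrightarrow> k \<alpha> \<in> Field \<kappa>"
    "\<And>\<alpha> b. \<alpha> \<in> Field r \<Longrightarrow> b \<in> Field r \<Longrightarrow> \<exists>\<beta>. (b, \<beta>) \<in> r - Id \<and> (\<alpha>, \<beta>) \<in> r - Id \<and> c (\<alpha>, \<beta>) = k \<alpha>"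
    by metis
  have "\<not> |Field r| \<le>o |Field \<kappa>|"
  proof
    assume "|Field r| \<le>o |Field \<kappa>|"
    then have "r \<le>o \<kappa>"
      using ordIso_ordLeq_trans[OF ordIso_symmetric[OF card_of_Field_ordIso[OF r(1)]]]
        ordLeq_ordIso_trans[OF _ card_of_Field_ordIso[OF \<kappa>(1)]] by blast
    then show False using \<kappa>r not_ordLess_ordLeq by blast
  qed
  then have "\<not> inj_on k (Field r)" using k(1) unfolding card_of_ordLeq[symmetric] by blast
  then obtain a0 a1 where "a0 \<in> Field r" "a1 \<in> Field r" "k a0 = k a1" "a0 \<noteq> a1" unfolding inj_on_def by blast
  then obtain \<alpha> \<alpha>' where \<alpha>: "\<alpha> \<in> Field r" "\<alpha>' \<in> Field r" "k \<alpha> = k \<alpha>'" "(\<alpha>, \<alpha>') \<in> r - Id"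
    using Card_order_cases[OF r(1), of a0 a1] by (metis DiffI pair_in_Id_conv)
  obtain \<beta>' where \<beta>': "(\<alpha>', \<beta>') \<in> r - Id" "c (\<alpha>', \<beta>') = k \<alpha>'" using k(2)[OF \<alpha>(2,2)] by blast
  then have "\<beta>' \<in> Field r" by (auto intro: FieldI2)
  then obtain \<beta> where \<beta>: "(\<beta>', \<beta>) \<in> r - Id" "(\<alpha>, \<beta>) \<in> r - Id" "c (\<alpha>, \<beta>) = k \<alpha>"
    using k(2)[OF \<alpha>(1)] by blast
  have "((\<alpha>, \<beta>), (\<alpha>', \<beta>')) \<in> incr_pairs r \<or> ((\<alpha>', \<beta>'), (\<alpha>, \<beta>)) \<in> incr_pairs r"
    using chain \<beta>' \<beta> \<alpha>(3) by auto
  then have "(\<beta>, \<beta>') \<in> r \<or> (\<alpha>', \<alpha>) \<in> r" unfolding incr_pairs_def by blast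
  then show False using Card_order_asym[OF r(1)] \<beta>(1) \<alpha>(4) by blast
qed

lemma card_of_above:
  assumes s: "Card_order s" "cinfinite s" and b: "b \<in> Field s"
  shows "\<not> |{x. (b, x) \<in> s}| <o s"
proof
  assume "|{x. (b, x) \<in> s}| <o s"
  then have "|{x. (b, x) \<in> s} \<union> underS s b| <o s"
    using Un_Cinfinite_bound_strict card_of_underS[OF s(1) b] s by blast
  moreover have "Field s \<subseteq> {x. (b, x) \<in> s} \<union> underS s b"
    using Card_order_cases[OF s(1) b] unfolding underS_def by blast
  ultimately have "|Field s| <o s" using card_of_mono1 ordLeq_ordLess_trans by blast
  then show False using card_of_Field_ordIso[OF s(1)] not_ordLess_ordIso by blast
qed

lemma embeds_into_incr_pairs_on:
  assumes r: "Well_order r" and s: "Well_order s" and X: "X \<subseteq> Field s" and le: "r \<le>o |X|"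
  shows "embeds_into (incr_pairs r) (incr_pairs s) ((s - Id) \<inter> X \<times> X)"
proof -
  have woX: "Well_order (Restr s X)" using s by (rule Well_order_Restr)
  have "well_order_on X (Restr s X)" using s X by (rule well_order_on_Restr)
  then have "|X| \<le>o Restr s X" by (rule card_of_least)
  with le have "r \<le>o Restr s X" by (rule ordLeq_transitive)
  then obtain e where "embed r (Restr s X) e" unfolding ordLeq_def by blast
  then have "iso r (Restr (Restr s X) (e ` Field r)) e"
    by (rule embed_implies_iso_Restr[OF woX r])
  then have bij: "bij_betw e (Field r) (Field (Restr (Restr s X) (e ` Field r)))"
    and rel: "\<forall>a\<in>Field r. \<forall>b\<in>Field r. (a, b) \<in> r \<longleftrightarrow> (e a, e b) \<in> Restr (Restr s X) (e ` Field r)"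
    unfolding iso_iff2 by blast+
  have inj: "inj_on e (Field r)" using bij unfolding bij_betw_def by blast
  have eX: "e a \<in> X" if "a \<in> Field r" for a
  proof -
    have "e a \<in> Field (Restr (Restr s X) (e ` Field r))" using bij that unfolding bij_betw_def by blast
    then show ?thesis unfolding Field_def by blast
  qed
  have le: "(a, b) \<in> r \<longleftrightarrow> (e a, e b) \<in> s" if "a \<in> Field r" "b \<in> Field r" for a b
    using rel eX that by auto
  have less: "(a, b) \<in> r - Id \<longleftrightarrow> (e a, e b) \<in> s - Id" if "a \<in> Field r" "b \<in> Field r" for a b
    using le[OF that] inj_on_eq_iff[OF inj that] by auto
  have "Refl r" using r unfolding order_on_defs by blast
  then have F: "Field (incr_pairs r) = r - Id" by (rule Field_incr_pairs)
  have Fr: "a \<in> Field r \<and> b \<in> Field r" if "(a, b) \<in> r - Id" for a b using that by (auto intro: FieldI1 FieldI2)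
  show ?thesis
  proof (rule embeds_intoI[where f = "map_prod e e"])
    fix p assume p: "p \<in> Field (incr_pairs r)"
    obtain a b where ab: "p = (a, b)" by (cases p)
    then have "(a, b) \<in> r - Id" using p F by blast
    then show "map_prod e e p \<in> (s - Id) \<inter> X \<times> X" using less[of a b] Fr[of a b] eX ab by auto
  next
    fix p q assume p: "p \<in> Field (incr_pairs r)" and q: "q \<in> Field (incr_pairs r)"
    obtain a b c d where ab: "p = (a, b)" "q = (c, d)" by (cases p; cases q) blast
    then have "(a, b) \<in> r - Id" "(c, d) \<in> r - Id" using p q F by blast+
    moreover from this have "a \<in> Field r" "b \<in> Field r" "c \<in> Field r" "d \<in> Field r" using Fr by blast+
    ultimately show "(p, q) \<in> incr_pairs r \<longleftrightarrow> (map_prod e e p, map_prod e e q) \<in> incr_pairs s"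
      using less[of a b] less[of c d] le[of a c] le[of b d] unfolding ab incr_pairs_def by simp
  qed
qed

lemma embeds_into_incr_pairs_mono:
  assumes "Card_order r" "Card_order s" "r \<le>o s"
  shows "embeds_into (incr_pairs r) (incr_pairs s) (Field (incr_pairs s))"
proof -
  have "r \<le>o |Field s|"
    using assms(3) ordIso_symmetric[OF card_of_Field_ordIso[OF assms(2)]] by (rule ordLeq_ordIso_trans)
  then have "embeds_into (incr_pairs r) (incr_pairs s) ((s - Id) \<inter> Field s \<times> Field s)"
    by (intro embeds_into_incr_pairs_on Card_orderD assms subset_refl)
  then show ?thesis
    by (rule embeds_into_mono) (use Field_incr_pairs[OF Card_orderD(2)[OF assms(2)]] in blast)
qed

lemma not_chain_colourable_if_embeds_into_incr_pairs:
  assumes \<kappa>: "Card_order \<kappa>" "cinfinite \<kappa>"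
    and emb: "embeds_into (incr_pairs (cardSuc \<kappa>)) P A \<or> embeds_into ((incr_pairs (cardSuc \<kappa>))\<inverse>) P A"
  shows "\<not> chain_colourable \<kappa> P A"
proof
  assume col: "chain_colourable \<kappa> P A"
  from emb have "chain_colourable \<kappa> (incr_pairs (cardSuc \<kappa>)) (Field (incr_pairs (cardSuc \<kappa>)))"
  proof
    assume "embeds_into (incr_pairs (cardSuc \<kappa>)) P A"
    then show ?thesis using col by (rule chain_colourable_if_embeds_into)
  next
    assume "embeds_into ((incr_pairs (cardSuc \<kappa>))\<inverse>) P A"
    then have "chain_colourable \<kappa> ((incr_pairs (cardSuc \<kappa>))\<inverse>) (Field ((incr_pairs (cardSuc \<kappa>))\<inverse>))"
      using col by (rule chain_colourable_if_embeds_into)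
    then show ?thesis unfolding chain_colourable_converse by simp
  qed
  then show False using not_chain_colourable_incr_pairs[OF \<kappa>] by blast
qed

lemma not_chain_colourable_principal_ideal:
  assumes \<rho>: "Card_order \<rho>" "cinfinite \<rho>"
    and emb: "embeds_into (incr_pairs (cardSuc (cardSuc \<rho>))) P D \<or>
      embeds_into ((incr_pairs (cardSuc (cardSuc \<rho>)))\<inverse>) P D"
  shows "\<exists>z\<in>D. \<not> chain_colourable \<rho> P {w\<in>D. (w, z) \<in> P}"
proof -
  define r where "r = cardSuc \<rho>"
  define s where "s = cardSuc r"
  have r: "Card_order r" "cinfinite r" unfolding r_def using Cinfinite_cardSucI[OF \<rho>] by blast+
  have s: "Card_order s" "cinfinite s" unfolding s_def using Cinfinite_cardSucI[OF r] by blast+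
  have rs: "r <o s" unfolding s_def using r(1) by (rule cardSuc_greater)
  have wo: "Well_order r" "Well_order s" using r(1) s(1) by (auto intro: Card_orderD)
  have F: "Field (incr_pairs s) = s - Id" using Card_orderD(2)[OF s(1)] by (rule Field_incr_pairs)
  have lim: "\<exists>b\<in>Field s. (a, b) \<in> s - Id" if "a \<in> Field s" for a
    using infinite_Card_order_limit[OF s(1) _ that] s(2) unfolding cinfinite_def by blast
  have ideal: "\<exists>z\<in>D. \<not> chain_colourable \<rho> P {w\<in>D. (w, z) \<in> P}"
    if R: "embeds_into R P D" and z: "z \<in> Field R" and below: "embeds_into R' R {p \<in> Field R. (p, z) \<in> R}"
      and R': "R' = incr_pairs r \<or> R' = (incr_pairs r)\<inverse>" for R R' z
  proof -
    obtain f where f: "f ` Field R \<subseteq> D" "\<forall>x\<in>Field R. \<forall>y\<in>Field R. (x, y) \<in> R \<longleftrightarrow> (f x, f y) \<in> P"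
      using R unfolding embeds_into_def by blast
    obtain g where g: "g ` Field R' \<subseteq> {p \<in> Field R. (p, z) \<in> R}"
      "\<forall>x\<in>Field R'. \<forall>y\<in>Field R'. (x, y) \<in> R' \<longleftrightarrow> (g x, g y) \<in> R"
      using below unfolding embeds_into_def by blast
    have "embeds_into R' P {w\<in>D. (w, f z) \<in> P}"
      by (rule embeds_intoI[of _ "f \<circ> g"]) (use f g z in \<open>auto simp: image_subset_iff\<close>)
    then have "\<not> chain_colourable \<rho> P {w\<in>D. (w, f z) \<in> P}"
      using R' not_chain_colourable_if_embeds_into_incr_pairs[OF \<rho>] unfolding r_def by blast
    then show ?thesis using f(1) z by blast
  qed
  from emb show ?thesis
  proof
    assume emb: "embeds_into (incr_pairs (cardSuc (cardSuc \<rho>))) P D"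
    obtain a where a: "a \<in> Field s" "r =o Restr s (underS s a)"
      using rs ordLess_iff_ordIso_Restr[OF wo(2,1)] by blast
    have "r =o |Field r|" using ordIso_symmetric[OF card_of_Field_ordIso[OF r(1)]] .
    also have "|Field r| =o |Field (Restr s (underS s a))|" using card_of_cong[OF a(2)] .
    also have "|Field (Restr s (underS s a))| \<le>o |underS s a|" by (rule card_of_mono1[OF Field_Restr_subset])
    finally have le: "r \<le>o |underS s a|" .
    obtain b where b: "b \<in> Field s" "(a, b) \<in> s - Id" using lim[OF a(1)] by blast
    have "underS s a \<subseteq> Field s" unfolding underS_def by (auto intro: FieldI1)
    then have "embeds_into (incr_pairs r) (incr_pairs s) ((s - Id) \<inter> underS s a \<times> underS s a)"
      using le by (rule embeds_into_incr_pairs_on[OF wo])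
    moreover have "(p, (a, b)) \<in> incr_pairs s" if "p \<in> (s - Id) \<inter> underS s a \<times> underS s a" for p
      using that b(2) Card_order_less_trans(2)[OF s(1), of _ a b]
      unfolding incr_pairs_def underS_def by (cases p) auto
    ultimately have "embeds_into (incr_pairs r) (incr_pairs s) {p \<in> Field (incr_pairs s). (p, (a, b)) \<in> incr_pairs s}"
      unfolding F by (elim embeds_into_mono) blast
    then show ?thesis using ideal[OF emb[folded r_def s_def]] b(2) F by blast
  next
    assume emb: "embeds_into ((incr_pairs (cardSuc (cardSuc \<rho>)))\<inverse>) P D"
    have "Field s \<noteq> {}" using s(2) unfolding cinfinite_def by auto
    then obtain a where a: "a \<in> Field s" by blast
    obtain b where b: "b \<in> Field s" "(a, b) \<in> s - Id" using lim[OF a(1)] by blast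
    define X where "X = {x. (b, x) \<in> s}"
    have "\<not> |X| <o s" unfolding X_def using card_of_above[OF s b(1)] .
    then have "s \<le>o |X|" using not_ordLess_iff_ordLeq[OF wo(2) card_of_Well_order] by blast
    then have le: "r \<le>o |X|" using rs ordLess_imp_ordLeq ordLeq_transitive by blast
    have "X \<subseteq> Field s" unfolding X_def by (auto intro: FieldI2)
    then have "embeds_into (incr_pairs r) (incr_pairs s) ((s - Id) \<inter> X \<times> X)"
      using le by (rule embeds_into_incr_pairs_on[OF wo])
    moreover have "((a, b), p) \<in> incr_pairs s" if "p \<in> (s - Id) \<inter> X \<times> X" for p
      using that b(2) Card_order_less_trans(2)[OF s(1), of a b]
      unfolding incr_pairs_def X_def by (cases p) auto
    ultimately have "embeds_into (incr_pairs r) (incr_pairs s) {p \<in> Field (incr_pairs s). ((a, b), p) \<in> incr_pairs s}"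
      unfolding F by (elim embeds_into_mono) blast
    then have "embeds_into ((incr_pairs r)\<inverse>) ((incr_pairs s)\<inverse>)
        {p \<in> Field ((incr_pairs s)\<inverse>). (p, (a, b)) \<in> (incr_pairs s)\<inverse>}"
      unfolding embeds_into_converse by simp
    moreover have "(a, b) \<in> Field ((incr_pairs s)\<inverse>)" using b(2) F by simp
    ultimately show ?thesis using ideal[OF emb[folded r_def s_def]] by blast
  qed
qed

section \<open>Cardinals below a limit cardinal of cofinality \<open>\<lambda>\<close>\<close>

lemma cinfinite_if_uncountable: "natLeq <o r \<Longrightarrow> cinfinite r"
  using cinfinite_mono[OF ordLess_imp_ordLeq natLeq_cinfinite] .

lemma ordLess_card_of_Field:
  assumes "Card_order r" "A \<subseteq> Field r" "\<not> |A| <o r"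
  shows "|A| =o r"
proof -
  have "|A| \<le>o r"
    using card_of_mono1[OF assms(2)] card_of_Field_ordIso[OF assms(1)] by (rule ordLeq_ordIso_trans)
  then show ?thesis using assms(3) ordLeq_iff_ordLess_or_ordIso by blast
qed

lemma Card_order_ordLess_or_ordLeq:
  "Card_order r \<Longrightarrow> Card_order s \<Longrightarrow> r <o s \<or> s \<le>o r"
  by (intro ordLess_or_ordLeq Card_orderD)

lemma ex_cofinal_in_cf:
  assumes "Card_order \<nu>" "lam =o cf \<nu>"
  obtains A where "cofinal_in A \<nu>" "lam =o |A|"
  using cf_least(1)[OF Card_orderD(2)[OF assms(1)]] assms(2) by auto

lemma not_cofinal_strict_bound:
  assumes \<nu>: "Card_order \<nu>" "cinfinite \<nu>" and B: "B \<subseteq> Field \<nu>" "\<not> cofinal_in B \<nu>"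
  shows "\<exists>b\<in>Field \<nu>. \<forall>x\<in>B. (x, b) \<in> \<nu> - Id"
proof -
  obtain a where a: "a \<in> Field \<nu>" "\<forall>x\<in>B. (a, x) \<notin> \<nu>" using B unfolding cofinal_in_def by blast
  have "(x, a) \<in> \<nu> - Id" if "x \<in> B" for x using Card_order_cases[OF \<nu>(1) a(1), of x] a(2) B(1) that by blast
  then show ?thesis using a(1) by blast
qed

lemma cofinality_strict_bound:
  assumes \<nu>: "Card_order \<nu>" "cinfinite \<nu>" and cf: "lam =o cf \<nu>"
    and B: "B \<subseteq> Field \<nu>" "|B| <o lam"
  shows "\<exists>b\<in>Field \<nu>. \<forall>x\<in>B. (x, b) \<in> \<nu> - Id"
proof (rule not_cofinal_strict_bound[OF \<nu> B(1)])
  show "\<not> cofinal_in B \<nu>"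
  proof
    assume "cofinal_in B \<nu>"
    then have "cf \<nu> \<le>o |B|" by (rule cf_least(2)[OF Card_orderD(2)[OF \<nu>(1)]])
    with cf have "lam \<le>o |B|" by (rule ordIso_ordLeq_trans)
    then show False using B(2) not_ordLess_ordLeq by blast
  qed
qed

lemma cofinality_infinite:
  assumes \<nu>: "Card_order \<nu>" "cinfinite \<nu>" and lam: "Card_order lam" "lam =o cf \<nu>"
  shows "cinfinite lam"
proof -
  obtain A where A: "cofinal_in A \<nu>" "lam =o |A|" using ex_cofinal_in_cf[OF \<nu>(1) lam(2)] by blast
  have fin: "\<exists>b\<in>Field \<nu>. \<forall>x\<in>B. (x, b) \<in> \<nu> - Id" if "finite B" "B \<subseteq> Field \<nu>" for B
    using that
  proof (induction B)
    case empty
    have "Field \<nu> \<noteq> {}" using \<nu>(2) unfolding cinfinite_def by auto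
    then show ?case by blast
  next
    case (insert y B)
    then obtain b where b: "b \<in> Field \<nu>" "\<forall>x\<in>B. (x, b) \<in> \<nu> - Id" by blast
    obtain c where c: "c \<in> Field \<nu>" "(b, c) \<in> \<nu> - Id"
      using infinite_Card_order_limit[OF \<nu>(1) _ b(1)] \<nu>(2) unfolding cinfinite_def by blast
    obtain d where d: "d \<in> Field \<nu>" "(y, d) \<in> \<nu> - Id"
      using infinite_Card_order_limit[OF \<nu>(1), of y] \<nu>(2) insert.prems unfolding cinfinite_def by blast
    from Card_order_cases[OF \<nu>(1) c(1) d(1)] show ?case
    proof
      assume "(c, d) \<in> \<nu>"
      then have "(b, d) \<in> \<nu> - Id" using Card_order_less_trans(2)[OF \<nu>(1) c(2)] by blast
      then have "(x, d) \<in> \<nu> - Id" if "x \<in> B" for x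
        using Card_order_less_trans(1)[OF \<nu>(1), of x b d] b(2) that by blast
      then show ?thesis using d by blast
    next
      assume "(d, c) \<in> \<nu> - Id"
      then have "(y, c) \<in> \<nu> - Id" using Card_order_less_trans(1)[OF \<nu>(1), of y d c] d(2) by blast
      moreover have "(x, c) \<in> \<nu> - Id" if "x \<in> B" for x
        using Card_order_less_trans(1)[OF \<nu>(1), of x b c] b(2) c(2) that by blast
      ultimately show ?thesis using c(1) by blast
    qed
  qed
  have "infinite A"
  proof
    assume "finite A"
    moreover have "A \<subseteq> Field \<nu>" using A(1) unfolding cofinal_in_def by blast
    ultimately obtain b where b: "b \<in> Field \<nu>" "\<forall>x\<in>A. (x, b) \<in> \<nu> - Id"
      using fin[of A] by blast
    then obtain x where x: "x \<in> A" "(b, x) \<in> \<nu>" using A(1) unfolding cofinal_in_def by blast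
    then show False using Card_order_asym[OF \<nu>(1) x(2)] b(2) by blast
  qed
  moreover have "|Field lam| =o |A|" using card_of_cong[OF A(2)] unfolding Field_card_of .
  ultimately show ?thesis using card_of_ordIso_finite[of "Field lam" A] unfolding cinfinite_def by blast
qed

lemma cofinality_regularCard:
  assumes \<nu>: "Card_order \<nu>" "cinfinite \<nu>" and lam: "Card_order lam" "lam =o cf \<nu>"
  shows "regularCard lam"
  unfolding regularCard_def
proof (intro allI impI, elim conjE, rule ccontr)
  fix K assume K: "K \<subseteq> Field lam" "cofinal K lam" "\<not> |K| =o lam"
  have inf: "cinfinite lam" using assms by (rule cofinality_infinite)
  have Kless: "|K| <o lam" using ordLess_card_of_Field[OF lam(1) K(1)] K(3) by blast
  obtain A where A: "cofinal_in A \<nu>" "lam =o |A|" using ex_cofinal_in_cf[OF \<nu>(1) lam(2)] by blast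
  then have "|Field lam| =o |A|" using card_of_cong[OF A(2)] unfolding Field_card_of by blast
  then obtain h where h: "bij_betw h (Field lam) A" unfolding card_of_ordIso[symmetric] by blast
  then have hA: "h ` Field lam = A" unfolding bij_betw_def by blast
  have "\<exists>b\<in>Field \<nu>. \<forall>x\<in>h ` underS lam k. (x, b) \<in> \<nu> - Id" if "k \<in> K" for k
  proof (rule cofinality_strict_bound[OF \<nu> lam(2)])
    show "h ` underS lam k \<subseteq> Field \<nu>"
      using hA A(1) unfolding cofinal_in_def underS_def by (auto intro: FieldI1)
    have "k \<in> Field lam" using K(1) that by blast
    then show "|h ` underS lam k| <o lam"
      by (rule ordLeq_ordLess_trans[OF card_of_image card_of_underS[OF lam(1)]])
  qed
  then obtain b where b: "\<And>k. k \<in> K \<Longrightarrow> b k \<in> Field \<nu>"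
    "\<And>k x. k \<in> K \<Longrightarrow> x \<in> h ` underS lam k \<Longrightarrow> (x, b k) \<in> \<nu> - Id" by metis
  have "|b ` K| <o lam" using card_of_image Kless by (rule ordLeq_ordLess_trans)
  moreover have "b ` K \<subseteq> Field \<nu>" using b(1) by (simp add: image_subset_iff)
  ultimately obtain a where a: "a \<in> Field \<nu>" "\<forall>x\<in>b ` K. (x, a) \<in> \<nu> - Id"
    using cofinality_strict_bound[OF \<nu> lam(2), of "b ` K"] by blast
  obtain y where y: "y \<in> A" "(a, y) \<in> \<nu>" using A(1) a(1) unfolding cofinal_in_def by blast
  then obtain t where t: "t \<in> Field lam" "y = h t" using hA by blast
  then obtain k where k: "k \<in> K" "t \<noteq> k" "(t, k) \<in> lam" using K(2) unfolding cofinal_def by blast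
  then have "(y, b k) \<in> \<nu> - Id" using b(2)[OF k(1), of y] t unfolding underS_def by blast
  moreover have "(b k, a) \<in> \<nu>" using a(2) k(1) by blast
  ultimately have "(y, a) \<in> \<nu> - Id" using Card_order_less_trans(2)[OF \<nu>(1)] by blast
  then show False using Card_order_asym[OF \<nu>(1) y(2)] by blast
qed

lemma cofinality_ordLeq:
  assumes "Card_order \<nu>" "lam =o cf \<nu>"
  shows "lam \<le>o \<nu>"
proof -
  obtain A where A: "cofinal_in A \<nu>" "lam =o |A|" using ex_cofinal_in_cf[OF assms] by blast
  have "|A| \<le>o |Field \<nu>|" using A(1) unfolding cofinal_in_def by (intro card_of_mono1) blast
  then have "|A| \<le>o \<nu>" using card_of_Field_ordIso[OF assms(1)] by (rule ordLeq_ordIso_trans)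
  with A(2) show ?thesis by (rule ordIso_ordLeq_trans)
qed

lemma small_family_bound:
  fixes \<nu> :: "'n rel" and \<mu> :: "'i \<Rightarrow> 'k rel"
  assumes \<nu>: "Card_order \<nu>" "natLeq <o \<nu>" and cf: "lam =o cf \<nu>"
    and I: "|I| <o lam" and \<mu>: "\<And>i. i \<in> I \<Longrightarrow> Card_order (\<mu> i) \<and> \<mu> i <o \<nu>"
  obtains \<rho> :: "'n rel" where "Card_order \<rho>" "cinfinite \<rho>" "\<rho> <o \<nu>" "\<forall>i\<in>I. \<mu> i \<le>o \<rho>"
proof -
  have wo: "Well_order \<nu>" using \<nu>(1) by (rule Card_orderD)
  have inf: "cinfinite \<nu>"
    using cinfinite_if_uncountable[OF \<nu>(2)] .
  have below: "\<exists>a\<in>Field \<nu>. \<mu>' \<le>o |underS \<nu> a|" if \<mu>': "Card_order \<mu>'" "\<mu>' <o \<nu>" for \<mu>' :: "'b rel"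
  proof -
    obtain a where a: "a \<in> Field \<nu>" "\<mu>' =o Restr \<nu> (underS \<nu> a)"
      using \<mu>'(2) ordLess_iff_ordIso_Restr[OF wo Card_orderD(1)[OF \<mu>'(1)]] by blast
    have "\<mu>' =o |Field \<mu>'|" using ordIso_symmetric[OF card_of_Field_ordIso[OF \<mu>'(1)]] .
    also have "|Field \<mu>'| =o |Field (Restr \<nu> (underS \<nu> a))|" using card_of_cong[OF a(2)] .
    also have "|Field (Restr \<nu> (underS \<nu> a))| \<le>o |underS \<nu> a|" by (rule card_of_mono1[OF Field_Restr_subset])
    finally show ?thesis using a(1) by blast
  qed
  have mono: "|underS \<nu> a| \<le>o |underS \<nu> b|" if "(a, b) \<in> \<nu>" for a b
    using that Card_order_less_trans(2)[OF \<nu>(1), of _ a b] unfolding underS_def by (intro card_of_mono1) blast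
  have "\<forall>i\<in>I. \<exists>a\<in>Field \<nu>. \<mu> i \<le>o |underS \<nu> a|" using below \<mu> by blast
  then obtain a where a: "\<And>i. i \<in> I \<Longrightarrow> a i \<in> Field \<nu>" "\<And>i. i \<in> I \<Longrightarrow> \<mu> i \<le>o |underS \<nu> (a i)|" by metis
  have "|a ` I| <o lam" using card_of_image I by (rule ordLeq_ordLess_trans)
  moreover have "a ` I \<subseteq> Field \<nu>" using a(1) by (simp add: image_subset_iff)
  ultimately obtain b where b: "b \<in> Field \<nu>" "\<forall>x\<in>a ` I. (x, b) \<in> \<nu> - Id"
    using cofinality_strict_bound[OF \<nu>(1) inf cf, of "a ` I"] by blast
  obtain n where n: "n \<in> Field \<nu>" "natLeq \<le>o |underS \<nu> n|" using below[OF natLeq_Card_order \<nu>(2)] by blast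
  obtain c where c: "c \<in> Field \<nu>" "(b, c) \<in> \<nu>" "(n, c) \<in> \<nu>"
    using Card_order_cases[OF \<nu>(1) b(1) n(1)] b(1) n(1) Card_orderD(2)[OF \<nu>(1)] unfolding refl_on_def by blast
  show thesis
  proof (rule that)
    show "Card_order |underS \<nu> c|" by (rule card_of_Card_order)
    show "cinfinite |underS \<nu> c|"
      using cinfinite_mono[OF ordLeq_transitive[OF n(2) mono[OF c(3)]] natLeq_cinfinite] .
    show "|underS \<nu> c| <o \<nu>" using \<nu>(1) c(1) by (rule card_of_underS)
    show "\<forall>i\<in>I. \<mu> i \<le>o |underS \<nu> c|"
    proof
      fix i assume i: "i \<in> I"
      then have "(a i, b) \<in> \<nu>" using b(2) by blast
      with a(2)[OF i] mono have "\<mu> i \<le>o |underS \<nu> b|" using ordLeq_transitive by blast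
      then show "\<mu> i \<le>o |underS \<nu> c|" using mono[OF c(2)] by (rule ordLeq_transitive)
    qed
  qed
qed

lemma two_cardinals_bound:
  fixes \<nu> :: "'n rel"
  assumes "Card_order \<rho>" "\<rho> <o \<nu>" "Card_order \<sigma>" "\<sigma> <o \<nu>"
    and \<nu>: "Card_order \<nu>" "natLeq <o \<nu>" and lam: "Card_order lam" "lam =o cf \<nu>"
  obtains \<tau> :: "'n rel" where "Card_order \<tau>" "cinfinite \<tau>" "\<tau> <o \<nu>" "\<rho> \<le>o \<tau>" "\<sigma> \<le>o \<tau>"
proof -
  have "cinfinite \<nu>" using cinfinite_if_uncountable[OF \<nu>(2)] .
  then have inf: "cinfinite lam" by (rule cofinality_infinite[OF \<nu>(1) _ lam])
  have fin: "|{()}| <o lam"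
    by (rule finite_ordLess_infinite)
      (use lam(1) inf in \<open>simp_all add: cinfinite_def Field_card_of card_of_well_order_on card_order_on_well_order_on\<close>)
  have \<rho>\<sigma>: "Card_order \<rho> \<and> \<rho> <o \<nu>" "Card_order \<sigma> \<and> \<sigma> <o \<nu>" using assms(1-4) by blast+
  obtain \<rho>' :: "'n rel" where \<rho>': "Card_order \<rho>'" "cinfinite \<rho>'" "\<rho>' <o \<nu>" "\<forall>i\<in>{()}. \<rho> \<le>o \<rho>'"
    by (rule small_family_bound[OF \<nu> lam(2) fin \<rho>\<sigma>(1)])
  obtain \<sigma>' :: "'n rel" where \<sigma>': "Card_order \<sigma>'" "cinfinite \<sigma>'" "\<sigma>' <o \<nu>" "\<forall>i\<in>{()}. \<sigma> \<le>o \<sigma>'"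
    by (rule small_family_bound[OF \<nu> lam(2) fin \<rho>\<sigma>(2)])
  have le: "\<rho> \<le>o \<rho>'" "\<sigma> \<le>o \<sigma>'" using \<rho>'(4) \<sigma>'(4) by simp_all
  from Card_order_ordLess_or_ordLeq[OF \<rho>'(1) \<sigma>'(1)] show thesis
  proof
    assume "\<rho>' <o \<sigma>'"
    then have "\<rho> \<le>o \<sigma>'" by (rule ordLeq_transitive[OF le(1) ordLess_imp_ordLeq])
    then show thesis using that[OF \<sigma>'(1-3)] le(2) by blast
  next
    assume "\<sigma>' \<le>o \<rho>'"
    then have "\<sigma> \<le>o \<rho>'" by (rule ordLeq_transitive[OF le(2)])
    then show thesis using that[OF \<rho>'(1-3) le(1)] by blast
  qed
qed

lemma cardSuc_ordLess_limit_cardinal: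
  fixes \<nu> :: "'n rel" and \<rho> :: "'r rel"
  assumes lim: "limit_cardinal \<nu>" and \<rho>: "Card_order \<rho>" "\<rho> <o \<nu>"
  shows "cardSuc \<rho> <o \<nu>"
proof -
  have \<nu>: "Card_order \<nu>" using lim unfolding limit_cardinal_def by blast
  obtain \<rho>' :: "'n rel" where \<rho>': "\<rho> =o \<rho>'" "\<rho>' <o \<nu>" using \<rho>(2) unfolding internalize_ordLess[of \<rho>] by blast
  then have co: "Card_order \<rho>'" using \<rho>(1) Card_order_ordIso2 by blast
  then have "cardSuc \<rho>' <o \<nu>" using lim \<rho>'(2) unfolding limit_cardinal_def by blast
  moreover have "cardSuc \<rho> =o cardSuc \<rho>'" using cardSuc_invar_ordIso[OF \<rho>(1) co] \<rho>'(1) by blast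
  ultimately show ?thesis using ordIso_ordLess_trans by blast
qed

lemma succ_family_unbounded:
  fixes \<nu> :: "'n rel" and lam :: "'l rel"
  assumes \<nu>: "Card_order \<nu>" "natLeq <o \<nu>" and lam: "Card_order lam" "lam =o cf \<nu>"
    and fam: "succ_family lam \<nu> \<kappa>"
    and \<rho>: "Card_order \<rho>" "\<rho> <o \<nu>" and a: "a \<in> Field lam"
  shows "\<exists>\<alpha>\<in>Field lam. (a, \<alpha>) \<in> lam - Id \<and> \<rho> \<le>o cardSuc (\<kappa> \<alpha>)"
proof (rule ccontr)
  assume no: "\<not> ?thesis"
  have inf: "cinfinite \<nu>" using cinfinite_if_uncountable[OF \<nu>(2)] .
  then have linf: "cinfinite lam" by (rule cofinality_infinite[OF \<nu>(1) _ lam])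
  have K: "Card_order (cardSuc (\<kappa> \<alpha>)) \<and> cardSuc (\<kappa> \<alpha>) <o \<nu>" if "\<alpha> \<in> Field lam" for \<alpha>
    using fam that cardSuc_Card_order unfolding succ_family_def by blast
  obtain b where b: "b \<in> Field lam" "(a, b) \<in> lam - Id"
    using infinite_Card_order_limit[OF lam(1) _ a] linf unfolding cinfinite_def by blast
  have sub: "underS lam b \<subseteq> Field lam" unfolding underS_def by (auto intro: FieldI1)
  have KS: "Card_order (cardSuc (\<kappa> \<alpha>)) \<and> cardSuc (\<kappa> \<alpha>) <o \<nu>" if "\<alpha> \<in> underS lam b" for \<alpha>
    using K sub that by blast
  obtain \<sigma> :: "'n rel" where \<sigma>: "Card_order \<sigma>" "cinfinite \<sigma>" "\<sigma> <o \<nu>" "\<forall>\<alpha>\<in>underS lam b. cardSuc (\<kappa> \<alpha>) \<le>o \<sigma>"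
    by (rule small_family_bound[OF \<nu> lam(2) card_of_underS[OF lam(1) b(1)] KS])
  obtain \<tau> :: "'n rel" where \<tau>: "Card_order \<tau>" "cinfinite \<tau>" "\<tau> <o \<nu>" "\<rho> \<le>o \<tau>" "\<sigma> \<le>o \<tau>"
    by (rule two_cardinals_bound[OF \<rho> \<sigma>(1,3) \<nu> lam])
  have "cardSuc (\<kappa> \<alpha>) \<le>o \<tau>" if \<alpha>: "\<alpha> \<in> Field lam" for \<alpha>
  proof (cases "\<alpha> \<in> underS lam b")
    case True
    then show ?thesis using \<sigma>(4) \<tau>(5) ordLeq_transitive by blast
  next
    case False
    then have "(b, \<alpha>) \<in> lam" using Card_order_cases[OF lam(1) b(1) \<alpha>] unfolding underS_def by blast
    then have "(a, \<alpha>) \<in> lam - Id" using Card_order_less_trans(2)[OF lam(1) b(2)] by blast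
    then have "\<not> \<rho> \<le>o cardSuc (\<kappa> \<alpha>)" using no \<alpha> by blast
    then have "cardSuc (\<kappa> \<alpha>) <o \<rho>" using Card_order_ordLess_or_ordLeq[of "cardSuc (\<kappa> \<alpha>)" \<rho>] K[OF \<alpha>] \<rho>(1) by blast
    then show ?thesis by (rule ordLeq_transitive[OF ordLess_imp_ordLeq \<tau>(4)])
  qed
  then have "\<nu> \<le>o \<tau>" using fam \<tau>(1) unfolding succ_family_def is_card_Sup_def by blast
  then show False using \<tau>(3) not_ordLess_ordLeq by blast
qed

lemma strictly_increasing_choice:
  assumes lam: "Card_order lam" "cinfinite lam" "regularCard lam"
    and ex: "\<And>i a. i \<in> Field lam \<Longrightarrow> a \<in> Field lam \<Longrightarrow> \<exists>v\<in>Field lam. (a, v) \<in> lam - Id \<and> \<Phi> i v"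
  obtains e where "\<And>i. i \<in> Field lam \<Longrightarrow> e i \<in> Field lam"
    "\<And>i. i \<in> Field lam \<Longrightarrow> \<Phi> i (e i)"
    "\<And>i j. (i, j) \<in> lam - Id \<Longrightarrow> (e i, e j) \<in> lam - Id"
proof -
  have "\<exists>e. \<forall>i. i \<in> Field lam \<longrightarrow> e i \<in> Field lam \<and> \<Phi> i (e i) \<and> (\<forall>j\<in>underS lam i. (e j, e i) \<in> lam - Id)"
  proof (rule dependent_wf_choice[OF Card_orderD(6)[OF lam(1)]])
    fix i e assume IH: "\<And>j. (j, i) \<in> lam - Id \<Longrightarrow> j \<in> Field lam \<longrightarrow>
      e j \<in> Field lam \<and> \<Phi> j (e j) \<and> (\<forall>k\<in>underS lam j. (e k, e j) \<in> lam - Id)"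
    show "\<exists>v. i \<in> Field lam \<longrightarrow> v \<in> Field lam \<and> \<Phi> i v \<and> (\<forall>j\<in>underS lam i. (e j, v) \<in> lam - Id)"
    proof (cases "i \<in> Field lam")
      case True
      have "|e ` underS lam i| <o lam"
        using card_of_image card_of_underS[OF lam(1) True] by (rule ordLeq_ordLess_trans)
      moreover have "e ` underS lam i \<subseteq> Field lam"
        using IH unfolding underS_def by (auto simp: image_subset_iff intro: FieldI1)
      ultimately obtain a where a: "a \<in> Field lam" "\<forall>s\<in>e ` underS lam i. (s, a) \<in> lam - Id"
        using regularCard_strict_bound[OF lam, of "e ` underS lam i"] by blast
      obtain v where v: "v \<in> Field lam" "(a, v) \<in> lam - Id" "\<Phi> i v" using ex[OF True a(1)] by blast
      have "(e j, v) \<in> lam - Id" if "j \<in> underS lam i" for j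
        using Card_order_less_trans(1)[OF lam(1), of "e j" a v] a(2) v(2) that by auto
      then show ?thesis using v by blast
    qed simp
  qed (auto simp: underS_def)
  then obtain e where e: "\<forall>i. i \<in> Field lam \<longrightarrow> e i \<in> Field lam \<and> \<Phi> i (e i) \<and> (\<forall>j\<in>underS lam i. (e j, e i) \<in> lam - Id)"
    by blast
  have "(e i, e j) \<in> lam - Id" if "(i, j) \<in> lam - Id" for i j
    using e[rule_format, of j] that unfolding underS_def by (auto intro: FieldI2)
  then show thesis using that[of e] e by simp
qed

section \<open>The four posets\<close>

lemma Q4_eq: "Q4 lam \<kappa> = lex_sum lam (\<lambda>\<alpha>. (incr_pairs (cardSuc (\<kappa> \<alpha>)))\<inverse>)"
  unfolding Q4_def Q2_def converse_lex_sum by simp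

lemma succ_familyD:
  assumes "succ_family lam \<nu> \<kappa>" "\<alpha> \<in> Field lam"
  shows "Card_order (\<kappa> \<alpha>)" "cinfinite (\<kappa> \<alpha>)" "Card_order (cardSuc (\<kappa> \<alpha>))"
    "cardSuc (\<kappa> \<alpha>) <o \<nu>" "\<kappa> \<alpha> <o \<nu>"
proof -
  show 1: "Card_order (\<kappa> \<alpha>)" "cardSuc (\<kappa> \<alpha>) <o \<nu>" using assms unfolding succ_family_def by blast+
  have "cinfinite (cardSuc (\<kappa> \<alpha>))" using assms unfolding succ_family_def by blast
  then show "cinfinite (\<kappa> \<alpha>)" unfolding cinfinite_def using cardSuc_finite[OF 1(1)] by blast
  show "Card_order (cardSuc (\<kappa> \<alpha>))" using 1(1) by (rule cardSuc_Card_order)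
  show "\<kappa> \<alpha> <o \<nu>" using cardSuc_greater[OF 1(1)] 1(2) by (rule ordLess_transitive)
qed

lemma Partial_order_Card_order: "Card_order r \<Longrightarrow> Partial_order r"
  using card_order_on_well_order_on[of "Field r" r] unfolding order_on_defs by blast

lemma Linear_order_Card_order: "Card_order r \<Longrightarrow> Linear_order r"
  using card_order_on_well_order_on[of "Field r" r] unfolding order_on_defs by blast

lemma Partial_order_Q:
  assumes lam: "Card_order lam" and fam: "succ_family lam \<nu> \<kappa>"
  shows "Partial_order (Q1 lam \<kappa>)" "Partial_order (Q2 lam \<kappa>)"
    "Partial_order (Q3 lam \<kappa>)" "Partial_order (Q4 lam \<kappa>)"
proof -
  have inc: "Partial_order (incr_pairs (cardSuc (\<kappa> \<alpha>)))" if "\<alpha> \<in> Field lam" for \<alpha>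
    by (intro Partial_order_incr_pairs Partial_order_Card_order succ_familyD(3)[OF fam that])
  show 1: "Partial_order (Q1 lam \<kappa>)" unfolding Q1_def
    by (intro Partial_order_lex_sum Partial_order_Card_order lam inc)
  show 2: "Partial_order (Q2 lam \<kappa>)" unfolding Q2_def
    by (intro Partial_order_lex_sum) (use Partial_order_Card_order[OF lam] inc in simp_all)
  show "Partial_order (Q3 lam \<kappa>)" "Partial_order (Q4 lam \<kappa>)"
    unfolding Q3_def Q4_def using 1 2 by simp_all
qed

lemma antisym_Partial_order: "Partial_order r \<Longrightarrow> antisym r" and Refl_Partial_order: "Partial_order r \<Longrightarrow> Refl r"
  and trans_Partial_order: "Partial_order r \<Longrightarrow> trans r"
  unfolding partial_order_on_def preorder_on_def by blast+

lemma embeddable_if_embeds_into: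
  "Partial_order R \<Longrightarrow> Partial_order P \<Longrightarrow> embeds_into R P (Field P) \<Longrightarrow> embeddable R P"
  using embeddable_iff_embeds_into[of R P] antisym_Partial_order Refl_Partial_order by blast

lemma embeds_into_if_embeddable:
  assumes "embeds_into R Q (Field Q)" "embeddable Q P"
  shows "embeds_into R P (Field P)"
proof -
  have "embeds_into Q P (Field P)" using assms(2) unfolding embeddable_iff embeds_into_def by blast
  with assms(1) show ?thesis by (rule embeds_into_trans)
qed

lemma embeds_into_lex_sum_lex_sum:
  assumes C: "Linear_order C" and QR: "\<And>\<alpha>. \<alpha> \<in> Field C \<Longrightarrow> Partial_order (Q \<alpha>)" "\<And>\<alpha>. \<alpha> \<in> Field C \<Longrightarrow> Partial_order (R \<alpha>)"
    and e: "\<And>\<alpha>. \<alpha> \<in> Field C \<Longrightarrow> e \<alpha> \<in> Field C" "\<And>\<alpha> \<beta>. (\<alpha>, \<beta>) \<in> C - Id \<Longrightarrow> (e \<alpha>, e \<beta>) \<in> C - Id"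
    and emb: "\<And>\<alpha>. \<alpha> \<in> Field C \<Longrightarrow> embeds_into (Q \<alpha>) (R (e \<alpha>)) (Field (R (e \<alpha>)))"
  shows "embeds_into (lex_sum C Q) (lex_sum C R) (Field (lex_sum C R))"
proof -
  have poC: "Partial_order C" using C unfolding linear_order_on_def by blast
  have F: "Field (lex_sum C R) = (SIGMA \<alpha>:Field C. Field (R \<alpha>))"
    by (rule Field_lex_sum) (rule Refl_Partial_order[OF QR(2)])
  have "embeds_into (lex_sum C Q) (lex_sum C R) (\<Union>\<alpha>\<in>Field C. {e \<alpha>} \<times> Field (R (e \<alpha>)))"
  proof (rule embeds_into_lex_sum[OF _ C])
    show "Refl (Q \<alpha>)" if "\<alpha> \<in> Field C" for \<alpha> using QR(1)[OF that] by (rule Refl_Partial_order)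
    show "antisym (lex_sum C R)" by (rule antisym_Partial_order[OF Partial_order_lex_sum[OF poC QR(2)]])
  next
    fix \<alpha> assume \<alpha>: "\<alpha> \<in> Field C"
    obtain f where f: "f ` Field (Q \<alpha>) \<subseteq> Field (R (e \<alpha>))"
      "\<forall>x\<in>Field (Q \<alpha>). \<forall>y\<in>Field (Q \<alpha>). (x, y) \<in> Q \<alpha> \<longleftrightarrow> (f x, f y) \<in> R (e \<alpha>)"
      using emb[OF \<alpha>] unfolding embeds_into_def by blast
    show "embeds_into (Q \<alpha>) (lex_sum C R) ({e \<alpha>} \<times> Field (R (e \<alpha>)))"
      by (rule embeds_intoI[of _ "\<lambda>x. (e \<alpha>, f x)"])
        (use f e(1)[OF \<alpha>] in \<open>auto simp: lex_sum_def image_subset_iff\<close>)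
  next
    fix \<alpha> \<beta> x y assume ab: "(\<alpha>, \<beta>) \<in> C - Id"
      and x: "x \<in> {e \<alpha>} \<times> Field (R (e \<alpha>))" and y: "y \<in> {e \<beta>} \<times> Field (R (e \<beta>))"
    have "e \<alpha> \<in> Field C" "e \<beta> \<in> Field C" using ab e(1) by (auto intro: FieldI1 FieldI2)
    then show "(x, y) \<in> lex_sum C R - Id" using x y e(2)[OF ab] unfolding lex_sum_def by auto
  qed
  then show ?thesis by (rule embeds_into_mono) (use F e(1) in auto)
qed

lemma embeddable_Q_Q:
  fixes \<nu> :: "'n rel" and lam :: "'l rel"
  assumes \<nu>: "Card_order \<nu>" "natLeq <o \<nu>" and lam: "Card_order lam" "lam =o cf \<nu>"
    and fam: "succ_family lam \<nu> \<kappa>" "succ_family lam \<nu> \<kappa>'"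
  shows "embeddable (Q1 lam \<kappa>) (Q1 lam \<kappa>')" "embeddable (Q2 lam \<kappa>) (Q2 lam \<kappa>')"
    "embeddable (Q3 lam \<kappa>) (Q3 lam \<kappa>')" "embeddable (Q4 lam \<kappa>) (Q4 lam \<kappa>')"
proof -
  have inf: "cinfinite \<nu>" using cinfinite_if_uncountable[OF \<nu>(2)] .
  have linf: "cinfinite lam" using cofinality_infinite[OF \<nu>(1) inf lam] .
  have reg: "regularCard lam" using cofinality_regularCard[OF \<nu>(1) inf lam] .
  have ex: "\<exists>v\<in>Field lam. (a, v) \<in> lam - Id \<and> cardSuc (\<kappa> i) \<le>o cardSuc (\<kappa>' v)"
    if "i \<in> Field lam" "a \<in> Field lam" for i a
    using succ_family_unbounded[OF \<nu> lam fam(2) succ_familyD(3,4)[OF fam(1) that(1)] that(2)] .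
  obtain e where e: "\<forall>i\<in>Field lam. e i \<in> Field lam \<and> cardSuc (\<kappa> i) \<le>o cardSuc (\<kappa>' (e i))"
    "\<forall>i j. (i, j) \<in> lam - Id \<longrightarrow> (e i, e j) \<in> lam - Id"
    using strictly_increasing_choice[OF lam(1) linf reg, of "\<lambda>i v. cardSuc (\<kappa> i) \<le>o cardSuc (\<kappa>' v)"] ex
    by metis
  have po: "Partial_order (incr_pairs (cardSuc (\<kappa> \<alpha>)))" "Partial_order (incr_pairs (cardSuc (\<kappa>' \<alpha>)))"
    if "\<alpha> \<in> Field lam" for \<alpha>
    using succ_familyD(3)[OF fam(1) that] succ_familyD(3)[OF fam(2) that]
    by (auto intro: Partial_order_incr_pairs Partial_order_Card_order)
  have emb: "embeds_into (incr_pairs (cardSuc (\<kappa> \<alpha>))) (incr_pairs (cardSuc (\<kappa>' (e \<alpha>)))) (Field (incr_pairs (cardSuc (\<kappa>' (e \<alpha>)))))"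
    if "\<alpha> \<in> Field lam" for \<alpha>
    using succ_familyD(3)[OF fam(1) that] succ_familyD(3)[OF fam(2), of "e \<alpha>"] e(1) that
    by (intro embeds_into_incr_pairs_mono) auto
  have lin: "Linear_order lam" using lam(1) by (rule Linear_order_Card_order)
  note poQ = Partial_order_Q[OF lam(1) fam(1)]
  note poQ' = Partial_order_Q[OF lam(1) fam(2)]
  have "embeds_into (Q1 lam \<kappa>) (Q1 lam \<kappa>') (Field (Q1 lam \<kappa>'))"
    unfolding Q1_def by (rule embeds_into_lex_sum_lex_sum[where e = e]) (use lin po emb e in auto)
  then show 1: "embeddable (Q1 lam \<kappa>) (Q1 lam \<kappa>')"
    by (rule embeddable_if_embeds_into[OF poQ(1) poQ'(1)])
  have e': "(e \<alpha>, e \<beta>) \<in> lam\<inverse> - Id" if "(\<alpha>, \<beta>) \<in> lam\<inverse> - Id" for \<alpha> \<beta>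
    using e(2)[rule_format, of \<beta> \<alpha>] that by auto
  have "embeds_into (Q2 lam \<kappa>) (Q2 lam \<kappa>') (Field (Q2 lam \<kappa>'))"
    unfolding Q2_def by (rule embeds_into_lex_sum_lex_sum[where e = e]) (fact e' | use lin po emb e(1) in simp)+
  then show 2: "embeddable (Q2 lam \<kappa>) (Q2 lam \<kappa>')"
    by (rule embeddable_if_embeds_into[OF poQ(2) poQ'(2)])
  show "embeddable (Q3 lam \<kappa>) (Q3 lam \<kappa>')" "embeddable (Q4 lam \<kappa>) (Q4 lam \<kappa>')"
    unfolding Q3_def Q4_def embeddable_converse by (fact 1, fact 2)
qed

lemma embeds_into_block:
  assumes "\<alpha> \<in> Field C" "\<And>\<alpha>. \<alpha> \<in> Field C \<Longrightarrow> Refl (Q \<alpha>)"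
  shows "embeds_into (Q \<alpha>) (lex_sum C Q) (Field (lex_sum C Q))"
proof (rule embeds_intoI[of _ "Pair \<alpha>"])
  show "(\<alpha>, x) \<in> Field (lex_sum C Q)" if "x \<in> Field (Q \<alpha>)" for x
    using Field_lex_sum[of C Q] assms that by auto
  show "(x, y) \<in> Q \<alpha> \<longleftrightarrow> ((\<alpha>, x), (\<alpha>, y)) \<in> lex_sum C Q" if "x \<in> Field (Q \<alpha>)" "y \<in> Field (Q \<alpha>)" for x y
    using assms(1) that unfolding lex_sum_def by auto
qed

lemma ordLeq_Cov_if_embeddable_Q:
  fixes \<nu> :: "'n rel" and lam :: "'l rel" and P :: "'p rel"
  assumes \<nu>: "Card_order \<nu>" and lam: "Card_order lam"
    and fam: "succ_family lam \<nu> \<kappa>" and P: "Partial_order P"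
    and emb: "embeddable (Q1 lam \<kappa>) P \<or> embeddable (Q2 lam \<kappa>) P \<or> embeddable (Q3 lam \<kappa>) P \<or> embeddable (Q4 lam \<kappa>) P"
  shows "\<nu> \<le>o Cov P"
proof (rule ccontr)
  assume "\<not> \<nu> \<le>o Cov P"
  obtain \<C> where "Cov P = |\<C>|" using Cov_least(1)[OF P] by blast
  then have co: "Card_order (Cov P)" by (simp add: card_of_Card_order)
  then have less: "Cov P <o \<nu>" using \<open>\<not> \<nu> \<le>o Cov P\<close> Card_order_ordLess_or_ordLeq \<nu> by blast
  have refl: "Refl (incr_pairs (cardSuc (\<kappa> \<alpha>)))" if "\<alpha> \<in> Field lam" for \<alpha>
    using succ_familyD(3)[OF fam that] by (intro Refl_Partial_order Partial_order_incr_pairs Partial_order_Card_order)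
  have blk: "embeds_into (incr_pairs (cardSuc (\<kappa> \<alpha>))) (Q1 lam \<kappa>) (Field (Q1 lam \<kappa>))"
    "embeds_into (incr_pairs (cardSuc (\<kappa> \<alpha>))) (Q2 lam \<kappa>) (Field (Q2 lam \<kappa>))" if "\<alpha> \<in> Field lam" for \<alpha>
    unfolding Q1_def Q2_def
    using embeds_into_block[of \<alpha> lam "\<lambda>\<alpha>. incr_pairs (cardSuc (\<kappa> \<alpha>))"]
      embeds_into_block[of \<alpha> "lam\<inverse>" "\<lambda>\<alpha>. incr_pairs (cardSuc (\<kappa> \<alpha>))"] refl that by simp_all
  then have blk': "embeds_into ((incr_pairs (cardSuc (\<kappa> \<alpha>)))\<inverse>) (Q3 lam \<kappa>) (Field (Q3 lam \<kappa>))"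
    "embeds_into ((incr_pairs (cardSuc (\<kappa> \<alpha>)))\<inverse>) (Q4 lam \<kappa>) (Field (Q4 lam \<kappa>))" if "\<alpha> \<in> Field lam" for \<alpha>
    using that unfolding Q3_def Q4_def embeds_into_converse by simp_all
  have "cardSuc (\<kappa> \<alpha>) \<le>o Cov P" if \<alpha>: "\<alpha> \<in> Field lam" for \<alpha>
  proof -
    have "embeds_into (incr_pairs (cardSuc (\<kappa> \<alpha>))) P (Field P) \<or> embeds_into ((incr_pairs (cardSuc (\<kappa> \<alpha>)))\<inverse>) P (Field P)"
      using emb embeds_into_if_embeddable[OF blk(1)[OF \<alpha>]] embeds_into_if_embeddable[OF blk(2)[OF \<alpha>]]
        embeds_into_if_embeddable[OF blk'(1)[OF \<alpha>]] embeds_into_if_embeddable[OF blk'(2)[OF \<alpha>]] by metis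
    then have "\<not> chain_colourable (\<kappa> \<alpha>) P (Field P)"
      using not_chain_colourable_if_embeds_into_incr_pairs succ_familyD(1,2)[OF fam \<alpha>] by blast
    then have "\<not> Cov P \<le>o \<kappa> \<alpha>" using Cov_ordLeq_iff[OF P succ_familyD(1)[OF fam \<alpha>]] by blast
    then have "\<kappa> \<alpha> <o Cov P" using Card_order_ordLess_or_ordLeq[OF succ_familyD(1)[OF fam \<alpha>] co] by blast
    then show ?thesis by (rule cardSuc_least[OF succ_familyD(1)[OF fam \<alpha>] co])
  qed
  moreover obtain \<rho> :: "'n rel" where \<rho>: "Cov P =o \<rho>" "\<rho> <o \<nu>" using less unfolding internalize_ordLess[of "Cov P"] by blast
  moreover have "Card_order \<rho>" using co \<rho>(1) by (rule Card_order_ordIso2)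
  ultimately have "\<nu> \<le>o \<rho>" using fam ordLeq_ordIso_trans unfolding succ_family_def is_card_Sup_def by blast
  then show False using \<rho>(2) not_ordLess_ordLeq by blast
qed

section \<open>Covering number at least a limit cardinal\<close>

lemma ex_greater:
  assumes "Card_order r" "cinfinite r" "a \<in> Field r"
  obtains b where "b \<in> Field r" "(a, b) \<in> r - Id"
  using infinite_Card_order_limit[OF assms(1) _ assms(3)] assms(2) unfolding cinfinite_def by blast

lemma cinfinite_nonempty: "cinfinite r \<Longrightarrow> \<exists>a. a \<in> Field r"
  unfolding cinfinite_def by (metis all_not_in_conv finite.emptyI)

lemma card_of_under:
  assumes r: "Card_order r" "cinfinite r" and a: "a \<in> Field r"
  shows "|{x. (x, a) \<in> r}| <o r"
proof -
  obtain b where b: "b \<in> Field r" "(a, b) \<in> r - Id" using r a by (rule ex_greater)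
  have "{x. (x, a) \<in> r} \<subseteq> underS r b"
    using Card_order_less_trans(1)[OF r(1) _ b(2)] unfolding underS_def by blast
  then show ?thesis by (rule ordLeq_ordLess_trans[OF card_of_mono1 card_of_underS[OF r(1) b(1)]])
qed

lemma embeds_into_lex_sum_if_unbounded:
  fixes lam :: "'l rel" and P :: "'p rel"
  assumes lam: "Card_order lam" "cinfinite lam" "regularCard lam" and P: "Partial_order P"
    and ord: "\<And>i j x y. (i, j) \<in> lam - Id \<Longrightarrow> x \<in> D i \<Longrightarrow> y \<in> D j \<Longrightarrow> (x, y) \<in> P - Id"
    and D: "\<And>i. i \<in> Field lam \<Longrightarrow> D i \<subseteq> Field P"
    and R: "\<And>i. i \<in> Field lam \<Longrightarrow> Refl (R i)"
    and unb: "\<And>a. a \<in> Field lam \<Longrightarrow>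
      \<exists>v\<in>Field lam. (a, v) \<in> lam - Id \<and> (\<forall>j. (j, v) \<in> lam \<longrightarrow> embeds_into (R j) P (D v))"
  shows "embeds_into (lex_sum lam R) P (Field P)"
proof -
  define \<Phi> where "\<Phi> i v \<longleftrightarrow> (i, v) \<in> lam \<and> (\<forall>j. (j, v) \<in> lam \<longrightarrow> embeds_into (R j) P (D v))" for i v
  have ex: "\<exists>v\<in>Field lam. (a, v) \<in> lam - Id \<and> \<Phi> i v" if ia: "i \<in> Field lam" "a \<in> Field lam" for i a
  proof -
    obtain b where b: "b \<in> Field lam" "(i, b) \<in> lam" "(a, b) \<in> lam"
      using Card_order_cases[OF lam(1) ia] Card_orderD(2)[OF lam(1)] ia unfolding refl_on_def by blast
    obtain v where v: "v \<in> Field lam" "(b, v) \<in> lam - Id" "\<forall>j. (j, v) \<in> lam \<longrightarrow> embeds_into (R j) P (D v)"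
      using unb[OF b(1)] by blast
    have "(a, v) \<in> lam - Id" "(i, v) \<in> lam"
      using Card_order_less_trans(1)[OF lam(1) b(3) v(2)] Card_order_less_trans(1)[OF lam(1) b(2) v(2)] by blast+
    then show ?thesis using v unfolding \<Phi>_def by blast
  qed
  obtain e where e: "\<forall>i\<in>Field lam. e i \<in> Field lam \<and> \<Phi> i (e i)"
    "\<forall>i j. (i, j) \<in> lam - Id \<longrightarrow> (e i, e j) \<in> lam - Id"
    using strictly_increasing_choice[OF lam, of \<Phi>] ex by metis
  have "embeds_into (lex_sum lam R) P (\<Union>i\<in>Field lam. D (e i))"
  proof (rule embeds_into_lex_sum)
    show "embeds_into (R i) P (D (e i))" if "i \<in> Field lam" for i using e(1) that unfolding \<Phi>_def by blast
    show "(x, y) \<in> P - Id" if "(i, j) \<in> lam - Id" "x \<in> D (e i)" "y \<in> D (e j)" for i j x y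
      using ord[OF e(2)[rule_format, OF that(1)] that(2,3)] .
  qed (use R Linear_order_Card_order[OF lam(1)] antisym_Partial_order[OF P] in auto)
  then show ?thesis by (rule embeds_into_mono) (use D e(1) in blast)
qed

lemma embeddable_Q1_or_Q4:
  fixes lam :: "'l rel" and P :: "'p rel" and \<rho> :: "'l \<Rightarrow> 'r rel"
  assumes lam: "Card_order lam" "cinfinite lam" "regularCard lam" and P: "Partial_order P"
    and fac: "\<And>X. antichain P X \<Longrightarrow> finite X"
    and fam: "succ_family lam \<nu> \<kappa>"
    and D: "\<And>i. i \<in> Field lam \<Longrightarrow> D i \<subseteq> Field P"
    and ord: "\<And>i j x y. (i, j) \<in> lam - Id \<Longrightarrow> x \<in> D i \<Longrightarrow> y \<in> D j \<Longrightarrow> (x, y) \<in> P - Id"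
    and \<rho>: "\<And>i. i \<in> Field lam \<Longrightarrow> Card_order (\<rho> i) \<and> cinfinite (\<rho> i)"
    and le: "\<And>i j. (j, i) \<in> lam \<Longrightarrow> \<kappa> j \<le>o \<rho> i"
    and big: "\<And>i. i \<in> Field lam \<Longrightarrow> \<not> chain_colourable (\<rho> i) P (D i)"
  shows "embeddable (Q1 lam \<kappa>) P \<or> embeddable (Q4 lam \<kappa>) P"
proof -
  define N where "N j = incr_pairs (cardSuc (\<kappa> j))" for j
  define T where "T i \<longleftrightarrow> (\<forall>j. (j, i) \<in> lam \<longrightarrow> embeds_into (N j) P (D i))" for i
  define T' where "T' i \<longleftrightarrow> (\<forall>j. (j, i) \<in> lam \<longrightarrow> embeds_into ((N j)\<inverse>) P (D i))" for i
  have poN: "Partial_order (N j)" if "j \<in> Field lam" for j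
    unfolding N_def by (intro Partial_order_incr_pairs Partial_order_Card_order succ_familyD(3)[OF fam that])
  have TT: "T i \<or> T' i" if i: "i \<in> Field lam" for i
  proof -
    have N: "embeds_into (N j) (incr_pairs (cardSuc (\<rho> i))) (Field (incr_pairs (cardSuc (\<rho> i))))" if j: "(j, i) \<in> lam" for j
      unfolding N_def
    proof (rule embeds_into_incr_pairs_mono)
      have jF: "j \<in> Field lam" using j by (rule FieldI1)
      show "Card_order (cardSuc (\<kappa> j))" using succ_familyD(3)[OF fam jF] .
      show "Card_order (cardSuc (\<rho> i))" using \<rho>[OF i] cardSuc_Card_order by blast
      show "cardSuc (\<kappa> j) \<le>o cardSuc (\<rho> i)"
        using cardSuc_mono_ordLeq[OF succ_familyD(1)[OF fam jF]] \<rho>[OF i] le[OF j] by blast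
    qed
    have "embeds_into (incr_pairs (cardSuc (\<rho> i))) P (D i) \<or> embeds_into ((incr_pairs (cardSuc (\<rho> i)))\<inverse>) P (D i)"
      using embeds_into_incr_pairs_if_not_chain_colourable[OF P D[OF i], of "\<rho> i"] fac \<rho>[OF i] big[OF i] by simp
    then show ?thesis
    proof
      assume "embeds_into (incr_pairs (cardSuc (\<rho> i))) P (D i)"
      then have "T i" unfolding T_def using embeds_into_trans[OF N] by blast
      then show ?thesis ..
    next
      assume emb: "embeds_into ((incr_pairs (cardSuc (\<rho> i)))\<inverse>) P (D i)"
      have "T' i"
        unfolding T'_def
      proof (intro allI impI)
        fix j assume "(j, i) \<in> lam"
        from N[OF this] show "embeds_into ((N j)\<inverse>) P (D i)"
          by (intro embeds_into_trans[OF _ emb]) (simp add: embeds_into_converse)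
      qed
      then show ?thesis ..
    qed
  qed
  have "(\<forall>a\<in>Field lam. \<exists>v\<in>Field lam. (a, v) \<in> lam - Id \<and> T v) \<or> (\<forall>a\<in>Field lam. \<exists>v\<in>Field lam. (a, v) \<in> lam - Id \<and> T' v)"
  proof (rule ccontr)
    assume "\<not> ?thesis"
    then obtain a b where a: "a \<in> Field lam" "\<forall>v\<in>Field lam. (a, v) \<in> lam - Id \<longrightarrow> \<not> T v"
      and b: "b \<in> Field lam" "\<forall>v\<in>Field lam. (b, v) \<in> lam - Id \<longrightarrow> \<not> T' v" by blast
    obtain c where c: "c \<in> Field lam" "(a, c) \<in> lam" "(b, c) \<in> lam"
      using Card_order_cases[OF lam(1) a(1) b(1)] Card_orderD(2)[OF lam(1)] a(1) b(1) unfolding refl_on_def by blast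
    obtain v where v: "v \<in> Field lam" "(c, v) \<in> lam - Id" using lam(1,2) c(1) by (rule ex_greater)
    then show False
      using a(2) b(2) TT[OF v(1)] Card_order_less_trans(1)[OF lam(1) c(2) v(2)]
        Card_order_less_trans(1)[OF lam(1) c(3) v(2)] by blast
  qed
  then show ?thesis
  proof
    assume unb: "\<forall>a\<in>Field lam. \<exists>v\<in>Field lam. (a, v) \<in> lam - Id \<and> T v"
    have "embeds_into (lex_sum lam N) P (Field P)"
      by (rule embeds_into_lex_sum_if_unbounded[OF lam P ord D])
        (use unb poN in \<open>auto simp: T_def intro: Refl_Partial_order\<close>)
    then have "embeds_into (Q1 lam \<kappa>) P (Field P)" unfolding Q1_def N_def .
    then show ?thesis using embeddable_if_embeds_into[OF Partial_order_Q(1)[OF lam(1) fam] P] by blast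
  next
    assume unb: "\<forall>a\<in>Field lam. \<exists>v\<in>Field lam. (a, v) \<in> lam - Id \<and> T' v"
    have "embeds_into (lex_sum lam (\<lambda>j. (N j)\<inverse>)) P (Field P)"
      by (rule embeds_into_lex_sum_if_unbounded[OF lam P ord D])
        (use unb poN in \<open>auto simp: T'_def intro: Refl_Partial_order\<close>)
    then have "embeds_into (Q4 lam \<kappa>) P (Field P)" unfolding Q4_eq N_def .
    then show ?thesis using embeddable_if_embeds_into[OF Partial_order_Q(4)[OF lam(1) fam] P] by blast
  qed
qed

definition small_cover :: "'n rel \<Rightarrow> 'p rel \<Rightarrow> 'p set \<Rightarrow> bool" where
  "small_cover \<nu> P A \<longleftrightarrow>
     (\<exists>\<rho> :: 'n rel. Card_order \<rho> \<and> cinfinite \<rho> \<and> \<rho> <o \<nu> \<and> chain_colourable \<rho> P A)"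

lemma small_cover_converse: "small_cover \<nu> (P\<inverse>) = small_cover \<nu> P"
  unfolding small_cover_def chain_colourable_converse by (rule ext) simp

lemma small_cover_subset: "small_cover \<nu> P B \<Longrightarrow> A \<subseteq> B \<Longrightarrow> small_cover \<nu> P A"
  unfolding small_cover_def using chain_colourable_subset by blast

lemma small_coverI:
  fixes \<nu> :: "'n rel"
  assumes \<nu>: "Card_order \<nu>" "natLeq <o \<nu>" and lam: "Card_order lam" "lam =o cf \<nu>"
    and \<rho>: "Card_order \<rho>" "\<rho> <o \<nu>" and col: "chain_colourable \<rho> P A"
  shows "small_cover \<nu> P A"
proof -
  obtain \<tau> :: "'n rel" where \<tau>: "Card_order \<tau>" "cinfinite \<tau>" "\<tau> <o \<nu>" "\<rho> \<le>o \<tau>" "\<rho> \<le>o \<tau>"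
    by (rule two_cardinals_bound[OF \<rho> \<rho> \<nu> lam])
  then show ?thesis unfolding small_cover_def using chain_colourable_ordLeq[OF col \<tau>(4)] by blast
qed

lemma small_cover_singleton:
  assumes \<nu>: "Card_order \<nu>" "natLeq <o \<nu>" and lam: "Card_order lam" "lam =o cf \<nu>" and "(x, x) \<in> P"
  shows "small_cover \<nu> P {x}"
proof (rule small_coverI[OF \<nu> lam natLeq_Card_order \<nu>(2)])
  show "chain_colourable natLeq P {x}" by (rule chain_colourable_singleton) (use assms(5) in \<open>simp_all add: Field_natLeq\<close>)
qed

lemma small_cover_Un:
  fixes \<nu> :: "'n rel"
  assumes \<nu>: "Card_order \<nu>" "natLeq <o \<nu>" and lam: "Card_order lam" "lam =o cf \<nu>"
    and A: "small_cover \<nu> P A" and B: "small_cover \<nu> P B"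
  shows "small_cover \<nu> P (A \<union> B)"
proof -
  obtain \<rho> :: "'n rel" where \<rho>: "Card_order \<rho>" "\<rho> <o \<nu>" "chain_colourable \<rho> P A" using A unfolding small_cover_def by blast
  obtain \<sigma> :: "'n rel" where \<sigma>: "Card_order \<sigma>" "\<sigma> <o \<nu>" "chain_colourable \<sigma> P B" using B unfolding small_cover_def by blast
  obtain \<tau> :: "'n rel" where \<tau>: "Card_order \<tau>" "cinfinite \<tau>" "\<tau> <o \<nu>" "\<rho> \<le>o \<tau>" "\<sigma> \<le>o \<tau>"
    by (rule two_cardinals_bound[OF \<rho>(1,2) \<sigma>(1,2) \<nu> lam])
  have "chain_colourable \<tau> P (A \<union> B)"
    using chain_colourable_Un[OF \<tau>(1,2)] chain_colourable_ordLeq[OF \<rho>(3) \<tau>(4)] chain_colourable_ordLeq[OF \<sigma>(3) \<tau>(5)] by blast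
  then show ?thesis using \<tau> unfolding small_cover_def by blast
qed

lemma small_cover_family_bound:
  fixes \<nu> :: "'n rel" and A :: "'i \<Rightarrow> 'p set"
  assumes \<nu>: "Card_order \<nu>" "natLeq <o \<nu>" and lam: "Card_order lam" "lam =o cf \<nu>"
    and I: "|I| <o lam" and A: "\<And>i. i \<in> I \<Longrightarrow> small_cover \<nu> P (A i)"
    and \<sigma>: "Card_order \<sigma>" "\<sigma> <o \<nu>"
  obtains \<tau> :: "'n rel" where "Card_order \<tau>" "cinfinite \<tau>" "\<tau> <o \<nu>" "\<sigma> \<le>o \<tau>"
    "\<forall>i\<in>I. chain_colourable \<tau> P (A i)"
proof -
  have "\<forall>i. \<exists>\<rho> :: 'n rel. i \<in> I \<longrightarrow> Card_order \<rho> \<and> \<rho> <o \<nu> \<and> chain_colourable \<rho> P (A i)"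
    using A unfolding small_cover_def by blast
  then obtain \<rho> :: "'i \<Rightarrow> 'n rel" where \<rho>: "\<forall>i\<in>I. Card_order (\<rho> i) \<and> \<rho> i <o \<nu> \<and> chain_colourable (\<rho> i) P (A i)"
    by metis
  then have \<rho>': "Card_order (\<rho> i) \<and> \<rho> i <o \<nu>" if "i \<in> I" for i using that by blast
  obtain \<rho>0 :: "'n rel" where \<rho>0: "Card_order \<rho>0" "cinfinite \<rho>0" "\<rho>0 <o \<nu>" "\<forall>i\<in>I. \<rho> i \<le>o \<rho>0"
    by (rule small_family_bound[OF \<nu> lam(2) I \<rho>'])
  obtain \<tau> :: "'n rel" where \<tau>: "Card_order \<tau>" "cinfinite \<tau>" "\<tau> <o \<nu>" "\<rho>0 \<le>o \<tau>" "\<sigma> \<le>o \<tau>"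
    by (rule two_cardinals_bound[OF \<rho>0(1,3) \<sigma> \<nu> lam])
  have "chain_colourable \<tau> P (A i)" if "i \<in> I" for i
    using chain_colourable_ordLeq[of "\<rho> i" P "A i" \<tau>] \<rho> \<rho>0(4) \<tau>(4) ordLeq_transitive that by blast
  then show thesis using that[OF \<tau>(1-3,5)] by blast
qed

lemma ex_cumulative_bounds:
  fixes \<nu> :: "'n rel" and lam :: "'l rel"
  assumes \<nu>: "Card_order \<nu>" "natLeq <o \<nu>" and lam: "Card_order lam" "lam =o cf \<nu>"
    and fam: "succ_family lam \<nu> \<kappa>"
  obtains \<rho> :: "'l \<Rightarrow> 'n rel" where
    "\<forall>i\<in>Field lam. Card_order (\<rho> i) \<and> cinfinite (\<rho> i) \<and> \<rho> i <o \<nu> \<and> (\<forall>j. (j, i) \<in> lam \<longrightarrow> \<kappa> j \<le>o \<rho> i)"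
proof -
  have inf: "cinfinite \<nu>" using cinfinite_if_uncountable[OF \<nu>(2)] .
  have linf: "cinfinite lam" using cofinality_infinite[OF \<nu>(1) inf lam] .
  have "\<exists>\<rho> :: 'n rel. Card_order \<rho> \<and> cinfinite \<rho> \<and> \<rho> <o \<nu> \<and> (\<forall>j. (j, i) \<in> lam \<longrightarrow> \<kappa> j \<le>o \<rho>)"
    if i: "i \<in> Field lam" for i
  proof -
    have \<kappa>: "Card_order (\<kappa> j) \<and> \<kappa> j <o \<nu>" if "j \<in> {j. (j, i) \<in> lam}" for j
      using succ_familyD(1,5)[OF fam, of j] that by (auto intro: FieldI1)
    obtain \<rho> :: "'n rel" where "Card_order \<rho>" "cinfinite \<rho>" "\<rho> <o \<nu>" "\<forall>j\<in>{j. (j, i) \<in> lam}. \<kappa> j \<le>o \<rho>"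
      by (rule small_family_bound[OF \<nu> lam(2) card_of_under[OF lam(1) linf i] \<kappa>])
    then show ?thesis by blast
  qed
  then show thesis using that by metis
qed

lemma embeddable_Q_if_up_type:
  fixes \<nu> :: "'n rel" and lam :: "'l rel" and P :: "'p rel"
  assumes lim: "limit_cardinal \<nu>" "natLeq <o \<nu>" and lam: "Card_order lam" "lam =o cf \<nu>"
    and fam: "succ_family lam \<nu> \<kappa>" and P: "Partial_order P" and fac: "\<And>X. antichain P X \<Longrightarrow> finite X"
    and BP: "B \<subseteq> Field P" and B: "up_type (small_cover \<nu> P) P B"
  shows "embeddable (Q1 lam \<kappa>) P \<or> embeddable (Q4 lam \<kappa>) P"
proof -
  have \<nu>: "Card_order \<nu>" "natLeq <o \<nu>" using lim unfolding limit_cardinal_def by blast+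
  have inf: "cinfinite \<nu>" using cinfinite_if_uncountable[OF \<nu>(2)] .
  have linf: "cinfinite lam" using cofinality_infinite[OF \<nu>(1) inf lam] .
  have reg: "regularCard lam" using cofinality_regularCard[OF \<nu>(1) inf lam] .
  have tr: "trans P" using P by (rule trans_Partial_order)
  have as: "antisym P" using P by (rule antisym_Partial_order)
  have refl: "(x, x) \<in> P" if "x \<in> B" for x using Refl_Partial_order[OF P] BP that unfolding refl_on_def by blast
  have posB: "\<not> small_cover \<nu> P B" and comp: "\<And>x. x \<in> B \<Longrightarrow> small_cover \<nu> P {y\<in>B. (x, y) \<notin> P}"
    using B unfolding up_type_def by blast+
  have dir: "\<exists>b\<in>B. \<forall>x\<in>X. (x, b) \<in> P" if X: "X \<subseteq> B" "|X| <o lam" for X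
  proof (rule ccontr)
    assume "\<not> ?thesis"
    then have BX: "B \<subseteq> (\<Union>x\<in>X. {y\<in>B. (x, y) \<notin> P})" by blast
    have compX: "small_cover \<nu> P {y\<in>B. (x, y) \<notin> P}" if "x \<in> X" for x using comp X(1) that by blast
    have X\<nu>: "|X| <o \<nu>" using X(2) cofinality_ordLeq[OF \<nu>(1) lam(2)] by (rule ordLess_ordLeq_trans)
    obtain \<tau> :: "'n rel" where \<tau>: "Card_order \<tau>" "cinfinite \<tau>" "\<tau> <o \<nu>" "|X| \<le>o \<tau>"
        "\<forall>x\<in>X. chain_colourable \<tau> P {y\<in>B. (x, y) \<notin> P}"
      by (rule small_cover_family_bound[OF \<nu> lam X(2) compX card_of_Card_order X\<nu>])
    have "chain_colourable \<tau> P (\<Union>x\<in>X. {y\<in>B. (x, y) \<notin> P})"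
      using \<tau>(5) by (intro chain_colourable_UN[OF \<tau>(1,2,4)]) blast
    then have "small_cover \<nu> P (\<Union>x\<in>X. {y\<in>B. (x, y) \<notin> P})" unfolding small_cover_def using \<tau>(1-3) by blast
    then show False using posB small_cover_subset[OF _ BX] by blast
  qed
  define G where "G y x = {z\<in>B. (y, z) \<in> P \<and> z \<noteq> y \<and> (z, x) \<in> P}" for y x
  have big: "\<exists>x\<in>B. \<not> chain_colourable \<rho> P (G y x)"
    if y: "y \<in> B" and \<rho>: "Card_order \<rho>" "cinfinite \<rho>" "\<rho> <o \<nu>" for y and \<rho> :: "'n rel"
  proof -
    define D where "D = {z\<in>B. (y, z) \<in> P \<and> z \<noteq> y}"
    have D: "\<not> small_cover \<nu> P D"
    proof
      assume "small_cover \<nu> P D"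
      then have "small_cover \<nu> P (D \<union> ({y} \<union> {z\<in>B. (y, z) \<notin> P}))"
        using small_cover_Un[OF \<nu> lam] small_cover_singleton[where P = P, OF \<nu> lam refl[OF y]] comp[OF y] by blast
      moreover have "B \<subseteq> D \<union> ({y} \<union> {z\<in>B. (y, z) \<notin> P})" unfolding D_def by blast
      ultimately show False using posB small_cover_subset by blast
    qed
    have s: "Card_order (cardSuc \<rho>)" "cinfinite (cardSuc \<rho>)" using Cinfinite_cardSucI[OF \<rho>(1,2)] by blast+
    have "cardSuc \<rho> <o \<nu>" using lim(1) \<rho>(1,3) by (rule cardSuc_ordLess_limit_cardinal)
    then have "\<not> chain_colourable (cardSuc \<rho>) P D" using small_coverI[OF \<nu> lam s(1)] D by blast
    then have "embeds_into (incr_pairs (cardSuc (cardSuc \<rho>))) P D \<or> embeds_into ((incr_pairs (cardSuc (cardSuc \<rho>)))\<inverse>) P D"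
      using embeds_into_incr_pairs_if_not_chain_colourable[OF P _ _ s, of D] fac BP unfolding D_def by blast
    then obtain x where x: "x \<in> D" "\<not> chain_colourable \<rho> P {w\<in>D. (w, x) \<in> P}"
      using not_chain_colourable_principal_ideal[OF \<rho>(1,2)] by blast
    have "{w\<in>D. (w, x) \<in> P} = G y x" unfolding D_def G_def by blast
    then show ?thesis using x unfolding D_def by auto
  qed
  obtain \<rho> :: "'l \<Rightarrow> 'n rel" where \<rho>: "\<forall>i\<in>Field lam. Card_order (\<rho> i) \<and> cinfinite (\<rho> i) \<and> \<rho> i <o \<nu> \<and> (\<forall>j. (j, i) \<in> lam \<longrightarrow> \<kappa> j \<le>o \<rho> i)"
    by (rule ex_cumulative_bounds[OF \<nu> lam fam])
  have "\<exists>f. \<forall>i. i \<in> Field lam \<longrightarrow> fst (f i) \<in> B \<and> snd (f i) \<in> B \<and>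
      (\<forall>j\<in>underS lam i. (snd (f j), fst (f i)) \<in> P) \<and> \<not> chain_colourable (\<rho> i) P (G (fst (f i)) (snd (f i)))"
  proof (rule dependent_wf_choice[OF Card_orderD(6)[OF lam(1)]])
    fix i and f :: "'l \<Rightarrow> 'p \<times> 'p" assume IH: "\<And>j. (j, i) \<in> lam - Id \<Longrightarrow> j \<in> Field lam \<longrightarrow> fst (f j) \<in> B \<and> snd (f j) \<in> B \<and>
      (\<forall>k\<in>underS lam j. (snd (f k), fst (f j)) \<in> P) \<and> \<not> chain_colourable (\<rho> j) P (G (fst (f j)) (snd (f j)))"
    show "\<exists>v. i \<in> Field lam \<longrightarrow> fst v \<in> B \<and> snd v \<in> B \<and>
      (\<forall>j\<in>underS lam i. (snd (f j), fst v) \<in> P) \<and> \<not> chain_colourable (\<rho> i) P (G (fst v) (snd v))"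
    proof (cases "i \<in> Field lam")
      case True
      have "snd (f j) \<in> B" if "j \<in> underS lam i" for j
        using IH[of j] that unfolding underS_def by (auto intro: FieldI1)
      then have sub: "(\<lambda>j. snd (f j)) ` underS lam i \<subseteq> B" by blast
      have "|(\<lambda>j. snd (f j)) ` underS lam i| <o lam"
        using card_of_image card_of_underS[OF lam(1) True] by (rule ordLeq_ordLess_trans)
      from dir[OF sub this] obtain y where y: "y \<in> B" "\<forall>j\<in>underS lam i. (snd (f j), y) \<in> P" by auto
      obtain x where "x \<in> B" "\<not> chain_colourable (\<rho> i) P (G y x)" using big[OF y(1), of "\<rho> i"] \<rho> True by blast
      then show ?thesis using y by (intro exI[of _ "(y, x)"]) simp
    qed simp
  qed (auto simp: underS_def)
  then obtain f where f: "\<forall>i\<in>Field lam. fst (f i) \<in> B \<and> snd (f i) \<in> B \<and>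
      (\<forall>j\<in>underS lam i. (snd (f j), fst (f i)) \<in> P) \<and> \<not> chain_colourable (\<rho> i) P (G (fst (f i)) (snd (f i)))" by blast
  show ?thesis
  proof (rule embeddable_Q1_or_Q4[OF lam(1) linf reg P fac fam])
    show "G (fst (f i)) (snd (f i)) \<subseteq> Field P" for i using BP unfolding G_def by blast
    show "\<not> chain_colourable (\<rho> i) P (G (fst (f i)) (snd (f i)))" if "i \<in> Field lam" for i using f that by blast
    show "Card_order (\<rho> i) \<and> cinfinite (\<rho> i)" if "i \<in> Field lam" for i using \<rho> that by blast
    show "\<kappa> j \<le>o \<rho> i" if "(j, i) \<in> lam" for i j using \<rho> that FieldI2[OF that] by blast
  next
    fix i j x y assume ij: "(i, j) \<in> lam - Id" and x: "x \<in> G (fst (f i)) (snd (f i))" and y: "y \<in> G (fst (f j)) (snd (f j))"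
    have "j \<in> Field lam" "i \<in> underS lam j" using ij unfolding underS_def by (auto intro: FieldI2)
    then have "(snd (f i), fst (f j)) \<in> P" using f by blast
    then have xf: "(x, fst (f j)) \<in> P" using x transD[OF tr, of x "snd (f i)" "fst (f j)"] unfolding G_def by blast
    moreover have fy: "(fst (f j), y) \<in> P" "y \<noteq> fst (f j)" using y unfolding G_def by blast+
    ultimately have "(x, y) \<in> P" using transD[OF tr] by blast
    moreover have "x \<noteq> y" using antisymD[OF as fy(1)] xf fy(2) by blast
    ultimately show "(x, y) \<in> P - Id" by blast
  qed
qed

lemma embeddable_Q3_or_Q2_if_converse:
  assumes "embeddable (Q1 lam \<kappa>) (P\<inverse>) \<or> embeddable (Q4 lam \<kappa>) (P\<inverse>)"
  shows "embeddable (Q3 lam \<kappa>) P \<or> embeddable (Q2 lam \<kappa>) P"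
  using assms embeddable_converse[of "Q1 lam \<kappa>" "P\<inverse>"] embeddable_converse[of "Q4 lam \<kappa>" "P\<inverse>"]
  unfolding Q3_def Q4_def by simp

lemma embeddable_Q_if_increasing_blocks:
  fixes lam :: "'l rel" and P :: "'p rel" and \<rho> :: "'l \<Rightarrow> 'r rel"
  assumes lam: "Card_order lam" "cinfinite lam" "regularCard lam" and P: "Partial_order P"
    and fac: "\<And>X. antichain P X \<Longrightarrow> finite X"
    and fam: "succ_family lam \<nu> \<kappa>"
    and K: "\<And>i. i \<in> Field lam \<Longrightarrow> K i \<subseteq> Field P"
    and \<rho>: "\<And>i. i \<in> Field lam \<Longrightarrow> Card_order (\<rho> i) \<and> cinfinite (\<rho> i)"
    and le: "\<And>i j. (j, i) \<in> lam \<Longrightarrow> \<kappa> j \<le>o \<rho> i"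
    and big: "\<And>i. i \<in> Field lam \<Longrightarrow> \<not> chain_colourable (\<rho> i) P (K i)"
    and g: "g ` Field lam \<subseteq> Field lam" "inj_on g (Field lam)"
    and ord: "\<And>a b x y. (a, b) \<in> lam - Id \<Longrightarrow> x \<in> K (g a) \<Longrightarrow> y \<in> K (g b) \<Longrightarrow> (x, y) \<in> P - Id"
  shows "embeddable (Q1 lam \<kappa>) P \<or> embeddable (Q4 lam \<kappa>) P"
proof -
  have ex: "\<exists>v\<in>Field lam. (a, v) \<in> lam - Id \<and> (i, g v) \<in> lam" if i: "i \<in> Field lam" and a: "a \<in> Field lam" for i a
  proof (rule ccontr)
    assume no: "\<not> ?thesis"
    obtain b where b: "b \<in> Field lam" "(a, b) \<in> lam - Id" using lam(1,2) a by (rule ex_greater)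
    have above: "{v. (b, v) \<in> lam} \<subseteq> Field lam" by (auto intro: FieldI2)
    have "g v \<in> underS lam i" if "v \<in> {v. (b, v) \<in> lam}" for v
    proof -
      have v: "v \<in> Field lam" "(a, v) \<in> lam - Id" using above Card_order_less_trans(2)[OF lam(1) b(2)] that by blast+
      then have "(i, g v) \<notin> lam" using no by blast
      then show ?thesis
        using Card_order_cases[OF lam(1) i, of "g v"] g(1) v(1) unfolding underS_def by blast
    qed
    then have "g ` {v. (b, v) \<in> lam} \<subseteq> underS lam i" by blast
    then have "|{v. (b, v) \<in> lam}| \<le>o |underS lam i|"
      using inj_on_subset[OF g(2) above] unfolding card_of_ordLeq[symmetric] by blast
    then have "|{v. (b, v) \<in> lam}| <o lam" using card_of_underS[OF lam(1) i] by (rule ordLeq_ordLess_trans)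
    then show False using card_of_above[OF lam(1,2) b(1)] by blast
  qed
  obtain h where h: "\<forall>i\<in>Field lam. h i \<in> Field lam \<and> (i, g (h i)) \<in> lam"
    "\<forall>i j. (i, j) \<in> lam - Id \<longrightarrow> (h i, h j) \<in> lam - Id"
    using strictly_increasing_choice[OF lam, of "\<lambda>i v. (i, g v) \<in> lam"] ex by metis
  have gh: "g (h i) \<in> Field lam" if "i \<in> Field lam" for i using g(1) h(1) that by blast
  show ?thesis
  proof (rule embeddable_Q1_or_Q4[OF lam P fac fam, where D = "\<lambda>i. K (g (h i))" and \<rho> = "\<lambda>i. \<rho> (g (h i))"])
    show "\<kappa> j \<le>o \<rho> (g (h i))" if "(j, i) \<in> lam" for i j
    proof (rule le)
      have "(i, g (h i)) \<in> lam" using h(1) FieldI2[OF that] by blast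
      with that show "(j, g (h i)) \<in> lam" by (rule transD[OF Card_orderD(3)[OF lam(1)]])
    qed
    show "(x, y) \<in> P - Id" if "(i, j) \<in> lam - Id" "x \<in> K (g (h i))" "y \<in> K (g (h j))" for i j x y
      using ord[OF h(2)[rule_format, OF that(1)] that(2,3)] .
  qed (use K \<rho> big gh in simp_all)
qed

lemma embeddable_Q_if_linear_blocks:
  fixes \<nu> :: "'n rel" and lam :: "'l rel" and P :: "'p rel"
  assumes \<nu>: "Card_order \<nu>" "natLeq <o \<nu>" and lam: "Card_order lam" "lam =o cf \<nu>"
    and wc: "weakly_compact lam"
    and fam: "succ_family lam \<nu> \<kappa>" and P: "Partial_order P" and fac: "\<And>X. antichain P X \<Longrightarrow> finite X"
    and \<K>: "\<Union>\<K> \<subseteq> Field P" "linear_blocks P \<K>" "\<And>K. K \<in> \<K> \<Longrightarrow> small_cover \<nu> P K"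
      "\<not> small_cover \<nu> P (\<Union>\<K>)"
  shows "embeddable (Q1 lam \<kappa>) P \<or> embeddable (Q2 lam \<kappa>) P \<or> embeddable (Q3 lam \<kappa>) P \<or> embeddable (Q4 lam \<kappa>) P"
proof -
  have inf: "cinfinite \<nu>" using cinfinite_if_uncountable[OF \<nu>(2)] .
  have linf: "cinfinite lam" using cofinality_infinite[OF \<nu>(1) inf lam] .
  have reg: "regularCard lam" using cofinality_regularCard[OF \<nu>(1) inf lam] .
  have as: "antisym P" and tr: "trans P" using P by (rule antisym_Partial_order, rule trans_Partial_order)
  have new: "\<exists>K\<in>\<K>. K \<notin> S \<and> \<not> chain_colourable \<rho> P K"
    if S: "S \<subseteq> \<K>" "|S| <o lam" and \<rho>: "Card_order \<rho>" "\<rho> <o \<nu>" for S and \<rho> :: "'n rel"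
  proof (rule ccontr)
    assume no: "\<not> ?thesis"
    have smallS: "small_cover \<nu> P K" if "K \<in> S" for K using \<K>(3) S(1) that by blast
    obtain \<tau> :: "'n rel" where \<tau>: "Card_order \<tau>" "cinfinite \<tau>" "\<tau> <o \<nu>" "\<rho> \<le>o \<tau>" "\<forall>K\<in>S. chain_colourable \<tau> P K"
      by (rule small_cover_family_bound[OF \<nu> lam S(2) smallS \<rho>])
    have "chain_colourable \<tau> P (\<Union>\<K>)"
    proof (rule chain_colourable_lexicographic)
      show "chain_colourable \<tau> P K" if "K \<in> \<K>" for K
        using \<tau>(5) chain_colourable_ordLeq[OF _ \<tau>(4)] no that by blast
      fix K L x y assume "K \<in> \<K>" "L \<in> \<K>" "K \<noteq> L" "x \<in> K" "y \<in> L"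
      then show "(x, y) \<in> P \<or> (y, x) \<in> P" using linear_blocksD(2)[OF \<K>(2), of K L] by auto
    qed
    then show False using \<K>(4) \<tau>(1-3) unfolding small_cover_def by blast
  qed
  obtain \<rho> :: "'l \<Rightarrow> 'n rel" where \<rho>: "\<forall>i\<in>Field lam. Card_order (\<rho> i) \<and> cinfinite (\<rho> i) \<and> \<rho> i <o \<nu> \<and> (\<forall>j. (j, i) \<in> lam \<longrightarrow> \<kappa> j \<le>o \<rho> i)"
    by (rule ex_cumulative_bounds[OF \<nu> lam fam])
  have "\<exists>K. \<forall>i. i \<in> Field lam \<longrightarrow> K i \<in> \<K> \<and> K i \<notin> K ` underS lam i \<and> \<not> chain_colourable (\<rho> i) P (K i)"
  proof (rule dependent_wf_choice[OF Card_orderD(6)[OF lam(1)]])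
    fix i and K :: "'l \<Rightarrow> 'p set" assume IH: "\<And>j. (j, i) \<in> lam - Id \<Longrightarrow> j \<in> Field lam \<longrightarrow>
      K j \<in> \<K> \<and> K j \<notin> K ` underS lam j \<and> \<not> chain_colourable (\<rho> j) P (K j)"
    show "\<exists>L. i \<in> Field lam \<longrightarrow> L \<in> \<K> \<and> L \<notin> K ` underS lam i \<and> \<not> chain_colourable (\<rho> i) P L"
    proof (cases "i \<in> Field lam")
      case True
      have "K j \<in> \<K>" if "j \<in> underS lam i" for j using IH[of j] that unfolding underS_def by (auto intro: FieldI1)
      then have sub: "K ` underS lam i \<subseteq> \<K>" by blast
      have "|K ` underS lam i| <o lam"
        using card_of_image card_of_underS[OF lam(1) True] by (rule ordLeq_ordLess_trans)
      from new[OF sub this, of "\<rho> i"] show ?thesis using \<rho> True by blast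
    qed simp
  next
    fix f g :: "'l \<Rightarrow> 'p set" and i L assume eq: "\<And>j. (j, i) \<in> lam - Id \<Longrightarrow> f j = g j"
    have "f ` underS lam i = g ` underS lam i" by (rule image_cong) (use eq in \<open>auto simp: underS_def\<close>)
    then show "(i \<in> Field lam \<longrightarrow> L \<in> \<K> \<and> L \<notin> f ` underS lam i \<and> \<not> chain_colourable (\<rho> i) P L) =
      (i \<in> Field lam \<longrightarrow> L \<in> \<K> \<and> L \<notin> g ` underS lam i \<and> \<not> chain_colourable (\<rho> i) P L)" by simp
  qed
  then obtain K where K: "\<forall>i\<in>Field lam. K i \<in> \<K> \<and> K i \<notin> K ` underS lam i \<and> \<not> chain_colourable (\<rho> i) P (K i)" by blast
  have Kneq: "K i \<noteq> K j" if "(i, j) \<in> lam - Id" for i j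
  proof -
    have "j \<in> Field lam" "i \<in> underS lam j" using that unfolding underS_def by (auto intro: FieldI2)
    then show ?thesis using K by blast
  qed
  have KK: "K i \<in> \<K>" if "i \<in> Field lam" for i using K that by blast
  have KP: "K i \<subseteq> Field P" if "i \<in> Field lam" for i using KK[OF that] \<K>(1) by blast
  have \<rho>i: "Card_order (\<rho> i) \<and> cinfinite (\<rho> i)" and Kbig: "\<not> chain_colourable (\<rho> i) P (K i)"
    if "i \<in> Field lam" for i using \<rho> K that by blast+
  have \<rho>le: "\<kappa> j \<le>o \<rho> i" if "(j, i) \<in> lam" for i j using \<rho> FieldI2[OF that] that by blast
  have Kinj: "K i \<noteq> K j" if "i \<in> Field lam" "j \<in> Field lam" "i \<noteq> j" for i j
    using Card_order_cases[OF lam(1) that(1,2)] Kneq[of i j] Kneq[of j i] that(3) by auto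
  have Kne: "K i \<noteq> {}" if "i \<in> Field lam" for i using \<K>(2) KK[OF that] unfolding linear_blocks_def by simp
  have Kdisj: "K i \<inter> K j = {}" and Kcmp: "K i \<times> K j \<subseteq> P \<or> K j \<times> K i \<subseteq> P"
    if "i \<in> Field lam" "j \<in> Field lam" "i \<noteq> j" for i j
    using linear_blocksD[OF \<K>(2) KK[OF that(1)] KK[OF that(2)] Kinj[OF that]] .
  define C where "C = {(i, j). i \<in> Field lam \<and> j \<in> Field lam \<and> (i = j \<or> K i \<times> K j \<subseteq> P)}"
  have FC: "Field C = Field lam" unfolding C_def Field_def by auto
  have "Linear_order C"
    unfolding linear_order_on_def partial_order_on_def preorder_on_def
  proof (intro conjI)
    show "C \<subseteq> Field C \<times> Field C" by (auto intro: FieldI1 FieldI2)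
    show "Refl C" unfolding refl_on_def FC unfolding C_def by blast
    show "Total C" using Kcmp unfolding total_on_def FC unfolding C_def by simp
    show "antisym C"
    proof (rule antisymI, rule ccontr)
      fix i j assume ij: "(i, j) \<in> C" "(j, i) \<in> C" "i \<noteq> j"
      then have F: "i \<in> Field lam" "j \<in> Field lam" unfolding C_def by blast+
      obtain x y where xy: "x \<in> K i" "y \<in> K j" using Kne F by blast
      then have "(x, y) \<in> P" "(y, x) \<in> P" using ij unfolding C_def by blast+
      then have "x = y" by (rule antisymD[OF as])
      then show False using xy Kdisj[OF F ij(3)] by blast
    qed
    show "trans C"
    proof (rule transI)
      fix i j k assume ij: "(i, j) \<in> C" and jk: "(j, k) \<in> C"
      show "(i, k) \<in> C"
      proof (cases "i = j \<or> j = k")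
        case True
        then show ?thesis using ij jk by blast
      next
        case False
        then have F: "i \<in> Field lam" "j \<in> Field lam" "k \<in> Field lam" "K i \<times> K j \<subseteq> P" "K j \<times> K k \<subseteq> P"
          using ij jk unfolding C_def by blast+
        obtain y where y: "y \<in> K j" using Kne F(2) by blast
        have "(x, z) \<in> P" if "x \<in> K i" "z \<in> K k" for x z
          using transD[OF tr, of x y z] F(4,5) y that by blast
        then show ?thesis using F(1,3) unfolding C_def by blast
      qed
    qed
  qed
  moreover have "|Field C| =o lam" unfolding FC using lam(1) by (rule card_of_Field_ordIso)
  ultimately have "embeddable lam C \<or> embeddable (lam\<inverse>) C" using wc unfolding weakly_compact_def by blast
  then show ?thesis
  proof
    assume "embeddable lam C"
    then obtain g where g: "g ` Field lam \<subseteq> Field lam" "inj_on g (Field lam)"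
      "\<forall>a\<in>Field lam. \<forall>b\<in>Field lam. (a, b) \<in> lam \<longleftrightarrow> (g a, g b) \<in> C"
      unfolding embeddable_iff FC by blast
    have "embeddable (Q1 lam \<kappa>) P \<or> embeddable (Q4 lam \<kappa>) P"
    proof (rule embeddable_Q_if_increasing_blocks[OF lam(1) linf reg P fac fam _ _ _ _ g(1,2)])
      fix a b x y assume ab: "(a, b) \<in> lam - Id" and x: "x \<in> K (g a)" and y: "y \<in> K (g b)"
      have F: "a \<in> Field lam" "b \<in> Field lam" using ab by (auto intro: FieldI1 FieldI2)
      then have gF: "g a \<in> Field lam" "g b \<in> Field lam" "g a \<noteq> g b"
        using g(1) inj_on_eq_iff[OF g(2)] ab by blast+
      have "(g a, g b) \<in> C" using g(3) F ab by blast
      then have "K (g a) \<times> K (g b) \<subseteq> P" using gF(3) unfolding C_def by simp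
      then have "(x, y) \<in> P" using x y by blast
      then show "(x, y) \<in> P - Id" using Kdisj[OF gF] x y by blast
    qed (use KP \<rho>i \<rho>le Kbig in simp_all)
    then show ?thesis by blast
  next
    assume "embeddable (lam\<inverse>) C"
    then obtain g where g: "g ` Field lam \<subseteq> Field lam" "inj_on g (Field lam)"
      "\<forall>a\<in>Field lam. \<forall>b\<in>Field lam. (a, b) \<in> lam\<inverse> \<longleftrightarrow> (g a, g b) \<in> C"
      unfolding embeddable_iff FC Field_converse by blast
    have P': "Partial_order (P\<inverse>)" using P by simp
    have fac': "finite X" if "antichain (P\<inverse>) X" for X
      using fac that unfolding antichain_converse .
    have "embeddable (Q1 lam \<kappa>) (P\<inverse>) \<or> embeddable (Q4 lam \<kappa>) (P\<inverse>)"
    proof (rule embeddable_Q_if_increasing_blocks[OF lam(1) linf reg P' fac' fam _ _ _ _ g(1,2)])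
      fix a b x y assume ab: "(a, b) \<in> lam - Id" and x: "x \<in> K (g a)" and y: "y \<in> K (g b)"
      have F: "a \<in> Field lam" "b \<in> Field lam" using ab by (auto intro: FieldI1 FieldI2)
      then have gF: "g a \<in> Field lam" "g b \<in> Field lam" "g a \<noteq> g b"
        using g(1) inj_on_eq_iff[OF g(2)] ab by blast+
      have "(g b, g a) \<in> C" using g(3) F ab by blast
      then have "K (g b) \<times> K (g a) \<subseteq> P" using gF(3) unfolding C_def by simp
      then have "(y, x) \<in> P" using x y by blast
      then show "(x, y) \<in> P\<inverse> - Id" using Kdisj[OF gF] x y by blast
    qed (use KP \<rho>i \<rho>le Kbig in \<open>simp_all add: chain_colourable_converse\<close>)
    then show ?thesis using embeddable_Q3_or_Q2_if_converse by blast
  qed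
qed

lemma embeddable_Q_if_ordLeq_Cov:
  fixes \<nu> :: "'n rel" and lam :: "'l rel" and P :: "'p rel"
  assumes lim: "limit_cardinal \<nu>" "natLeq <o \<nu>" and lam: "Card_order lam" "lam =o cf \<nu>"
    and wc: "weakly_compact lam"
    and fam: "succ_family lam \<nu> \<kappa>" and P: "Partial_order P" and fac: "\<And>X. antichain P X \<Longrightarrow> finite X"
    and Cov: "\<nu> \<le>o Cov P"
  shows "embeddable (Q1 lam \<kappa>) P \<or> embeddable (Q2 lam \<kappa>) P \<or> embeddable (Q3 lam \<kappa>) P \<or> embeddable (Q4 lam \<kappa>) P"
proof -
  have \<nu>: "Card_order \<nu>" "natLeq <o \<nu>" using lim unfolding limit_cardinal_def by blast+
  have pos: "\<not> small_cover \<nu> P (Field P)"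
  proof
    assume "small_cover \<nu> P (Field P)"
    then obtain \<rho> :: "'n rel" where \<rho>: "Card_order \<rho>" "\<rho> <o \<nu>" "chain_colourable \<rho> P (Field P)"
      unfolding small_cover_def by blast
    then have "Cov P \<le>o \<rho>" using Cov_ordLeq_iff[OF P] by blast
    then show False using Cov \<rho>(2) ordLeq_transitive not_ordLess_ordLeq by blast
  qed
  have sing: "small_cover \<nu> P {x}" if "x \<in> Field P" for x
    using Refl_Partial_order[OF P] that unfolding refl_on_def by (intro small_cover_singleton[OF \<nu> lam]) blast
  have facP: "finite X" if "antichain P X" "X \<subseteq> Field P" for X using fac that(1) .
  show ?thesis
  proof (rule up_type_or_linear_blocks[OF P subset_refl facP small_cover_subset small_cover_Un[OF \<nu> lam] sing pos])
    fix B assume "B \<subseteq> Field P" "up_type (small_cover \<nu> P) P B"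
    then show ?thesis using embeddable_Q_if_up_type[OF lim lam fam P fac] by blast
  next
    fix B assume B: "B \<subseteq> Field P" "up_type (small_cover \<nu> P) (P\<inverse>) B"
    have P': "Partial_order (P\<inverse>)" using P by simp
    have fac': "finite X" if "antichain (P\<inverse>) X" for X
      using fac that unfolding antichain_converse .
    have "embeddable (Q1 lam \<kappa>) (P\<inverse>) \<or> embeddable (Q4 lam \<kappa>) (P\<inverse>)"
      by (rule embeddable_Q_if_up_type[OF lim lam fam P' fac']) (use B in \<open>simp_all add: small_cover_converse\<close>)
    then show ?thesis using embeddable_Q3_or_Q2_if_converse by blast
  next
    fix \<K> assume \<K>: "\<Union>\<K> \<subseteq> Field P" "linear_blocks P \<K>" "\<And>K. K \<in> \<K> \<Longrightarrow> small_cover \<nu> P K" "\<not> small_cover \<nu> P (\<Union>\<K>)"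
    show ?thesis
      by (rule embeddable_Q_if_linear_blocks[OF \<nu> lam wc fam P _ \<K>(1,2) _ \<K>(4)]) (use fac \<K>(3) in blast)+
  qed
qed

section \<open>The four posets are pairwise not equimorphic\<close>

lemma wf_minimal: "wf r \<Longrightarrow> x \<in> S \<Longrightarrow> \<exists>z\<in>S. \<forall>y. (y, z) \<in> r \<longrightarrow> y \<notin> S"
  unfolding wf_eq_minimal by blast

lemma wf_lex_sum:
  assumes C: "wf (C - Id)" and Q: "\<And>\<alpha>. \<alpha> \<in> Field C \<Longrightarrow> wf (Q \<alpha> - Id)"
  shows "wf (lex_sum C Q - Id)"
  unfolding wf_eq_minimal
proof (intro allI impI)
  fix S :: "('a \<times> 'b) set" and p assume "p \<in> S"
  then have "fst p \<in> fst ` S" by blast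
  from wf_minimal[OF C this] obtain \<alpha> where
    \<alpha>: "\<alpha> \<in> fst ` S" "\<forall>\<beta>. (\<beta>, \<alpha>) \<in> C - Id \<longrightarrow> \<beta> \<notin> fst ` S" by blast
  show "\<exists>z\<in>S. \<forall>y. (y, z) \<in> lex_sum C Q - Id \<longrightarrow> y \<notin> S"
  proof (cases "\<alpha> \<in> Field C")
    case False
    obtain z where "z \<in> S" "fst z = \<alpha>" using \<alpha>(1) by blast
    then show ?thesis using False unfolding lex_sum_def by (intro bexI[of _ z]) auto
  next
    case True
    obtain x where "x \<in> {x. (\<alpha>, x) \<in> S}" using \<alpha>(1) by force
    from wf_minimal[OF Q[OF True] this] obtain y where
      y: "(\<alpha>, y) \<in> S" "\<forall>z. (z, y) \<in> Q \<alpha> - Id \<longrightarrow> (\<alpha>, z) \<notin> S" by blast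
    have "q \<notin> S" if "(q, (\<alpha>, y)) \<in> lex_sum C Q - Id" for q
    proof (cases "fst q = \<alpha>")
      case True
      then have "(snd q, y) \<in> Q \<alpha> - Id" using that unfolding lex_sum_def by auto
      then show ?thesis using y(2) True by (metis prod.collapse)
    next
      case False
      then have "(fst q, \<alpha>) \<in> C - Id" using that unfolding lex_sum_def by auto
      then show ?thesis using \<alpha>(2) by blast
    qed
    then show ?thesis using y(1) by blast
  qed
qed

lemma wf_incr_pairs:
  assumes "wf (r - Id)"
  shows "wf (incr_pairs r - Id)"
proof (rule wf_subset)
  show "wf ((r - Id) <*lex*> (r - Id))" using assms by (intro wf_lex_prod)
  show "incr_pairs r - Id \<subseteq> (r - Id) <*lex*> (r - Id)" unfolding incr_pairs_def by auto
qed

lemma wf_if_embeddable: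
  assumes "embeddable R P" "wf (P - Id)"
  shows "wf (R - Id)"
proof -
  obtain f where f: "inj_on f (Field R)" "\<forall>x\<in>Field R. \<forall>y\<in>Field R. (x, y) \<in> R \<longleftrightarrow> (f x, f y) \<in> P"
    using assms(1) unfolding embeddable_iff by blast
  have "R - Id \<subseteq> inv_image (P - Id) f"
  proof
    fix p assume p: "p \<in> R - Id"
    obtain x y where xy: "p = (x, y)" by (cases p)
    have F: "x \<in> Field R" "y \<in> Field R" using p xy by (auto intro: FieldI1 FieldI2)
    then show "p \<in> inv_image (P - Id) f" using p f(2) inj_on_eq_iff[OF f(1) F] unfolding xy by auto
  qed
  then show ?thesis using wf_inv_image[OF assms(2)] by (rule wf_subset[rotated])
qed

lemma not_wf_converse_block:
  assumes "Card_order r" "cinfinite r"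
  shows "\<not> wf ((incr_pairs r)\<inverse> - Id)"
proof
  assume wf: "wf ((incr_pairs r)\<inverse> - Id)"
  obtain a where a: "a \<in> Field r" using cinfinite_nonempty[OF assms(2)] by blast
  obtain b where "b \<in> Field r" "(a, b) \<in> r - Id" using assms a by (rule ex_greater)
  then have "(a, b) \<in> Pair a ` {b. (a, b) \<in> r - Id}" by blast
  from wf_minimal[OF wf this] obtain z where z: "z \<in> Pair a ` {b. (a, b) \<in> r - Id}"
    "\<forall>y. (y, z) \<in> (incr_pairs r)\<inverse> - Id \<longrightarrow> y \<notin> Pair a ` {b. (a, b) \<in> r - Id}" by blast
  then obtain c where c: "(a, c) \<in> r - Id" "z = (a, c)" by blast
  have "c \<in> Field r" using c(1) by (auto intro: FieldI2)
  with assms obtain d where d: "(c, d) \<in> r - Id" by (rule ex_greater)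
  have ad: "(a, d) \<in> r - Id" using Card_order_less_trans(1)[OF assms(1), of a c d] c(1) d by blast
  have "(a, a) \<in> r" using Card_orderD(2)[OF assms(1)] a unfolding refl_on_def by blast
  then have "((a, d), z) \<in> (incr_pairs r)\<inverse> - Id" using ad c d unfolding incr_pairs_def by auto
  then show False using z(2) ad by blast
qed

context
  fixes lam :: "'l rel" and \<nu> :: "'n rel" and \<kappa> :: "'l \<Rightarrow> 'k rel"
  assumes lim: "limit_cardinal \<nu>" "natLeq <o \<nu>" and lam: "Card_order lam" "lam =o cf \<nu>"
    and fam: "succ_family lam \<nu> \<kappa>"
begin

lemma Card_order_\<nu>: "Card_order \<nu>" "natLeq <o \<nu>" and cinfinite_lam: "cinfinite lam"
proof -
  show 1: "Card_order \<nu>" "natLeq <o \<nu>" using lim unfolding limit_cardinal_def by blast+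
  have "cinfinite \<nu>" using cinfinite_mono[OF ordLess_imp_ordLeq[OF 1(2)] natLeq_cinfinite] .
  then show "cinfinite lam" by (rule cofinality_infinite[OF 1(1) _ lam])
qed

lemma block_cardinal:
  assumes "\<alpha> \<in> Field lam"
  shows "Card_order (cardSuc (\<kappa> \<alpha>))" "cinfinite (cardSuc (\<kappa> \<alpha>))" "regularCard (cardSuc (\<kappa> \<alpha>))"
  using Cinfinite_cardSucI succ_familyD(1,2)[OF fam assms] by blast+

lemma Field_block: "\<alpha> \<in> Field lam \<Longrightarrow> Field (incr_pairs (cardSuc (\<kappa> \<alpha>))) = cardSuc (\<kappa> \<alpha>) - Id"
  by (intro Field_incr_pairs Card_orderD block_cardinal)

lemma Q_rel:
  assumes "\<alpha> \<in> Field lam" "\<beta> \<in> Field lam" "p \<in> cardSuc (\<kappa> \<alpha>) - Id" "q \<in> cardSuc (\<kappa> \<beta>) - Id"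
  shows "((\<alpha>, p), (\<beta>, q)) \<in> Q2 lam \<kappa> \<longleftrightarrow> (\<beta>, \<alpha>) \<in> lam - Id \<or> \<alpha> = \<beta> \<and> (p, q) \<in> incr_pairs (cardSuc (\<kappa> \<alpha>))"
    and "((\<alpha>, p), (\<beta>, q)) \<in> Q4 lam \<kappa> \<longleftrightarrow> (\<alpha>, \<beta>) \<in> lam - Id \<or> \<alpha> = \<beta> \<and> (q, p) \<in> incr_pairs (cardSuc (\<kappa> \<alpha>))"
  using assms Field_block unfolding Q2_def Q4_eq lex_sum_def by auto

lemma Field_Q:
  "Field (Q2 lam \<kappa>) = (SIGMA \<alpha>:Field lam. cardSuc (\<kappa> \<alpha>) - Id)"
  "Field (Q4 lam \<kappa>) = (SIGMA \<alpha>:Field lam. cardSuc (\<kappa> \<alpha>) - Id)"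
proof -
  have "Refl (incr_pairs (cardSuc (\<kappa> \<alpha>)))" if "\<alpha> \<in> Field lam" for \<alpha>
    by (intro Refl_Partial_order Partial_order_incr_pairs Partial_order_Card_order block_cardinal that)
  then show "Field (Q2 lam \<kappa>) = (SIGMA \<alpha>:Field lam. cardSuc (\<kappa> \<alpha>) - Id)"
    unfolding Q2_def using Field_block by (subst Field_lex_sum) auto
  then show "Field (Q4 lam \<kappa>) = (SIGMA \<alpha>:Field lam. cardSuc (\<kappa> \<alpha>) - Id)"
    unfolding Q4_def by simp
qed

lemma ex_block_element: "\<alpha> \<in> Field lam \<Longrightarrow> \<exists>p. p \<in> cardSuc (\<kappa> \<alpha>) - Id"
proof -
  assume \<alpha>: "\<alpha> \<in> Field lam"
  then obtain a where "a \<in> Field (cardSuc (\<kappa> \<alpha>))"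
    using cinfinite_nonempty[OF block_cardinal(2)[OF \<alpha>]] by blast
  from ex_greater[OF block_cardinal(1,2)[OF \<alpha>] this] show ?thesis by metis
qed

lemma wf_Q1: "wf (Q1 lam \<kappa> - Id)"
  unfolding Q1_def by (intro wf_lex_sum wf_incr_pairs Card_orderD lam block_cardinal)

lemma not_wf_Q2: "\<not> wf (Q2 lam \<kappa> - Id)"
proof
  assume wf: "wf (Q2 lam \<kappa> - Id)"
  obtain p where p: "\<And>\<alpha>. \<alpha> \<in> Field lam \<Longrightarrow> p \<alpha> \<in> cardSuc (\<kappa> \<alpha>) - Id" using ex_block_element by metis
  obtain \<alpha>0 where "\<alpha>0 \<in> Field lam" using cinfinite_nonempty[OF cinfinite_lam] by blast
  then have "(\<alpha>0, p \<alpha>0) \<in> (\<lambda>\<alpha>. (\<alpha>, p \<alpha>)) ` Field lam" by blast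
  from wf_minimal[OF wf this] obtain z where z: "z \<in> (\<lambda>\<alpha>. (\<alpha>, p \<alpha>)) ` Field lam"
    "\<forall>y. (y, z) \<in> Q2 lam \<kappa> - Id \<longrightarrow> y \<notin> (\<lambda>\<alpha>. (\<alpha>, p \<alpha>)) ` Field lam" by blast
  then obtain \<alpha> where \<alpha>: "\<alpha> \<in> Field lam" "z = (\<alpha>, p \<alpha>)" by blast
  obtain \<beta> where \<beta>: "\<beta> \<in> Field lam" "(\<alpha>, \<beta>) \<in> lam - Id" using lam(1) cinfinite_lam \<alpha>(1) by (rule ex_greater)
  have "((\<beta>, p \<beta>), z) \<in> Q2 lam \<kappa> - Id"
    using Q_rel(1)[OF \<beta>(1) \<alpha>(1) p[OF \<beta>(1)] p[OF \<alpha>(1)]] \<beta>(2) unfolding \<alpha>(2) by auto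
  then show False using z(2) \<beta>(1) by blast
qed

lemma not_wf_Q3: "\<not> wf (Q3 lam \<kappa> - Id)" and not_wf_Q4: "\<not> wf (Q4 lam \<kappa> - Id)"
proof -
  obtain \<alpha> where \<alpha>: "\<alpha> \<in> Field lam" using cinfinite_nonempty[OF cinfinite_lam] by blast
  define N where "N = (\<lambda>\<alpha>. (incr_pairs (cardSuc (\<kappa> \<alpha>)))\<inverse>)"
  have po: "Partial_order (N \<alpha>)" if "\<alpha> \<in> Field lam" for \<alpha>
    using Partial_order_incr_pairs[OF Partial_order_Card_order[OF block_cardinal(1)[OF that]]] unfolding N_def by simp
  have nwf: "\<not> wf (N \<alpha> - Id)" unfolding N_def using not_wf_converse_block[OF block_cardinal(1,2)[OF \<alpha>]] .
  have "Q3 lam \<kappa> = lex_sum (lam\<inverse>) N" unfolding Q3_def Q1_def converse_lex_sum N_def ..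
  then have "embeds_into (N \<alpha>) (Q3 lam \<kappa>) (Field (Q3 lam \<kappa>))"
    using embeds_into_block[of \<alpha> "lam\<inverse>" N] \<alpha> Refl_Partial_order[OF po] by simp
  then have "embeddable (N \<alpha>) (Q3 lam \<kappa>)"
    by (rule embeddable_if_embeds_into[OF po[OF \<alpha>] Partial_order_Q(3)[OF lam(1) fam]])
  then show "\<not> wf (Q3 lam \<kappa> - Id)" using wf_if_embeddable nwf by blast
  have "Q4 lam \<kappa> = lex_sum lam N" unfolding Q4_eq N_def ..
  then have "embeds_into (N \<alpha>) (Q4 lam \<kappa>) (Field (Q4 lam \<kappa>))"
    using embeds_into_block[of \<alpha> lam N] \<alpha> Refl_Partial_order[OF po] by simp
  then have "embeddable (N \<alpha>) (Q4 lam \<kappa>)"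
    by (rule embeddable_if_embeds_into[OF po[OF \<alpha>] Partial_order_Q(4)[OF lam(1) fam]])
  then show "\<not> wf (Q4 lam \<kappa> - Id)" using wf_if_embeddable nwf by blast
qed

lemma Q2_not_embeddable_Q4: "\<not> embeddable (Q2 lam \<kappa>) (Q4 lam \<kappa>)"
proof
  assume "embeddable (Q2 lam \<kappa>) (Q4 lam \<kappa>)"
  then obtain f where f: "f ` Field (Q2 lam \<kappa>) \<subseteq> Field (Q4 lam \<kappa>)" "inj_on f (Field (Q2 lam \<kappa>))"
    "\<forall>x\<in>Field (Q2 lam \<kappa>). \<forall>y\<in>Field (Q2 lam \<kappa>). (x, y) \<in> Q2 lam \<kappa> \<longleftrightarrow> (f x, f y) \<in> Q4 lam \<kappa>"
    unfolding embeddable_iff by blast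
  have f4: "fst (f x) \<in> Field lam" "snd (f x) \<in> cardSuc (\<kappa> (fst (f x))) - Id" if "x \<in> Field (Q2 lam \<kappa>)" for x
  proof -
    have "f x \<in> (SIGMA \<alpha>:Field lam. cardSuc (\<kappa> \<alpha>) - Id)" using f(1) that unfolding Field_Q(2) by blast
    then show "fst (f x) \<in> Field lam" "snd (f x) \<in> cardSuc (\<kappa> (fst (f x))) - Id" by (cases "f x"; simp)+
  qed
  have le4: "(fst (f x), fst (f y)) \<in> lam - Id \<or>
      fst (f x) = fst (f y) \<and> (snd (f y), snd (f x)) \<in> incr_pairs (cardSuc (\<kappa> (fst (f x)))) - Id"
    if x: "x \<in> Field (Q2 lam \<kappa>)" and y: "y \<in> Field (Q2 lam \<kappa>)" and xy: "(x, y) \<in> Q2 lam \<kappa>" "x \<noteq> y" for x y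
  proof -
    have "f x \<noteq> f y" using inj_on_eq_iff[OF f(2) x y] xy(2) by blast
    moreover have "((fst (f x), snd (f x)), (fst (f y), snd (f y))) \<in> Q4 lam \<kappa>" using f(3) x y xy(1) by simp
    ultimately show ?thesis unfolding Q_rel(2)[OF f4(1)[OF x] f4(1)[OF y] f4(2)[OF x] f4(2)[OF y]]
      by (auto simp: prod_eq_iff)
  qed
  show False
  proof (cases "\<exists>\<alpha>\<in>Field lam. lam <o cardSuc (\<kappa> \<alpha>)")
    case True
    then obtain \<alpha> where \<alpha>: "\<alpha> \<in> Field lam" "lam <o cardSuc (\<kappa> \<alpha>)" by blast
    define r where "r = cardSuc (\<kappa> \<alpha>)"
    have r: "Card_order r" "cinfinite r" "regularCard r" unfolding r_def using block_cardinal[OF \<alpha>(1)] .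
    obtain a where a: "a \<in> Field r" using cinfinite_nonempty[OF r(2)] by blast
    define h where "h b = f (\<alpha>, (a, b))" for b
    have F2: "(\<alpha>, (a, b)) \<in> Field (Q2 lam \<kappa>)" if "(a, b) \<in> r - Id" for b
      using that \<alpha>(1) unfolding Field_Q r_def by blast
    have "\<exists>i\<in>Field lam. \<forall>b\<in>Field r. \<exists>c. (a, c) \<in> r - Id \<and> fst (h c) = i \<and> (b, c) \<in> r - Id"
    proof (rule ccontr)
      assume no: "\<not> ?thesis"
      have "\<forall>i. \<exists>b. i \<in> Field lam \<longrightarrow> b \<in> Field r \<and> (\<forall>c. (a, c) \<in> r - Id \<longrightarrow> fst (h c) = i \<longrightarrow> (b, c) \<notin> r - Id)"
      proof (intro allI, rule ccontr)
        fix i assume i: "\<not> (\<exists>b. i \<in> Field lam \<longrightarrow> b \<in> Field r \<and> (\<forall>c. (a, c) \<in> r - Id \<longrightarrow> fst (h c) = i \<longrightarrow> (b, c) \<notin> r - Id))"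
        then have "i \<in> Field lam" "\<forall>b\<in>Field r. \<exists>c. (a, c) \<in> r - Id \<and> fst (h c) = i \<and> (b, c) \<in> r - Id" by auto
        then show False using no by (elim notE) (rule bexI)
      qed
      then obtain b where b: "\<And>i. i \<in> Field lam \<Longrightarrow> b i \<in> Field r"
        "\<And>i c. i \<in> Field lam \<Longrightarrow> (a, c) \<in> r - Id \<Longrightarrow> fst (h c) = i \<Longrightarrow> (b i, c) \<notin> r - Id" by metis
      have "|insert a (b ` Field lam)| \<le>o lam"
        using Un_Cinfinite_bound[of "{a}" lam "b ` Field lam"] lam(1) cinfinite_lam card_of_ordLeq_if_finite[OF lam(1) cinfinite_lam, of "{a}"]
          card_of_image_ordLeq[OF ordIso_imp_ordLeq[OF card_of_Field_ordIso[OF lam(1)]], of b] by simp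
      then have "|insert a (b ` Field lam)| <o r" using \<alpha>(2) unfolding r_def by (rule ordLeq_ordLess_trans)
      from regularCard_strict_bound[OF r _ this] obtain c where
        c: "c \<in> Field r" "\<forall>s\<in>insert a (b ` Field lam). (s, c) \<in> r - Id"
        using a b(1) by (auto simp: image_subset_iff)
      then have "fst (h c) \<in> Field lam" using f4(1)[OF F2, of c] unfolding h_def by simp
      then show False using b(2)[of "fst (h c)" c] c(2) by simp
    qed
    then obtain i where i: "i \<in> Field lam" "\<forall>b\<in>Field r. \<exists>c. (a, c) \<in> r - Id \<and> fst (h c) = i \<and> (b, c) \<in> r - Id" by blast
    define S where "S = {c. (a, c) \<in> r - Id \<and> fst (h c) = i}"
    have wf: "wf (incr_pairs (cardSuc (\<kappa> i)) - Id)" by (intro wf_incr_pairs Card_orderD block_cardinal i)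
    obtain c0 where "c0 \<in> S" using i(2) a unfolding S_def by blast
    then have "snd (h c0) \<in> (\<lambda>c. snd (h c)) ` S" by blast
    from wf_minimal[OF wf this] obtain z where z: "z \<in> (\<lambda>c. snd (h c)) ` S"
      "\<forall>y. (y, z) \<in> incr_pairs (cardSuc (\<kappa> i)) - Id \<longrightarrow> y \<notin> (\<lambda>c. snd (h c)) ` S" by blast
    then obtain c where c: "c \<in> S" "z = snd (h c)" by blast
    have ac: "(a, c) \<in> r - Id" using c(1) unfolding S_def by blast
    then have "c \<in> Field r" by (auto intro: FieldI2)
    then obtain d where d: "(a, d) \<in> r - Id" "fst (h d) = i" "(c, d) \<in> r - Id" using i(2) by blast
    have "(a, a) \<in> r" using Card_orderD(2)[OF r(1)] a unfolding refl_on_def by blast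
    then have "((a, c), (a, d)) \<in> incr_pairs r" using ac d unfolding incr_pairs_def by blast
    then have "((\<alpha>, (a, c)), (\<alpha>, (a, d))) \<in> Q2 lam \<kappa>"
      using Q_rel(1)[OF \<alpha>(1) \<alpha>(1)] ac d unfolding r_def by blast
    from le4[OF F2[OF ac] F2[OF d(1)] this]
    have "(snd (h d), snd (h c)) \<in> incr_pairs (cardSuc (\<kappa> i)) - Id"
      using d c(1) unfolding h_def[symmetric] S_def by auto
    then show False using z(2) c(2) d unfolding S_def by blast
  next
    case False
    have small: "cardSuc (\<kappa> m) <o lam" if m: "m \<in> Field lam" for m
    proof -
      have "cardSuc (cardSuc (\<kappa> m)) <o \<nu>"
        using lim(1) block_cardinal(1)[OF m] succ_familyD(4)[OF fam m] by (rule cardSuc_ordLess_limit_cardinal)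
      then obtain \<beta> where \<beta>: "\<beta> \<in> Field lam" "cardSuc (cardSuc (\<kappa> m)) \<le>o cardSuc (\<kappa> \<beta>)"
        using succ_family_unbounded[OF Card_order_\<nu> lam fam cardSuc_Card_order[OF block_cardinal(1)[OF m]] _ m] by blast
      have "cardSuc (\<kappa> m) <o cardSuc (cardSuc (\<kappa> m))" using block_cardinal(1)[OF m] by (rule cardSuc_greater)
      also note \<beta>(2)
      also have "cardSuc (\<kappa> \<beta>) \<le>o lam"
        using False \<beta>(1) Card_order_ordLess_or_ordLeq[OF lam(1) block_cardinal(1)[OF \<beta>(1)]] by blast
      finally show ?thesis .
    qed
    obtain p where p: "\<And>\<alpha>. \<alpha> \<in> Field lam \<Longrightarrow> p \<alpha> \<in> cardSuc (\<kappa> \<alpha>) - Id" using ex_block_element by metis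
    define h where "h \<alpha> = f (\<alpha>, p \<alpha>)" for \<alpha>
    have F2: "(\<alpha>, p \<alpha>) \<in> Field (Q2 lam \<kappa>)" if "\<alpha> \<in> Field lam" for \<alpha>
      using p[OF that] that unfolding Field_Q by blast
    have dec: "(fst (h \<beta>), fst (h \<alpha>)) \<in> lam - Id \<or> fst (h \<beta>) = fst (h \<alpha>)"
      if "(\<alpha>, \<beta>) \<in> lam - Id" for \<alpha> \<beta>
    proof -
      have F: "\<alpha> \<in> Field lam" "\<beta> \<in> Field lam" using that by (auto intro: FieldI1 FieldI2)
      have "((\<beta>, p \<beta>), (\<alpha>, p \<alpha>)) \<in> Q2 lam \<kappa>"
        using Q_rel(1)[OF F(2,1) p[OF F(2)] p[OF F(1)]] that by blast
      moreover have "(\<beta>, p \<beta>) \<noteq> (\<alpha>, p \<alpha>)" using that by auto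
      ultimately show ?thesis using le4[OF F2[OF F(2)] F2[OF F(1)]] unfolding h_def by blast
    qed
    obtain \<alpha>0 where "\<alpha>0 \<in> Field lam" using cinfinite_nonempty[OF cinfinite_lam] by blast
    then have "fst (h \<alpha>0) \<in> (\<lambda>\<alpha>. fst (h \<alpha>)) ` Field lam" by blast
    from wf_minimal[OF Card_orderD(6)[OF lam(1)] this] obtain m where m: "m \<in> (\<lambda>\<alpha>. fst (h \<alpha>)) ` Field lam"
      "\<forall>y. (y, m) \<in> lam - Id \<longrightarrow> y \<notin> (\<lambda>\<alpha>. fst (h \<alpha>)) ` Field lam" by blast
    then obtain \<alpha> where \<alpha>: "\<alpha> \<in> Field lam" "fst (h \<alpha>) = m" by blast
    define S where "S = {\<beta>. (\<alpha>, \<beta>) \<in> lam}"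
    have SF: "S \<subseteq> Field lam" unfolding S_def by (auto intro: FieldI2)
    have Sm: "fst (h \<beta>) = m" if "\<beta> \<in> S" for \<beta>
      using dec[of \<alpha> \<beta>] m(2)[rule_format, of "fst (h \<beta>)"] \<alpha> SF that unfolding S_def by blast
    have mF: "m \<in> Field lam" using f4(1)[OF F2[OF \<alpha>(1)]] \<alpha>(2) unfolding h_def by simp
    define s where "s = cardSuc (\<kappa> m)"
    have s: "Card_order s" "cinfinite s" unfolding s_def using block_cardinal[OF mF] by blast+
    have "inj_on (\<lambda>\<beta>. snd (h \<beta>)) S"
    proof (rule inj_onI)
      fix \<beta> \<gamma> assume bc: "\<beta> \<in> S" "\<gamma> \<in> S" "snd (h \<beta>) = snd (h \<gamma>)"
      then have "h \<beta> = h \<gamma>" using Sm by (simp add: prod_eq_iff)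
      then have "(\<beta>, p \<beta>) = (\<gamma>, p \<gamma>)" unfolding h_def using inj_onD[OF f(2)] F2 SF bc by blast
      then show "\<beta> = \<gamma>" by simp
    qed
    moreover have "(\<lambda>\<beta>. snd (h \<beta>)) ` S \<subseteq> Field s \<times> Field s"
    proof (rule image_subsetI)
      fix \<beta> assume "\<beta> \<in> S"
      then have "snd (h \<beta>) \<in> s - Id" using f4(2)[OF F2, of \<beta>] Sm SF unfolding h_def s_def by auto
      then show "snd (h \<beta>) \<in> Field s \<times> Field s" by (cases "snd (h \<beta>)") (auto intro: FieldI1 FieldI2)
    qed
    ultimately have "|S| \<le>o |Field s \<times> Field s|" unfolding card_of_ordLeq[symmetric] by blast
    also have "|Field s \<times> Field s| \<le>o s"
      using s card_of_Times_ordLeq_infinite_Field[of s "Field s" "Field s"] ordIso_imp_ordLeq[OF card_of_Field_ordIso[OF s(1)]]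
      unfolding cinfinite_def by blast
    also have "s <o lam" unfolding s_def using small[OF mF] .
    finally have "|S| <o lam" .
    then show False using card_of_above[OF lam(1) cinfinite_lam \<alpha>(1)] unfolding S_def by blast
  qed
qed

lemma Q_pairwise_not_equimorphic:
  "\<not> equimorphic (Q1 lam \<kappa>) (Q2 lam \<kappa>)" "\<not> equimorphic (Q1 lam \<kappa>) (Q3 lam \<kappa>)"
  "\<not> equimorphic (Q1 lam \<kappa>) (Q4 lam \<kappa>)" "\<not> equimorphic (Q2 lam \<kappa>) (Q3 lam \<kappa>)"
  "\<not> equimorphic (Q2 lam \<kappa>) (Q4 lam \<kappa>)" "\<not> equimorphic (Q3 lam \<kappa>) (Q4 lam \<kappa>)"
proof -
  have conv: "embeddable (Q2 lam \<kappa>) (Q3 lam \<kappa>) \<longleftrightarrow> embeddable (Q4 lam \<kappa>) (Q1 lam \<kappa>)"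
    "embeddable (Q4 lam \<kappa>) (Q3 lam \<kappa>) \<longleftrightarrow> embeddable (Q2 lam \<kappa>) (Q1 lam \<kappa>)"
    using embeddable_converse[of "Q2 lam \<kappa>" "Q3 lam \<kappa>"] embeddable_converse[of "Q4 lam \<kappa>" "Q3 lam \<kappa>"]
    unfolding Q3_def Q4_def by simp_all
  have "\<not> embeddable (Q2 lam \<kappa>) (Q1 lam \<kappa>)" "\<not> embeddable (Q3 lam \<kappa>) (Q1 lam \<kappa>)" "\<not> embeddable (Q4 lam \<kappa>) (Q1 lam \<kappa>)"
    using wf_if_embeddable[OF _ wf_Q1] not_wf_Q2 not_wf_Q3 not_wf_Q4 by blast+
  then show "\<not> equimorphic (Q1 lam \<kappa>) (Q2 lam \<kappa>)" "\<not> equimorphic (Q1 lam \<kappa>) (Q3 lam \<kappa>)"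
    "\<not> equimorphic (Q1 lam \<kappa>) (Q4 lam \<kappa>)" "\<not> equimorphic (Q2 lam \<kappa>) (Q3 lam \<kappa>)"
    "\<not> equimorphic (Q2 lam \<kappa>) (Q4 lam \<kappa>)" "\<not> equimorphic (Q3 lam \<kappa>) (Q4 lam \<kappa>)"
    using conv Q2_not_embeddable_Q4 unfolding equimorphic_def by blast+
qed

end

theorem mainTheorem2:
  fixes \<nu> :: "'n rel" and lam :: "'l rel"
  assumes "limit_cardinal \<nu>"
    and "natLeq <o \<nu>"
    and "Card_order lam"
    and "lam =o cf \<nu>"
    and "weakly_compact lam"
  shows "(\<forall>(\<kappa> :: 'l \<Rightarrow> 'k rel) (\<kappa>' :: 'l \<Rightarrow> 'm rel).
            succ_family lam \<nu> \<kappa> \<and> succ_family lam \<nu> \<kappa>' \<longrightarrow>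
              equimorphic (Q1 lam \<kappa>) (Q1 lam \<kappa>') \<and>
              equimorphic (Q2 lam \<kappa>) (Q2 lam \<kappa>') \<and>
              equimorphic (Q3 lam \<kappa>) (Q3 lam \<kappa>') \<and>
              equimorphic (Q4 lam \<kappa>) (Q4 lam \<kappa>'))
       \<and> (\<forall>\<kappa> :: 'l \<Rightarrow> 'k rel. succ_family lam \<nu> \<kappa> \<longrightarrow>
              \<not> equimorphic (Q1 lam \<kappa>) (Q2 lam \<kappa>) \<and>
              \<not> equimorphic (Q1 lam \<kappa>) (Q3 lam \<kappa>) \<and>
              \<not> equimorphic (Q1 lam \<kappa>) (Q4 lam \<kappa>) \<and>
              \<not> equimorphic (Q2 lam \<kappa>) (Q3 lam \<kappa>) \<and>
              \<not> equimorphic (Q2 lam \<kappa>) (Q4 lam \<kappa>) \<and>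
              \<not> equimorphic (Q3 lam \<kappa>) (Q4 lam \<kappa>))
       \<and> (\<forall>(\<kappa> :: 'l \<Rightarrow> 'k rel) (P :: 'p rel).
            succ_family lam \<nu> \<kappa> \<and> Partial_order P \<and> (\<forall>A. antichain P A \<longrightarrow> finite A) \<longrightarrow>
              (\<nu> \<le>o Cov P \<longleftrightarrow>
                 embeddable (Q1 lam \<kappa>) P \<or> embeddable (Q2 lam \<kappa>) P \<or>
                 embeddable (Q3 lam \<kappa>) P \<or> embeddable (Q4 lam \<kappa>) P))"
proof (intro conjI allI impI; (elim conjE)?)
  have \<nu>: "Card_order \<nu>" using assms(1) unfolding limit_cardinal_def by blast
  {
    fix \<kappa> :: "'l \<Rightarrow> 'k rel" and \<kappa>' :: "'l \<Rightarrow> 'm rel"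
    assume fam: "succ_family lam \<nu> \<kappa>" "succ_family lam \<nu> \<kappa>'"
    show "equimorphic (Q1 lam \<kappa>) (Q1 lam \<kappa>')" "equimorphic (Q2 lam \<kappa>) (Q2 lam \<kappa>')"
      "equimorphic (Q3 lam \<kappa>) (Q3 lam \<kappa>')" "equimorphic (Q4 lam \<kappa>) (Q4 lam \<kappa>')"
      unfolding equimorphic_def
      using embeddable_Q_Q[OF \<nu> assms(2-4) fam] embeddable_Q_Q[OF \<nu> assms(2-4) fam(2,1)] by blast+
  next
    fix \<kappa> :: "'l \<Rightarrow> 'k rel" assume fam: "succ_family lam \<nu> \<kappa>"
    show "\<not> equimorphic (Q1 lam \<kappa>) (Q2 lam \<kappa>)" "\<not> equimorphic (Q1 lam \<kappa>) (Q3 lam \<kappa>)"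
      "\<not> equimorphic (Q1 lam \<kappa>) (Q4 lam \<kappa>)" "\<not> equimorphic (Q2 lam \<kappa>) (Q3 lam \<kappa>)"
      "\<not> equimorphic (Q2 lam \<kappa>) (Q4 lam \<kappa>)" "\<not> equimorphic (Q3 lam \<kappa>) (Q4 lam \<kappa>)"
      using Q_pairwise_not_equimorphic[OF assms(1-4) fam] .
  next
    fix \<kappa> :: "'l \<Rightarrow> 'k rel" and P :: "'p rel"
    assume fam: "succ_family lam \<nu> \<kappa>" and P: "Partial_order P" and fac: "\<forall>A. antichain P A \<longrightarrow> finite A"
    show "\<nu> \<le>o Cov P \<longleftrightarrow> embeddable (Q1 lam \<kappa>) P \<or> embeddable (Q2 lam \<kappa>) P \<or>
        embeddable (Q3 lam \<kappa>) P \<or> embeddable (Q4 lam \<kappa>) P"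
    proof
      assume "\<nu> \<le>o Cov P"
      then show "embeddable (Q1 lam \<kappa>) P \<or> embeddable (Q2 lam \<kappa>) P \<or>
          embeddable (Q3 lam \<kappa>) P \<or> embeddable (Q4 lam \<kappa>) P"
        using embeddable_Q_if_ordLeq_Cov[OF assms fam P] fac by simp
    qed (rule ordLeq_Cov_if_embeddable_Q[OF \<nu> assms(3) fam P])
  }
qed

end
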